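(* Let $n\ge 1$. Let $q\in[1,\infty)$, $c\in(0,\infty]$, $\mathbf{B}=(\beta_0,\beta_\infty)\in\mathbb{R}^2$ be such that either $q=c=1$ and $\mathbf{B}=(0,0)$, or $1<q<\infty$ and $0<c\le\infty$ (with $\mathbf{B}\in\mathbb{R}^2$ arbitrary). Let $-\infty<\sigma<\infty$, $\mathbf{\Gamma}=(\gamma_0,\gamma_\infty)\in\mathbb{R}^2$, $0<u\le\infty$, $0<b\le\infty$, and $\mathbf{A}=(\alpha_0,\alpha_\infty)\in\mathbb{R}^2$ with $\alpha_0<-\frac1b<\alpha_\infty$. Then $$\dot B_{(q,c;\mathbf{B}),u}^{\sigma+\frac nq,\,\mathbf{\Gamma}+\left(\overleftarrow{\mathbf{A}}-\overleftarrow{\mathbf{B}}+\frac1b\right)}\subset\dot B_{(\infty,b;\mathbf{A}),u}^{\sigma,\mathbf{\Gamma}}.$$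
   Context: Convention: $1/\infty=0$. For a pair $\mathbf{A}=(\alpha_0,\alpha_\infty)\in\mathbb{R}^2$ put $\overleftarrow{\mathbf{A}}=(\alpha_\infty,\alpha_0)$ and, for $s\in\mathbb{R}$, $\mathbf{A}+s=(\alpha_0+s,\alpha_\infty+s)$; pairs are added and subtracted componentwise. The broken-logarithmic function is $l^{\mathbf{A}}(t)=(1+|\ln t|)^{\alpha_0}$ for $0<t\le 1$ and $l^{\mathbf{A}}(t)=(1+|\ln t|)^{\alpha_\infty}$ for $t>1$. For a complex-valued measurable $f$ on $\mathbb{R}^n$, $f^*$ is its non-increasing rearrangement. For $0<p,b\le\infty$, the Lorentz–Zygmund space $L_{p,b;\mathbf{A}}=L_{p,b;\mathbf{A}}(\mathbb{R}^n)$ consists of all measurable $f$ with $\|f\|_{p,b;\mathbf{A}}:=\left\|t^{\frac1p-\frac1b}l^{\mathbf{A}}(t)f^*(t)\right\|_{L_b(0,\infty)}<\infty$. $S$ and $S'$ are the Schwartz space and the space of tempered distributions on $\mathbb{R}^n$; $\mathcal{F}$ is the Fourier transform, $\mathcal{F}f(\xi)=\int e^{-2\pi i x\xi}f(x)\,dx$, extended to $S'$. Fix $\varphi\in S$ with $\operatorname{supp}\varphi=\{\xi:2^{-1}\le|\xi|\le2\}$, $\varphi(\xi)>0$ for $2^{-1}<|\xi|<2$, and $\sum_{k=-\infty}^\infty\varphi(2^{-k}\xi)=1$ for $\xi\ne0$. Put $\varphi_k(\xi)=\varphi(2^{-k}\xi)$ ($k\in\mathbb{Z}$). For $\sigma\in\mathbb{R}$,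 $0<p,b,u\le\infty$, $\mathbf{A},\mathbf{\Gamma}\in\mathbb{R}^2$ with $L_{p,b;\mathbf{A}}\neq\{0\}$, the homogeneous Besov-type space $\dot B^{\sigma,\mathbf{\Gamma}}_{(p,b;\mathbf{A}),u}$ consists of all $f\in S'$ with finite semi-(quasi-)norm $$\|f\|_{\dot B^{\sigma,\mathbf{\Gamma}}_{(p,b;\mathbf{A}),u}}=\left\{\sum_{k=-\infty}^\infty\left(2^{\sigma k}l^{\mathbf{\Gamma}}(2^k)\|\mathcal{F}^{-1}(\varphi_k\mathcal{F}f)\|_{p,b;\mathbf{A}}\right)^u\right\}^{1/u}$$ (supremum over $k\in\mathbb{Z}$ if $u=\infty$). $X\subset Y$ means continuous embedding: every $f\in X$ is in $Y$ and $\|f\|_Y\le C\|f\|_X$ with $C$ independent of $f$. *)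

theory Defs
  imports "HOL-Analysis.Analysis" "HOL-Probability.Essential_Supremum"
begin

section \<open>Extended exponents and broken logarithms\<close>

text \<open>The convention \<open>1/\<infinity> = 0\<close> is the one of \<^typ>\<open>ennreal\<close>. Only exponents in \<open>(0,\<infinity>]\<close> are used.\<close>

definition recip :: "ennreal \<Rightarrow> real" where
  "recip p = enn2real (1 / p)"

text \<open>Real powers on \<open>[0,\<infinity>]\<close>, meant for positive exponents only.\<close>

definition ennpowr :: "ennreal \<Rightarrow> real \<Rightarrow> ennreal" where
  "ennpowr x r = (if x = \<infinity> then \<infinity> else ennreal (enn2real x powr r))"

text \<open>A pair \<open>(\<alpha>\<^sub>0, \<alpha>\<^sub>\<infinity>)\<close> is an element of \<^typ>\<open>real \<times> real\<close>, with the componentwise operations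
  of the library; its reversal is \<^const>\<open>prod.swap\<close>.\<close>

definition broken_log :: "real \<times> real \<Rightarrow> real \<Rightarrow> real" where
  "broken_log A t = (1 + \<bar>ln t\<bar>) powr (if t \<le> 1 then fst A else snd A)"

definition pair_shift :: "real \<times> real \<Rightarrow> real \<Rightarrow> real \<times> real" where
  "pair_shift A s = (fst A + s, snd A + s)"


section \<open>Lorentz--Zygmund quasi-norms\<close>

definition rearrangement :: "('a::euclidean_space \<Rightarrow> complex) \<Rightarrow> real \<Rightarrow> ennreal" where
  "rearrangement f t = Inf {s. emeasure lebesgue {x. s < ennreal (norm (f x))} \<le> ennreal t}"

definition Lp_qnorm :: "'b measure \<Rightarrow> ennreal \<Rightarrow> ('b \<Rightarrow> ennreal) \<Rightarrow> ennreal" where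
  "Lp_qnorm M b h =
     (if b = \<infinity> then esssup M h
      else ennpowr (\<integral>\<^sup>+ t. ennpowr (h t) (enn2real b) \<partial>M) (recip b))"

definition lz_qnorm ::
  "ennreal \<Rightarrow> ennreal \<Rightarrow> real \<times> real \<Rightarrow> ('a::euclidean_space \<Rightarrow> complex) \<Rightarrow> ennreal" where
  "lz_qnorm p b A f =
     Lp_qnorm (lebesgue_on {0<..}) b
       (\<lambda>t. ennreal (t powr (recip p - recip b) * broken_log A t) * rearrangement f t)"


section \<open>Schwartz functions and tempered distributions\<close>

fun mixed_partial :: "'a::euclidean_space list \<Rightarrow> ('a \<Rightarrow> complex) \<Rightarrow> 'a \<Rightarrow> complex" where
  "mixed_partial [] f = f"
| "mixed_partial (v # vs) f = (\<lambda>x. frechet_derivative (mixed_partial vs f) (at x) v)"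

definition smooth :: "('a::euclidean_space \<Rightarrow> complex) \<Rightarrow> bool" where
  "smooth f \<longleftrightarrow> (\<forall>vs\<in>lists Basis. \<forall>x. mixed_partial vs f differentiable (at x))"

definition schwartz :: "('a::euclidean_space \<Rightarrow> complex) \<Rightarrow> bool" where
  "schwartz f \<longleftrightarrow> smooth f \<and>
     (\<forall>m. \<forall>vs\<in>lists Basis. bounded (range (\<lambda>x. (1 + norm x) ^ m *\<^sub>R mixed_partial vs f x)))"

definition schwartz_seminorm :: "nat \<Rightarrow> ('a::euclidean_space \<Rightarrow> complex) \<Rightarrow> real" where
  "schwartz_seminorm N f =
     (SUP (vs, x) \<in> {vs \<in> lists Basis. length vs \<le> N} \<times> UNIV.
        (1 + norm x) ^ N * norm (mixed_partial vs f x))"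

text \<open>A tempered distribution is given by a functional on all functions of which only the values
  on Schwartz functions matter.\<close>

type_synonym 'a functional = "('a \<Rightarrow> complex) \<Rightarrow> complex"

definition tempered :: "('a::euclidean_space) functional \<Rightarrow> bool" where
  "tempered T \<longleftrightarrow>
     (\<forall>f g a b. schwartz f \<longrightarrow> schwartz g \<longrightarrow> T (\<lambda>x. a * f x + b * g x) = a * T f + b * T g) \<and>
     (\<exists>C N. \<forall>f. schwartz f \<longrightarrow> norm (T f) \<le> C * schwartz_seminorm N f)"

definition fourier :: "('a::euclidean_space \<Rightarrow> complex) \<Rightarrow> 'a \<Rightarrow> complex" where
  "fourier f \<xi> = (\<integral>x. exp (- 2 * pi * \<i> * complex_of_real (x \<bullet> \<xi>)) * f x \<partial>lborel)"

definition inv_fourier :: "('a::euclidean_space \<Rightarrow> complex) \<Rightarrow> 'a \<Rightarrow> complex" where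
  "inv_fourier f x = (\<integral>\<xi>. exp (2 * pi * \<i> * complex_of_real (x \<bullet> \<xi>)) * f \<xi> \<partial>lborel)"

definition dist_fourier :: "('a::euclidean_space) functional \<Rightarrow> 'a functional" where
  "dist_fourier T = (\<lambda>\<psi>. T (fourier \<psi>))"

definition dist_inv_fourier :: "('a::euclidean_space) functional \<Rightarrow> 'a functional" where
  "dist_inv_fourier T = (\<lambda>\<psi>. T (inv_fourier \<psi>))"

definition dist_mult :: "('a::euclidean_space \<Rightarrow> complex) \<Rightarrow> 'a functional \<Rightarrow> 'a functional" where
  "dist_mult m T = (\<lambda>\<psi>. T (\<lambda>x. m x * \<psi> x))"

definition represents :: "('a::euclidean_space \<Rightarrow> complex) \<Rightarrow> 'a functional \<Rightarrow> bool" where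
  "represents g T \<longleftrightarrow> g \<in> borel_measurable lebesgue \<and>
     (\<forall>\<psi>. schwartz \<psi> \<longrightarrow> integrable lebesgue (\<lambda>x. g x * \<psi> x) \<and>
                        T \<psi> = (\<integral>x. g x * \<psi> x \<partial>lebesgue))"

text \<open>The representing function is unique almost everywhere and the quasi-norm only depends on its
  class, so the infimum is the quasi-norm of that function; it is \<open>\<infinity>\<close> if there is none.\<close>

definition dist_lz_qnorm ::
  "ennreal \<Rightarrow> ennreal \<Rightarrow> real \<times> real \<Rightarrow> ('a::euclidean_space) functional \<Rightarrow> ennreal" where
  "dist_lz_qnorm p b A T = (INF g \<in> {g. represents g T}. lz_qnorm p b A g)"


section \<open>Homogeneous Besov-type spaces\<close>

definition dyadic_generator :: "('a::euclidean_space \<Rightarrow> real) \<Rightarrow> bool" where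
  "dyadic_generator \<phi> \<longleftrightarrow>
     schwartz (\<lambda>\<xi>. complex_of_real (\<phi> \<xi>)) \<and>
     closure {\<xi>. \<phi> \<xi> \<noteq> 0} = {\<xi>. 1/2 \<le> norm \<xi> \<and> norm \<xi> \<le> 2} \<and>
     (\<forall>\<xi>. 1/2 < norm \<xi> \<and> norm \<xi> < 2 \<longrightarrow> 0 < \<phi> \<xi>) \<and>
     (\<forall>\<xi>. \<xi> \<noteq> 0 \<longrightarrow> ((\<lambda>k::int. \<phi> ((2 powi (- k)) *\<^sub>R \<xi>)) has_sum 1) UNIV)"

definition lp_block ::
  "('a::euclidean_space \<Rightarrow> real) \<Rightarrow> int \<Rightarrow> 'a functional \<Rightarrow> 'a functional" where
  "lp_block \<phi> k T =
     dist_inv_fourier (dist_mult (\<lambda>\<xi>. complex_of_real (\<phi> ((2 powi (- k)) *\<^sub>R \<xi>))) (dist_fourier T))"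

definition besov_qnorm ::
  "('a::euclidean_space \<Rightarrow> real) \<Rightarrow> real \<Rightarrow> real \<times> real \<Rightarrow> ennreal \<Rightarrow> ennreal \<Rightarrow> real \<times> real \<Rightarrow>
   ennreal \<Rightarrow> 'a functional \<Rightarrow> ennreal" where
  "besov_qnorm \<phi> \<sigma> \<Gamma> p b A u T =
     (let a = (\<lambda>k::int. ennreal (2 powr (\<sigma> * real_of_int k) * broken_log \<Gamma> (2 powi k)) *
                        dist_lz_qnorm p b A (lp_block \<phi> k T))
      in if u = \<infinity> then (SUP k. a k)
         else ennpowr (\<Sum>\<^sub>\<infinity>k. ennpowr (a k) (enn2real u)) (recip u))"

text \<open>Spaces of tempered distributions are given by their semi-(quasi-)norm.\<close>

definition tempered_space :: "(('a::euclidean_space) functional \<Rightarrow> ennreal) \<Rightarrow> 'a functional set" where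
  "tempered_space N = {T. tempered T \<and> N T < \<infinity>}"

definition continuously_embedded ::
  "(('a::euclidean_space) functional \<Rightarrow> ennreal) \<Rightarrow> ('a functional \<Rightarrow> ennreal) \<Rightarrow> bool" where
  "continuously_embedded N\<^sub>X N\<^sub>Y \<longleftrightarrow>
     tempered_space N\<^sub>X \<subseteq> tempered_space N\<^sub>Y \<and>
     (\<exists>C::real. \<forall>T \<in> tempered_space N\<^sub>X. N\<^sub>Y T \<le> ennreal C * N\<^sub>X T)"

end

theory Submission
  imports Defs "HOL-Probability.Characteristic_Functions" "HOL-Probability.Sinc_Integral"
begin

text \<open>Everything reduces to a Nikolskii inequality for a single dyadic block. Let \<open>K\<close> be a rapidly
  decreasing kernel whose Fourier transform is \<open>1\<close> on the support of \<open>\<phi>\<close> (a sum of five dilates of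
  the inverse transform of \<open>\<phi>\<close>), and let \<open>K\<^sub>k\<close> be its \<open>L\<^sub>1\<close>-normalised dilate by \<open>2\<^sup>k\<close>. If \<open>g\<close> represents the
  \<open>k\<close>-th block, then so does \<open>K\<^sub>k * g\<close>. With \<open>r = 2\<^sup>-\<^sup>k\<^sup>n\<close> and the averages
  \<open>g\<^sup>*\<^sup>*(t) = t\<^sup>-\<^sup>1 \<integral>\<^sub>0\<^sup>t g\<^sup>*\<close>, cutting \<open>g\<close> at height \<open>g\<^sup>*(t)\<close> shows
  \<open>(K\<^sub>k * g)\<^sup>*(t) \<le> C g\<^sup>*\<^sup>*(max r t)\<close>. The hypotheses on \<open>q\<close>, \<open>c\<close>, \<open>B\<close> give
  \<open>g\<^sup>*\<^sup>*(t) \<le> C w(t) \<parallel>g\<parallel>\<close> with \<open>w(t) = t\<^sup>-\<^sup>1\<^sup>/\<^sup>q l\<^sup>-\<^sup>B(t)\<close>, so that only the explicit function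
  \<open>w(max r t)\<close> has to be integrated against \<open>t\<^sup>-\<^sup>1\<^sup>/\<^sup>b l\<^sup>A(t)\<close>. The part \<open>t \<le> r\<close> produces the
  extra factor \<open>(1 + \<bar>ln r\<bar>)\<^sup>1\<^sup>/\<^sup>b\<close>.\<close>


section \<open>Lebesgue integrals\<close>

lemma lborel_integral_affine:
  fixes f :: "'a::euclidean_space \<Rightarrow> 'b::{banach,second_countable_topology}"
  assumes [measurable]: "f \<in> borel_measurable borel" and "c \<noteq> 0"
  shows "(\<integral>x. f x \<partial>lborel) = \<bar>c\<bar> ^ DIM('a) *\<^sub>R (\<integral>x. f (t + c *\<^sub>R x) \<partial>lborel)"
  by (subst lborel_affine[OF \<open>c \<noteq> 0\<close>, of t]) (simp add: integral_density integral_distr)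

lemma nn_integral_lborel_affine:
  fixes f :: "'a::euclidean_space \<Rightarrow> ennreal"
  assumes [measurable]: "f \<in> borel_measurable borel" and "c \<noteq> 0"
  shows "(\<integral>\<^sup>+x. f x \<partial>lborel) = ennreal (\<bar>c\<bar> ^ DIM('a)) * (\<integral>\<^sup>+x. f (t + c *\<^sub>R x) \<partial>lborel)"
  by (subst lborel_affine[OF \<open>c \<noteq> 0\<close>, of t]) (simp add: nn_integral_density nn_integral_distr nn_integral_cmult)

lemma lborel_integral_translate:
  fixes f :: "'a::euclidean_space \<Rightarrow> 'b::{banach,second_countable_topology}"
  assumes "f \<in> borel_measurable borel"
  shows "(\<integral>x. f (t + x) \<partial>lborel) = (\<integral>x. f x \<partial>lborel)"
  using lborel_integral_affine[OF assms, of 1 t] by simp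

lemma integrable_lborel_affine:
  fixes f :: "'a::euclidean_space \<Rightarrow> 'b::{banach,second_countable_topology}"
  assumes f: "integrable lborel f" and c: "c \<noteq> 0"
  shows "integrable lborel (\<lambda>x. f (t + c *\<^sub>R x))"
proof -
  have [measurable]: "f \<in> borel_measurable borel" using f by auto
  show ?thesis
    using f c unfolding integrable_iff_bounded
    by (auto simp: nn_integral_lborel_affine[of "\<lambda>x. ennreal (norm (f x))" c t] ennreal_mult_less_top)
qed

lemma
  fixes f :: "'a::euclidean_space \<Rightarrow> real \<Rightarrow> 'b::{real_normed_field,banach,second_countable_topology}"
  assumes f: "\<And>b. b \<in> Basis \<Longrightarrow> integrable lborel (f b)"
  shows integrable_lborel_prod: "integrable lborel (\<lambda>x::'a. \<Prod>b\<in>Basis. f b (x \<bullet> b))"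
    and integral_lborel_prod: "(\<integral>(x::'a). (\<Prod>b\<in>Basis. f b (x \<bullet> b)) \<partial>lborel) = (\<Prod>b\<in>Basis. \<integral>x. f b x \<partial>lborel)"
proof -
  interpret product_sigma_finite "\<lambda>_::'a. lborel :: real measure" ..
  have [measurable]: "f b \<in> borel_measurable borel" if "b \<in> Basis" for b using f[OF that] by auto
  have "integrable (\<Pi>\<^sub>M b\<in>Basis. lborel) (\<lambda>x. \<Prod>b\<in>Basis. f b (x b))"
    by (intro product_integrable_prod f) auto
  then show "integrable lborel (\<lambda>x::'a. \<Prod>b\<in>Basis. f b (x \<bullet> b))"
    by (subst lborel_eq) (simp add: integrable_distr_eq cong: prod.cong)
  have "(\<integral>x. (\<Prod>b\<in>Basis. f b (x b)) \<partial>(\<Pi>\<^sub>M b\<in>Basis. lborel)) = (\<Prod>b\<in>Basis. \<integral>x. f b x \<partial>lborel)"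
    by (intro product_integral_prod f) auto
  then show "(\<integral>(x::'a). (\<Prod>b\<in>Basis. f b (x \<bullet> b)) \<partial>lborel) = (\<Prod>b\<in>Basis. \<integral>x. f b x \<partial>lborel)"
    by (subst lborel_eq) (simp add: integral_distr cong: prod.cong)
qed

lemma integrable_lborel_pairI:
  fixes F :: "'a::euclidean_space \<Rightarrow> 'b::euclidean_space \<Rightarrow> 'c::{banach,second_countable_topology}"
  assumes F[measurable]: "case_prod F \<in> borel_measurable (lborel \<Otimes>\<^sub>M lborel)"
    and bound: "(\<integral>\<^sup>+x. \<integral>\<^sup>+y. ennreal (norm (F x y)) \<partial>lborel \<partial>lborel) < \<infinity>"
  shows "integrable (lborel \<Otimes>\<^sub>M lborel) (case_prod F)"
proof (rule integrableI_bounded[OF F])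
  have "(\<integral>\<^sup>+p. ennreal (norm (case_prod F p)) \<partial>(lborel \<Otimes>\<^sub>M lborel))
     = (\<integral>\<^sup>+x. \<integral>\<^sup>+y. ennreal (norm (F x y)) \<partial>lborel \<partial>lborel)"
    by (subst lborel.nn_integral_fst[symmetric]) auto
  then show "(\<integral>\<^sup>+p. ennreal (norm (case_prod F p)) \<partial>(lborel \<Otimes>\<^sub>M lborel)) < \<infinity>" using bound by simp
qed

lemma integral_dominated_convergence_at:
  fixes f :: "'a::first_countable_topology \<Rightarrow> 'b \<Rightarrow> 'c::{banach,second_countable_topology}"
  assumes "\<And>h. f h \<in> borel_measurable M" "l \<in> borel_measurable M" "integrable M B"
    and bound: "\<And>h z. h \<noteq> a \<Longrightarrow> norm (f h z) \<le> B z"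
    and lim: "\<And>z. ((\<lambda>h. f h z) \<longlongrightarrow> l z) (at a)"
  shows "((\<lambda>h. \<integral>z. f h z \<partial>M) \<longlongrightarrow> (\<integral>z. l z \<partial>M)) (at a)"
  unfolding tendsto_at_iff_sequentially comp_def
proof (intro allI impI)
  fix X :: "nat \<Rightarrow> 'a" assume X: "\<forall>i. X i \<in> UNIV - {a}" "X \<longlonglongrightarrow> a"
  then have "filterlim X (at a) sequentially" by (auto simp: filterlim_at)
  then have "(\<lambda>i. f (X i) z) \<longlonglongrightarrow> l z" for z by (rule filterlim_compose[OF lim])
  moreover have "norm (f (X i) z) \<le> B z" for i z using X(1) by (intro bound) auto
  ultimately show "(\<lambda>i. \<integral>z. f (X i) z \<partial>M) \<longlonglongrightarrow> (\<integral>z. l z \<partial>M)"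
    by (intro integral_dominated_convergence[where w = B] AE_I2) (simp_all add: assms(1-3))
qed

lemma bounded_linear_lebesgue_integral:
  fixes L :: "'b \<Rightarrow> 'a::real_normed_vector \<Rightarrow> 'c::{banach,second_countable_topology}"
  assumes linear: "\<And>z. linear (L z)" and integrable: "\<And>h. integrable M (\<lambda>z. L z h)"
    and bound: "\<And>z h. norm (L z h) \<le> B z * norm h" and B: "integrable M B"
  shows "bounded_linear (\<lambda>h. \<integral>z. L z h \<partial>M)"
proof (rule bounded_linear_intro)
  fix h
  have "norm (\<integral>z. L z h \<partial>M) \<le> (\<integral>z. norm (L z h) \<partial>M)" by (rule integral_norm_bound)
  also have "\<dots> \<le> (\<integral>z. norm h * B z \<partial>M)"
    using integrable B bound by (intro integral_mono) (auto simp: mult.commute)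
  finally show "norm (\<integral>z. L z h \<partial>M) \<le> norm h * (\<integral>z. B z \<partial>M)" by simp
qed (simp_all add: integrable linear_add[OF linear] linear_scale[OF linear])

lemma has_derivative_lebesgue_integral:
  fixes f :: "'b \<Rightarrow> 'a::euclidean_space \<Rightarrow> 'c::{banach,second_countable_topology}"
  assumes f: "\<And>y. integrable M (\<lambda>z. f z y)"
    and deriv: "\<And>z y. (f z has_derivative f' z y) (at y)"
    and f': "\<And>y h. (\<lambda>z. f' z y h) \<in> borel_measurable M"
    and bound: "\<And>z y h. norm (f' z y h) \<le> B z * norm h" and B: "integrable M B"
  shows "((\<lambda>y. \<integral>z. f z y \<partial>M) has_derivative (\<lambda>h. \<integral>z. f' z y h \<partial>M)) (at y)"
proof -
  have [measurable]: "(\<lambda>z. f z y) \<in> borel_measurable M" "(\<lambda>z. f' z y h) \<in> borel_measurable M" for y h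
    using f f' by auto
  have f'_integrable: "integrable M (\<lambda>z. f' z y h)" for h
  proof (rule Bochner_Integration.integrable_bound)
    show "integrable M (\<lambda>z. B z * norm h)" using B by simp
    show "AE z in M. norm (f' z y h) \<le> norm (B z * norm h)"
      by (intro AE_I2 order_trans[OF bound]) simp
  qed measurable
  define R where "R h z = (f z (y + h) - f z y - f' z y h) /\<^sub>R norm h" for h z
  have R_le: "norm (R h z) \<le> 2 * B z" if "h \<noteq> 0" for h z
  proof -
    have "norm (f z (y + h) - f z y) \<le> B z * norm (y + h - y)"
      by (rule differentiable_bound[of UNIV "f z" "f' z"]) (simp_all add: deriv bound onorm_le)
    then have "norm (f z (y + h) - f z y - f' z y h) \<le> 2 * B z * norm h"
      using norm_triangle_ineq4[of "f z (y + h) - f z y" "f' z y h"] bound[of z y h] by simp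
    then show ?thesis unfolding R_def norm_scaleR using that by (simp add: field_simps)
  qed
  have "(\<lambda>h. \<integral>z. R h z \<partial>M) \<midarrow>0\<rightarrow> (\<integral>z. 0 \<partial>M)"
  proof (rule integral_dominated_convergence_at[OF _ _ _ R_le])
    show "(\<lambda>h. R h z) \<midarrow>0\<rightarrow> 0" for z
    proof (rule tendsto_norm_zero_cancel)
      show "(\<lambda>h. norm (R h z)) \<midarrow>0\<rightarrow> 0"
        using deriv[of z y] by (simp add: has_derivative_at R_def divide_inverse_commute)
    qed
  qed (use B in \<open>simp_all add: R_def\<close>)
  then have "(\<lambda>h. norm (\<integral>z. R h z \<partial>M)) \<midarrow>0\<rightarrow> 0" by (intro tendsto_norm_zero) simp
  moreover have "norm (\<integral>z. R h z \<partial>M)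
      = norm ((\<integral>z. f z (y + h) \<partial>M) - (\<integral>z. f z y \<partial>M) - (\<integral>z. f' z y h \<partial>M)) / norm h" for h
    unfolding R_def integral_scaleR_right
    by (simp add: Bochner_Integration.integral_diff Bochner_Integration.integrable_diff f f'_integrable
        divide_inverse_commute)
  moreover have "bounded_linear (\<lambda>h. \<integral>z. f' z y h \<partial>M)"
    by (rule bounded_linear_lebesgue_integral[OF has_derivative_linear[OF deriv] f'_integrable bound B])
  ultimately show ?thesis by (simp only: has_derivative_at)
qed


section \<open>Broken logarithms\<close>

lemma powr_le_powr_abs_mult:
  fixes x y c e :: real
  assumes "0 < x" "0 < y" and xy: "x \<le> c * y" and yx: "y \<le> c * x"
  shows "x powr e \<le> c powr \<bar>e\<bar> * y powr e"
proof (cases "0 \<le> e")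
  case True
  then show ?thesis
    using powr_mono2[OF True _ xy] assms(1) by (simp add: powr_mult)
next
  case False
  have "0 < c"
    using assms(1,2) xy by (metis less_le_trans zero_less_mult_pos2)
  have "c powr e * x powr e \<le> y powr e"
    using powr_mono2'[of e y "c * x"] False yx assms(2) by (simp add: powr_mult)
  then show ?thesis
    using False \<open>0 < c\<close> by (simp add: powr_minus field_simps)
qed

lemma broken_log_pos: "0 < broken_log A t"
  unfolding broken_log_def by (simp add: add_pos_nonneg less_imp_neq[symmetric])

lemma broken_log_measurable [measurable]: "broken_log A \<in> borel_measurable borel"
  unfolding broken_log_def[abs_def] by measurable

lemma broken_log_add: "broken_log (A + B) t = broken_log A t * broken_log B t"
  by (simp add: broken_log_def powr_add)

lemma broken_log_powr: "broken_log A t powr p = broken_log (p *\<^sub>R A) t"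
  by (simp add: broken_log_def powr_powr mult.commute)

lemma broken_log_pair_shift: "broken_log (pair_shift A s) t = broken_log A t * (1 + \<bar>ln t\<bar>) powr s"
  by (simp add: broken_log_def pair_shift_def powr_add)

lemma broken_log_inverse:
  assumes "0 < t"
  shows "broken_log A (1 / t) = broken_log (prod.swap A) t"
  using assms by (cases "t = 1") (auto simp: broken_log_def ln_div divide_le_eq)

lemma broken_log_power_le:
  assumes n: "1 \<le> n" and t: "0 < t"
  shows "broken_log A (t ^ n) \<le> real n powr (\<bar>fst A\<bar> + \<bar>snd A\<bar>) * broken_log A t"
proof -
  define e where "e = (if t \<le> 1 then fst A else snd A)"
  have side: "t ^ n \<le> 1 \<longleftrightarrow> t \<le> 1"
    using n t by (metis linorder_not_le one_less_power power_le_one less_imp_le zero_less_one less_le_trans)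
  have "\<bar>ln t\<bar> \<le> real n * \<bar>ln t\<bar>"
    using n mult_right_mono[of 1 "real n" "\<bar>ln t\<bar>"] by simp
  then have "(1 + real n * \<bar>ln t\<bar>) powr e \<le> real n powr \<bar>e\<bar> * (1 + \<bar>ln t\<bar>) powr e"
    using n mult_right_mono[of 1 "real n" "1 + real n * \<bar>ln t\<bar>"]
    by (intro powr_le_powr_abs_mult) (auto simp: algebra_simps add_pos_nonneg)
  also have "\<dots> \<le> real n powr (\<bar>fst A\<bar> + \<bar>snd A\<bar>) * (1 + \<bar>ln t\<bar>) powr e"
    using n by (intro mult_right_mono powr_mono) (auto simp: e_def)
  finally show ?thesis
    using t by (simp add: broken_log_def e_def side ln_realpow abs_mult)
qed

lemma one_plus_abs_ln_le:
  fixes s t :: real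
  assumes "0 < s" "0 < t"
  shows "1 + \<bar>ln t\<bar> \<le> (1 + \<bar>ln (t / s)\<bar>) * (1 + \<bar>ln s\<bar>)"
proof -
  have "(1 + \<bar>ln (t / s)\<bar>) * (1 + \<bar>ln s\<bar>) = 1 + (\<bar>ln (t / s)\<bar> + \<bar>ln s\<bar>) + \<bar>ln (t / s)\<bar> * \<bar>ln s\<bar>"
    by (simp add: algebra_simps)
  moreover have "\<bar>ln t\<bar> \<le> \<bar>ln (t / s)\<bar> + \<bar>ln s\<bar>"
    using assms by (simp add: ln_div)
  ultimately show ?thesis using mult_nonneg_nonneg[of "\<bar>ln (t / s)\<bar>" "\<bar>ln s\<bar>"] by linarith
qed

lemma broken_log_le_quotient:
  assumes s: "0 < s" and t: "0 < t"
  shows "broken_log A t \<le> (1 + \<bar>ln (t / s)\<bar>) powr (\<bar>fst A\<bar> + \<bar>snd A\<bar>) * broken_log A s"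
proof -
  define R where "R = 1 + \<bar>ln (t / s)\<bar>"
  have R: "1 \<le> R" by (simp add: R_def)
  have ln: "ln (t / s) = ln t - ln s" using s t by (simp add: ln_div)
  have powr_same_side: "(1 + \<bar>ln t\<bar>) powr e \<le> R powr (\<bar>fst A\<bar> + \<bar>snd A\<bar>) * (1 + \<bar>ln s\<bar>) powr e"
    if "\<bar>e\<bar> \<le> \<bar>fst A\<bar> + \<bar>snd A\<bar>" for e
  proof -
    have "(1 + \<bar>ln t\<bar>) powr e \<le> R powr \<bar>e\<bar> * (1 + \<bar>ln s\<bar>) powr e"
      using one_plus_abs_ln_le[OF s t] one_plus_abs_ln_le[OF t s] s t
      by (intro powr_le_powr_abs_mult) (auto simp: R_def ln_div add_pos_nonneg abs_minus_commute)
    also have "\<dots> \<le> R powr (\<bar>fst A\<bar> + \<bar>snd A\<bar>) * (1 + \<bar>ln s\<bar>) powr e"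
      using that R by (intro mult_right_mono powr_mono) auto
    finally show ?thesis .
  qed
  have opposite_sides: "(1 + \<bar>ln t\<bar>) powr d \<le> R powr (\<bar>d\<bar> + \<bar>e\<bar>) * (1 + \<bar>ln s\<bar>) powr e"
    if "(ln t \<le> 0 \<and> 0 \<le> ln s) \<or> (0 \<le> ln t \<and> ln s \<le> 0)" for d e
  proof -
    have "(1 + \<bar>ln t\<bar>) powr d \<le> R powr \<bar>d\<bar> * 1 powr d"
      using that by (intro powr_le_powr_abs_mult) (auto simp: R_def ln algebra_simps add_pos_nonneg)
    moreover have "1 powr e \<le> R powr \<bar>e\<bar> * (1 + \<bar>ln s\<bar>) powr e"
      using that R mult_mono[of 1 R 1 "1 + \<bar>ln s\<bar>"]
      by (intro powr_le_powr_abs_mult) (auto simp: R_def ln algebra_simps add_pos_nonneg)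
    ultimately have "(1 + \<bar>ln t\<bar>) powr d * 1 \<le> R powr \<bar>d\<bar> * (R powr \<bar>e\<bar> * (1 + \<bar>ln s\<bar>) powr e)"
      by (intro mult_mono) auto
    then show ?thesis by (simp add: powr_add mult_ac)
  qed
  consider (same_side) "t \<le> 1 \<longleftrightarrow> s \<le> 1" | (t_below) "t \<le> 1" "1 < s" | (s_below) "1 < t" "s \<le> 1"
    by linarith
  then show ?thesis
  proof cases
    case same_side
    then show ?thesis using powr_same_side by (auto simp: broken_log_def R_def)
  next
    case t_below
    then show ?thesis using opposite_sides[of "fst A" "snd A"] s t by (simp add: broken_log_def R_def)
  next
    case s_below
    then show ?thesis using opposite_sides[of "snd A" "fst A"] s t
      by (simp add: broken_log_def R_def add.commute)
  qed
qed

lemma broken_log_mono: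
  assumes A: "fst A \<le> 0" "0 \<le> snd A" and t: "0 < t" "t \<le> r"
  shows "broken_log A t \<le> broken_log A r"
proof -
  have ln: "ln t \<le> ln r" using t by simp
  consider (below) "r \<le> 1" | (across) "t \<le> 1" "1 < r" | (above) "1 < t" by linarith
  then show ?thesis
  proof cases
    case below
    then have "ln r \<le> 0" using t by simp
    then have "ln r < 1" by linarith
    then show ?thesis using below t ln A by (auto simp: broken_log_def intro!: powr_mono2')
  next
    case across
    then have "broken_log A t \<le> 1"
      using A powr_mono[of "fst A" 0 "1 + \<bar>ln t\<bar>"] by (simp add: broken_log_def add_nonneg_eq_0_iff)
    also have "1 \<le> broken_log A r"
      using across A by (auto simp: broken_log_def intro!: ge_one_powr_ge_zero)
    finally show ?thesis .
  next
    case above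
    then show ?thesis using t ln A by (auto simp: broken_log_def intro!: powr_mono2)
  qed
qed

lemma one_plus_powr_le_exp:
  fixes a \<epsilon> :: real
  assumes "0 \<le> a" "0 < \<epsilon>"
  obtains C where "0 < C" "\<And>y. 0 \<le> y \<Longrightarrow> (1 + y) powr a \<le> C * exp (\<epsilon> * y)"
proof
  define b where "b = a + 1"
  have b: "0 < b" using assms by (simp add: b_def)
  show "0 < exp (\<epsilon> - b - b * ln (\<epsilon> / b))" by simp
  fix y :: real assume y: "0 \<le> y"
  have "ln (1 + y) = ln (\<epsilon> / b * (1 + y)) - ln (\<epsilon> / b)"
    using assms b y by (subst ln_mult_pos) auto
  also have "\<dots> \<le> \<epsilon> / b * (1 + y) - 1 - ln (\<epsilon> / b)"
    using assms b y by (intro diff_right_mono ln_le_minus_one) auto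
  finally have "b * ln (1 + y) \<le> b * (\<epsilon> / b * (1 + y) - 1 - ln (\<epsilon> / b))"
    using b by (intro mult_left_mono) auto
  also have "\<dots> = (\<epsilon> - b - b * ln (\<epsilon> / b)) + \<epsilon> * y"
    using b by (simp add: field_simps)
  finally have "(1 + y) powr b \<le> exp (\<epsilon> - b - b * ln (\<epsilon> / b)) * exp (\<epsilon> * y)"
    using y by (simp add: powr_def flip: exp_add)
  moreover have "(1 + y) powr a \<le> (1 + y) powr b"
    using y by (intro powr_mono) (auto simp: b_def)
  ultimately show "(1 + y) powr a \<le> exp (\<epsilon> - b - b * ln (\<epsilon> / b)) * exp (\<epsilon> * y)"
    by (rule order_trans[rotated])
qed

lemma broken_log_potter:
  assumes "0 < \<epsilon>"
  obtains C where "0 < C"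
    "\<And>s t. 0 < s \<Longrightarrow> s \<le> t \<Longrightarrow> broken_log A t \<le> C * broken_log A s * (t / s) powr \<epsilon>"
    "\<And>s t. 0 < s \<Longrightarrow> s \<le> t \<Longrightarrow> broken_log A s \<le> C * broken_log A t * (t / s) powr \<epsilon>"
proof -
  obtain C where C: "0 < C" "\<And>y. 0 \<le> y \<Longrightarrow> (1 + y) powr (\<bar>fst A\<bar> + \<bar>snd A\<bar>) \<le> C * exp (\<epsilon> * y)"
    using one_plus_powr_le_exp[of "\<bar>fst A\<bar> + \<bar>snd A\<bar>" \<epsilon>] assms by auto
  have bound: "broken_log A t \<le> C * broken_log A s * exp (\<epsilon> * \<bar>ln (t / s)\<bar>)" if "0 < s" "0 < t" for s t
  proof -
    have "broken_log A t \<le> (1 + \<bar>ln (t / s)\<bar>) powr (\<bar>fst A\<bar> + \<bar>snd A\<bar>) * broken_log A s"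
      by (rule broken_log_le_quotient[OF that])
    also have "\<dots> \<le> (C * exp (\<epsilon> * \<bar>ln (t / s)\<bar>)) * broken_log A s"
      by (intro mult_right_mono C less_imp_le[OF broken_log_pos]) simp
    finally show ?thesis by (simp add: mult_ac)
  qed
  show ?thesis
  proof (rule that[OF C(1)])
    fix s t :: real assume st: "0 < s" "s \<le> t"
    show "broken_log A t \<le> C * broken_log A s * (t / s) powr \<epsilon>"
      using bound[of s t] st by (simp add: powr_def ln_div)
    show "broken_log A s \<le> C * broken_log A t * (t / s) powr \<epsilon>"
      using bound[of t s] st by (simp add: powr_def ln_div)
  qed
qed


section \<open>Powers with logarithmic factors\<close>

definition powr_log :: "real \<Rightarrow> real \<times> real \<Rightarrow> real \<Rightarrow> real" where
  "powr_log e A t = t powr e * broken_log A t"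

lemma powr_log_pos: "0 < t \<Longrightarrow> 0 < powr_log e A t"
  by (simp add: powr_log_def broken_log_pos)

lemma powr_log_nonneg: "0 \<le> powr_log e A t"
  by (simp add: powr_log_def less_imp_le[OF broken_log_pos])

lemma powr_log_measurable [measurable]: "powr_log e A \<in> borel_measurable borel"
  unfolding powr_log_def[abs_def] by measurable

lemma powr_log_mult: "powr_log d A t * powr_log e B t = powr_log (d + e) (A + B) t"
  by (simp add: powr_log_def powr_add broken_log_add)

lemma powr_log_powr: "powr_log e A t powr p = powr_log (p * e) (p *\<^sub>R A) t"
  by (simp add: powr_log_def powr_mult powr_powr broken_log_powr mult.commute)

lemma powr_log_minus: "powr_log (- e) (- A) t = 1 / powr_log e A t"
  by (simp add: powr_log_def broken_log_def powr_minus_divide)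

lemma powr_log_zero: "0 < t \<Longrightarrow> powr_log 0 A t = broken_log A t"
  by (simp add: powr_log_def)

lemma powr_log_potter:
  assumes "d < e"
  obtains C where "0 < C"
    "\<And>s t. 0 < s \<Longrightarrow> s \<le> t \<Longrightarrow> powr_log d A t \<le> C * powr_log d A s * (t / s) powr e"
    "\<And>s t. 0 < s \<Longrightarrow> s \<le> t \<Longrightarrow> powr_log e A s \<le> C * powr_log e A t * (s / t) powr d"
proof -
  obtain C where C: "0 < C"
    "\<And>s t. 0 < s \<Longrightarrow> s \<le> t \<Longrightarrow> broken_log A t \<le> C * broken_log A s * (t / s) powr (e - d)"
    "\<And>s t. 0 < s \<Longrightarrow> s \<le> t \<Longrightarrow> broken_log A s \<le> C * broken_log A t * (t / s) powr (e - d)"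
    using broken_log_potter[of "e - d" A] assms by auto
  show ?thesis
  proof (rule that[OF C(1)])
    fix s t :: real assume st: "0 < s" "s \<le> t"
    have "powr_log d A t \<le> t powr d * (C * broken_log A s * (t / s) powr (e - d))"
      unfolding powr_log_def by (intro mult_left_mono C(2)[OF st]) simp
    also have "\<dots> = C * powr_log d A s * (t / s) powr e"
      using st by (simp add: powr_log_def powr_divide powr_diff)
    finally show "powr_log d A t \<le> C * powr_log d A s * (t / s) powr e" .
    have "powr_log e A s \<le> s powr e * (C * broken_log A t * (t / s) powr (e - d))"
      unfolding powr_log_def by (intro mult_left_mono C(3)[OF st]) simp
    also have "\<dots> = C * powr_log e A t * (s / t) powr d"
      using st by (simp add: powr_log_def powr_divide powr_diff)
    finally show "powr_log e A s \<le> C * powr_log e A t * (s / t) powr d" .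
  qed
qed

lemma powr_log_doubling:
  obtains C where "0 < C" "\<And>s t. s / 2 < t \<Longrightarrow> t \<le> s \<Longrightarrow> powr_log e A s \<le> C * powr_log e A t"
proof -
  have "e < \<bar>e\<bar> + 1" by simp
  then obtain C where C: "0 < C"
    "\<And>s t. 0 < s \<Longrightarrow> s \<le> t \<Longrightarrow> powr_log e A t \<le> C * powr_log e A s * (t / s) powr (\<bar>e\<bar> + 1)"
    using powr_log_potter by metis
  show ?thesis
  proof (rule that[of "C * 2 powr (\<bar>e\<bar> + 1)"])
    show "0 < C * 2 powr (\<bar>e\<bar> + 1)" using C by simp
    fix s t :: real assume t: "s / 2 < t" "t \<le> s"
    then have "0 < t" by linarith
    then have "powr_log e A s \<le> C * powr_log e A t * (s / t) powr (\<bar>e\<bar> + 1)"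
      using t by (intro C)
    also have "\<dots> \<le> C * powr_log e A t * 2 powr (\<bar>e\<bar> + 1)"
      using t \<open>0 < t\<close> C(1) by (intro mult_left_mono powr_mono2) (auto simp: powr_log_nonneg field_simps)
    finally show "powr_log e A s \<le> C * 2 powr (\<bar>e\<bar> + 1) * powr_log e A t" by (simp add: mult_ac)
  qed
qed


subsection \<open>Integrals near zero and infinity\<close>

lemma nn_integral_Ioc_le_antiderivative:
  fixes f F :: "real \<Rightarrow> real"
  assumes f[measurable]: "f \<in> borel_measurable borel" and "a < r"
    and deriv: "\<And>x. a < x \<Longrightarrow> x \<le> r \<Longrightarrow> (F has_real_derivative f x) (at x)"
    and nonneg: "\<And>x. a < x \<Longrightarrow> x \<le> r \<Longrightarrow> 0 \<le> f x" "\<And>x. a < x \<Longrightarrow> x \<le> r \<Longrightarrow> 0 \<le> F x"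
  shows "(\<integral>\<^sup>+x. ennreal (f x) * indicator {a<..r} x \<partial>lborel) \<le> ennreal (F r)"
proof -
  define l where "l n = a + (r - a) / Suc n" for n
  have l: "a < l n" "l n \<le> r" for n
    using \<open>a < r\<close> divide_left_mono[of 1 "real (Suc n)" "r - a"] by (auto simp: l_def)
  have "decseq l"
    using \<open>a < r\<close> by (auto simp: l_def decseq_def intro!: divide_left_mono)
  have "(\<Union>n. {l n..r}) = {a<..r}"
  proof (intro equalityI subsetI)
    fix x assume x: "x \<in> {a<..r}"
    have "l \<longlonglongrightarrow> a + 0"
      unfolding l_def by (intro tendsto_intros LIMSEQ_Suc[OF lim_const_over_n])
    then have "\<forall>\<^sub>F n in sequentially. l n < x"
      using x by (intro order_tendstoD) auto
    then show "x \<in> (\<Union>n. {l n..r})"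
      using x by (auto dest!: eventually_happens intro: less_imp_le)
  qed (use l in \<open>auto intro: less_le_trans\<close>)
  moreover have "emeasure (density lborel f) {l n..r} \<le> ennreal (F r)" for n
  proof -
    have "(\<integral>\<^sup>+x. ennreal (f x) * indicator {l n..r} x \<partial>lborel) = F r - F (l n)"
      by (rule nn_integral_FTC_Icc) (use l[of n] nonneg(1) deriv in \<open>auto intro: has_field_derivative_at_within\<close>)
    also have "\<dots> \<le> ennreal (F r)"
      using nonneg(2)[of "l n"] l[of n] by (intro ennreal_leI) simp
    finally show ?thesis by (simp add: emeasure_density)
  qed
  moreover have "(SUP n. emeasure (density lborel f) {l n..r}) = emeasure (density lborel f) (\<Union>n. {l n..r})"
    using \<open>decseq l\<close> by (intro SUP_emeasure_incseq) (auto simp: incseq_def decseq_def)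
  ultimately have "emeasure (density lborel f) {a<..r} \<le> ennreal (F r)"
    by (metis (no_types, lifting) SUP_least)
  then show ?thesis by (simp add: emeasure_density)
qed

lemma DERIV_quotient_powr:
  fixes s t d :: real
  assumes "0 < s" "0 < t" "d \<noteq> -1"
  shows "((\<lambda>s. t / (d + 1) * (s / t) powr (d + 1)) has_real_derivative (s / t) powr d) (at s)"
proof -
  have "((\<lambda>s. s / t) has_real_derivative 1 / t) (at s)"
    using assms(2) by (auto intro!: derivative_eq_intros)
  from DERIV_cmult[OF DERIV_fun_powr[OF this, of "d + 1"], of "t / (d + 1)"] show ?thesis
    using assms by (auto simp: add_eq_0_iff2)
qed

lemma nn_integral_powr_log_Ioc_le:
  assumes "-1 < e"
  obtains C where "0 < C"
    "\<And>t. 0 < t \<Longrightarrow> (\<integral>\<^sup>+s. ennreal (powr_log e A s) * indicator {0<..t} s \<partial>lborel) \<le> ennreal (C * (t * powr_log e A t))"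
proof -
  define d where "d = (e - 1) / 2"
  have d: "-1 < d" "d < e" using assms by (auto simp: d_def)
  obtain C where C: "0 < C"
    "\<And>s t. 0 < s \<Longrightarrow> s \<le> t \<Longrightarrow> powr_log e A s \<le> C * powr_log e A t * (s / t) powr d"
    using powr_log_potter[OF d(2)] by metis
  show ?thesis
  proof (rule that[of "C / (d + 1)"])
    show "0 < C / (d + 1)" using C d by simp
    fix t :: real assume t: "0 < t"
    have K: "0 \<le> C * powr_log e A t" using C by (simp add: powr_log_nonneg)
    have "(\<integral>\<^sup>+s. ennreal (powr_log e A s) * indicator {0<..t} s \<partial>lborel)
        \<le> (\<integral>\<^sup>+s. ennreal (C * powr_log e A t * (s / t) powr d) * indicator {0<..t} s \<partial>lborel)"
      by (intro nn_integral_mono) (auto simp: indicator_def intro!: ennreal_leI C)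
    also have "\<dots> \<le> ennreal (C * powr_log e A t * (t / (d + 1) * (t / t) powr (d + 1)))"
    proof (rule nn_integral_Ioc_le_antiderivative[where
          F = "\<lambda>s. C * powr_log e A t * (t / (d + 1) * (s / t) powr (d + 1))"])
      fix s :: real assume s: "0 < s"
      show "((\<lambda>s. C * powr_log e A t * (t / (d + 1) * (s / t) powr (d + 1))) has_real_derivative
          C * powr_log e A t * (s / t) powr d) (at s)"
        using s t d by (intro DERIV_cmult DERIV_quotient_powr) auto
    qed (use d t K in auto)
    also have "C * powr_log e A t * (t / (d + 1) * (t / t) powr (d + 1)) = C / (d + 1) * (t * powr_log e A t)"
      using t by simp
    finally show "(\<integral>\<^sup>+s. ennreal (powr_log e A s) * indicator {0<..t} s \<partial>lborel)
      \<le> ennreal (C / (d + 1) * (t * powr_log e A t))" .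
  qed
qed

lemma nn_integral_powr_log_Ioi_le:
  assumes "e < -1"
  obtains C where "0 < C"
    "\<And>t. 0 < t \<Longrightarrow> (\<integral>\<^sup>+s. ennreal (powr_log e A s) * indicator {t<..} s \<partial>lborel) \<le> ennreal (C * (t * powr_log e A t))"
proof -
  define d where "d = (e - 1) / 2"
  have d: "d < -1" "e < d" using assms by (auto simp: d_def)
  obtain C where C: "0 < C"
    "\<And>s t. 0 < s \<Longrightarrow> s \<le> t \<Longrightarrow> powr_log e A t \<le> C * powr_log e A s * (t / s) powr d"
    using powr_log_potter[OF d(2)] by metis
  show ?thesis
  proof (rule that[of "C / - (d + 1)"])
    show "0 < C / - (d + 1)" using C d by (intro divide_pos_pos) auto
    fix t :: real assume t: "0 < t"
    have K: "0 \<le> C * powr_log e A t" using C by (simp add: powr_log_nonneg)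
    have "(\<integral>\<^sup>+s. ennreal (powr_log e A s) * indicator {t<..} s \<partial>lborel)
        \<le> (\<integral>\<^sup>+s. ennreal (C * powr_log e A t * (s / t) powr d) * indicator {t..} s \<partial>lborel)"
      using t by (intro nn_integral_mono) (auto simp: indicator_def intro!: ennreal_leI C)
    also have "\<dots> = ennreal (0 - C * powr_log e A t * (t / (d + 1) * (t / t) powr (d + 1)))"
    proof (rule nn_integral_FTC_atLeast[where
          F = "\<lambda>s. C * powr_log e A t * (t / (d + 1) * (s / t) powr (d + 1))"])
      fix s :: real assume s: "t \<le> s"
      show "((\<lambda>s. C * powr_log e A t * (t / (d + 1) * (s / t) powr (d + 1))) has_real_derivative
          C * powr_log e A t * (s / t) powr d) (at s)"
        using s t d by (intro DERIV_cmult DERIV_quotient_powr) auto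
    next
      have "filterlim (\<lambda>s. s / t) at_top at_top"
        using t by (auto intro!: filterlim_at_top_mult_tendsto_pos[of _ "1 / t" at_top, simplified] filterlim_ident simp: divide_inverse)
      then have "((\<lambda>s. (s / t) powr (d + 1)) \<longlongrightarrow> 0) at_top"
        using d by (intro tendsto_neg_powr) auto
      then show "((\<lambda>s. C * powr_log e A t * (t / (d + 1) * (s / t) powr (d + 1))) \<longlongrightarrow> 0) at_top"
        by (intro tendsto_mult_right_zero)
    qed (use d t K in auto)
    also have "0 - C * powr_log e A t * (t / (d + 1) * (t / t) powr (d + 1)) = C / - (d + 1) * (t * powr_log e A t)"
      using t d by (simp add: divide_simps) (simp add: algebra_simps)
    finally show "(\<integral>\<^sup>+s. ennreal (powr_log e A s) * indicator {t<..} s \<partial>lborel)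
      \<le> ennreal (C / - (d + 1) * (t * powr_log e A t))" .
  qed
qed

lemma nn_integral_powr_log_minus_one_near_zero_le:
  assumes A: "fst A < -1" and t: "0 < t" "t \<le> 1"
  shows "(\<integral>\<^sup>+s. ennreal (powr_log (-1) A s) * indicator {0<..t} s \<partial>lborel)
    \<le> ennreal ((1 - ln t) powr (fst A + 1) / - (fst A + 1))"
proof -
  define a where "a = fst A + 1"
  have a: "a < 0" using A by (simp add: a_def)
  have "(\<integral>\<^sup>+s. ennreal (powr_log (-1) A s) * indicator {0<..t} s \<partial>lborel)
      = (\<integral>\<^sup>+s. ennreal ((1 - ln s) powr (a - 1) / s) * indicator {0<..t} s \<partial>lborel)"
    using t by (intro nn_integral_cong)
      (auto simp: indicator_def powr_log_def broken_log_def a_def powr_minus_divide)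
  also have "\<dots> \<le> ennreal ((1 - ln t) powr a / - a)"
  proof (rule nn_integral_Ioc_le_antiderivative[where F = "\<lambda>t. (1 - ln t) powr a / - a"])
    fix s assume s: "0 < s" "s \<le> t"
    then have "ln s \<le> 0" using t by simp
    then have "0 < 1 - ln s" by linarith
    then show "((\<lambda>t. (1 - ln t) powr a / - a) has_real_derivative (1 - ln s) powr (a - 1) / s) (at s)"
      by - (rule derivative_eq_intros | use s a in simp)+
  qed (use t a in \<open>auto simp: divide_nonneg_neg\<close>)
  finally show ?thesis by (simp only: a_def)
qed

lemma nn_integral_one_plus_ln_powr_le:
  assumes "-1 < b" and t: "1 < t"
  shows "(\<integral>\<^sup>+s. ennreal ((1 + ln s) powr b / s) * indicator {1<..t} s \<partial>lborel)
    \<le> ennreal ((1 + ln t) powr (b + 1) / (b + 1))"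
proof (rule nn_integral_Ioc_le_antiderivative[where F = "\<lambda>t. (1 + ln t) powr (b + 1) / (b + 1)", OF _ t])
  fix s :: real assume s: "1 < s"
  then have "0 < 1 + ln s" using ln_gt_zero[of s] by linarith
  then show "((\<lambda>t. (1 + ln t) powr (b + 1) / (b + 1)) has_real_derivative (1 + ln s) powr b / s) (at s)"
    by - (rule derivative_eq_intros | use s assms in simp)+
qed (use assms in auto)

lemma nn_integral_powr_log_minus_one_beyond_one_le:
  assumes A: "fst A < -1" "-1 < snd A" and t: "1 < t"
  shows "(\<integral>\<^sup>+s. ennreal (powr_log (-1) A s) * indicator {0<..t} s \<partial>lborel)
    \<le> ennreal ((1 / - (fst A + 1) + 1 / (snd A + 1)) * broken_log (pair_shift A 1) t)"
proof -
  define a where "a = fst A + 1"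
  define b where "b = snd A + 1"
  have ab: "a < 0" "0 < b" using A by (auto simp: a_def b_def)
  have "(\<integral>\<^sup>+s. ennreal (powr_log (-1) A s) * indicator {0<..t} s \<partial>lborel)
      = (\<integral>\<^sup>+s. ennreal (powr_log (-1) A s) * indicator {0<..1} s
          + ennreal ((1 + ln s) powr snd A / s) * indicator {1<..t} s \<partial>lborel)"
    using t by (intro nn_integral_cong)
      (auto simp: indicator_def powr_log_def broken_log_def powr_minus_divide)
  also have "\<dots> \<le> ennreal (1 / - a) + ennreal ((1 + ln t) powr b / b)"
    using nn_integral_powr_log_minus_one_near_zero_le[OF A(1), of 1] nn_integral_one_plus_ln_powr_le[OF A(2) t]
    by (subst nn_integral_add) (auto simp: a_def b_def intro!: add_mono)
  also have "\<dots> = ennreal (1 / - a + (1 + ln t) powr b / b)"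
    using ab by (intro ennreal_plus[symmetric]) auto
  also have "\<dots> \<le> ennreal ((1 / - a + 1 / b) * (1 + ln t) powr b)"
  proof (rule ennreal_leI)
    have "1 \<le> (1 + ln t) powr b" using t ab by (intro ge_one_powr_ge_zero) auto
    then have "1 / - a * 1 \<le> 1 / - a * (1 + ln t) powr b"
      using ab by (intro mult_left_mono) auto
    then show "1 / - a + (1 + ln t) powr b / b \<le> (1 / - a + 1 / b) * (1 + ln t) powr b"
      by (simp add: algebra_simps)
  qed
  also have "(1 + ln t) powr b = broken_log (pair_shift A 1) t"
    using t by (simp add: broken_log_def pair_shift_def b_def)
  finally show ?thesis by (simp only: a_def b_def)
qed

lemma nn_integral_powr_log_minus_one_le:
  assumes A: "fst A < -1" "-1 < snd A"
  obtains C where "0 < C"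
    "\<And>t. 0 < t \<Longrightarrow> (\<integral>\<^sup>+s. ennreal (powr_log (-1) A s) * indicator {0<..t} s \<partial>lborel)
       \<le> ennreal (C * broken_log (pair_shift A 1) t)"
proof (rule that[of "1 / - (fst A + 1) + 1 / (snd A + 1)"])
  show "0 < 1 / - (fst A + 1) + 1 / (snd A + 1)" using A by (intro add_pos_pos) auto
  fix t :: real assume t: "0 < t"
  show "(\<integral>\<^sup>+s. ennreal (powr_log (-1) A s) * indicator {0<..t} s \<partial>lborel)
     \<le> ennreal ((1 / - (fst A + 1) + 1 / (snd A + 1)) * broken_log (pair_shift A 1) t)"
  proof (cases "t \<le> 1")
    case True
    have "(1 - ln t) powr (fst A + 1) / - (fst A + 1)
        \<le> (1 / - (fst A + 1) + 1 / (snd A + 1)) * broken_log (pair_shift A 1) t"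
      using True t A by (simp add: broken_log_def pair_shift_def distrib_right)
    with nn_integral_powr_log_minus_one_near_zero_le[OF A(1) t True] show ?thesis
      by (meson ennreal_leI order_trans)
  next
    case False
    then show ?thesis by (intro nn_integral_powr_log_minus_one_beyond_one_le A) simp
  qed
qed


section \<open>Lebesgue quasi-norms\<close>

lemma recip_ennreal: "0 < p \<Longrightarrow> recip (ennreal p) = 1 / p"
  by (simp add: recip_def divide_ennreal flip: ennreal_1)

lemma recip_top [simp]: "recip top = 0"
  by (simp add: recip_def)

lemma recip_nonneg: "0 \<le> recip b"
  by (simp add: recip_def)

lemma ennpowr_ennreal: "0 \<le> a \<Longrightarrow> ennpowr (ennreal a) r = ennreal (a powr r)"
  by (simp add: ennpowr_def)

lemma ennpowr_one [simp]: "ennpowr x 1 = x"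
  by (cases x) (auto simp: ennpowr_def)

lemma ennpowr_zero [simp]: "0 < r \<Longrightarrow> ennpowr 0 r = 0"
  by (simp add: ennpowr_def)

lemma ennpowr_mono: "0 < r \<Longrightarrow> x \<le> y \<Longrightarrow> ennpowr x r \<le> ennpowr y r"
  by (cases x; cases y) (auto simp: ennpowr_def top_unique intro!: ennreal_leI powr_mono2)

lemma ennpowr_inverse:
  assumes "0 < r"
  shows "ennpowr (ennpowr x r) (1 / r) = x" "ennpowr (ennpowr x (1 / r)) r = x"
  using assms by (cases x; simp add: ennpowr_def powr_powr)+

lemma ennpowr_mult: "0 < r \<Longrightarrow> ennpowr (x * y) r = ennpowr x r * ennpowr y r"
  by (cases x; cases y)
    (auto simp: ennpowr_def powr_mult ennreal_top_mult ennreal_mult_top simp flip: ennreal_mult)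

lemma ennpowr_measurable [measurable]: "(\<lambda>x. ennpowr x r) \<in> borel_measurable borel"
  unfolding ennpowr_def by measurable

lemma exponent_cases:
  fixes b :: ennreal
  assumes "0 < b"
  obtains (top) "b = top" | (real) p where "b = ennreal p" "0 < p" "recip b = 1 / p"
proof (cases b)
  case (real p)
  then show ?thesis using that(2)[of p] assms by (simp add: recip_ennreal)
qed (use that(1) in simp)

lemma Lp_qnorm_top_le_iff:
  assumes "h \<in> borel_measurable M"
  shows "Lp_qnorm M top h \<le> N \<longleftrightarrow> (AE x in M. h x \<le> N)"
proof
  assume le: "Lp_qnorm M top h \<le> N"
  show "AE x in M. h x \<le> N"
    using esssup_AE[of h M] by eventually_elim (use le in \<open>auto simp: Lp_qnorm_def\<close>)
qed (use assms in \<open>auto simp: Lp_qnorm_def intro: esssup_I\<close>)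

lemma Lp_qnorm_le_iff:
  assumes "0 < p"
  shows "Lp_qnorm M (ennreal p) h \<le> N \<longleftrightarrow> (\<integral>\<^sup>+x. ennpowr (h x) p \<partial>M) \<le> ennpowr N p"
proof -
  define I where "I = (\<integral>\<^sup>+x. ennpowr (h x) p \<partial>M)"
  have "Lp_qnorm M (ennreal p) h = ennpowr I (1 / p)"
    using assms by (simp add: Lp_qnorm_def I_def recip_ennreal)
  moreover have "ennpowr I (1 / p) \<le> N \<longleftrightarrow> I \<le> ennpowr N p"
    using assms ennpowr_inverse[OF assms] ennpowr_mono[of p] ennpowr_mono[of "1 / p"]
    by (metis zero_less_divide_1_iff)
  ultimately show ?thesis by (simp add: I_def)
qed

lemma Lp_qnorm_mono:
  assumes f[measurable]: "f \<in> borel_measurable M" and "0 < b" and "g \<in> borel_measurable M"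
    and le: "\<And>x. x \<in> space M \<Longrightarrow> f x \<le> g x"
  shows "Lp_qnorm M b f \<le> Lp_qnorm M b g"
  using \<open>0 < b\<close>
proof (cases rule: exponent_cases)
  case top
  have "AE x in M. g x \<le> Lp_qnorm M b g"
    using Lp_qnorm_top_le_iff[OF assms(3)] top by auto
  then have "AE x in M. f x \<le> Lp_qnorm M b g"
    using AE_space by eventually_elim (use le in \<open>auto intro: order_trans\<close>)
  then show ?thesis using Lp_qnorm_top_le_iff[OF f] top by auto
next
  case (real p)
  have "(\<integral>\<^sup>+x. ennpowr (f x) p \<partial>M) \<le> (\<integral>\<^sup>+x. ennpowr (g x) p \<partial>M)"
    using real le by (intro nn_integral_mono ennpowr_mono)
  also have "\<dots> \<le> ennpowr (Lp_qnorm M b g) p"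
    using real by (simp flip: Lp_qnorm_le_iff)
  finally show ?thesis using real by (simp add: Lp_qnorm_le_iff)
qed

lemma Lp_qnorm_cmult_le:
  assumes f[measurable]: "f \<in> borel_measurable M" and "0 < b"
  shows "Lp_qnorm M b (\<lambda>x. a * f x) \<le> a * Lp_qnorm M b f"
  using \<open>0 < b\<close>
proof (cases rule: exponent_cases)
  case top
  have "AE x in M. f x \<le> Lp_qnorm M b f"
    using Lp_qnorm_top_le_iff[OF f] top by auto
  then have "AE x in M. a * f x \<le> a * Lp_qnorm M b f"
    by eventually_elim (simp add: mult_left_mono)
  then show ?thesis using top by (simp add: Lp_qnorm_top_le_iff)
next
  case (real p)
  have "(\<integral>\<^sup>+x. ennpowr (a * f x) p \<partial>M) = ennpowr a p * (\<integral>\<^sup>+x. ennpowr (f x) p \<partial>M)"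
    using real by (simp add: ennpowr_mult nn_integral_cmult)
  also have "\<dots> \<le> ennpowr a p * ennpowr (Lp_qnorm M b f) p"
    using real by (intro mult_left_mono) (simp_all flip: Lp_qnorm_le_iff)
  finally show ?thesis using real by (simp add: Lp_qnorm_le_iff ennpowr_mult)
qed

lemma Lp_qnorm_max_le:
  assumes [measurable]: "f \<in> borel_measurable M" "g \<in> borel_measurable M" and "0 < b"
    and le: "Lp_qnorm M b f \<le> N" "Lp_qnorm M b g \<le> N"
  shows "Lp_qnorm M b (\<lambda>x. max (f x) (g x)) \<le> ennreal (2 powr recip b) * N"
  using \<open>0 < b\<close>
proof (cases rule: exponent_cases)
  case top
  then have "AE x in M. f x \<le> N" "AE x in M. g x \<le> N"
    using le by (auto simp: Lp_qnorm_top_le_iff)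
  then have "AE x in M. max (f x) (g x) \<le> N" by eventually_elim simp
  then show ?thesis using top by (simp add: Lp_qnorm_top_le_iff)
next
  case (real p)
  have "(\<integral>\<^sup>+x. ennpowr (max (f x) (g x)) p \<partial>M) \<le> (\<integral>\<^sup>+x. ennpowr (f x) p + ennpowr (g x) p \<partial>M)"
    by (intro nn_integral_mono) (auto simp: max_def)
  also have "\<dots> = (\<integral>\<^sup>+x. ennpowr (f x) p \<partial>M) + (\<integral>\<^sup>+x. ennpowr (g x) p \<partial>M)"
    by (rule nn_integral_add) auto
  also have "\<dots> \<le> ennpowr N p + ennpowr N p"
    using le real by (intro add_mono) (simp_all add: Lp_qnorm_le_iff)
  also have "\<dots> = ennpowr (ennreal (2 powr recip b) * N) p"
    using real by (simp add: ennpowr_mult ennpowr_ennreal powr_powr mult_2)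
  finally show ?thesis using real by (simp add: Lp_qnorm_le_iff)
qed

lemma Lp_qnorm_ge_on_set:
  assumes "0 < b" and S: "S \<in> sets M" "emeasure M S = ennreal m" "0 < m"
    and ge: "\<And>x. x \<in> S \<Longrightarrow> a \<le> h x"
  shows "a * ennreal (m powr recip b) \<le> Lp_qnorm M b h"
  using \<open>0 < b\<close>
proof (cases rule: exponent_cases)
  case top
  have "a \<le> esssup M h"
  proof (rule ccontr)
    assume less: "\<not> a \<le> esssup M h"
    have "AE x in M. x \<notin> S"
      using esssup_AE[of h M] by eventually_elim (use less in \<open>auto dest: ge order_trans\<close>)
    then have "S \<in> null_sets M" using S(1) by (simp add: AE_iff_null_sets)
    then show False using S by auto
  qed
  then show ?thesis using top S by (simp add: Lp_qnorm_def)
next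
  case (real p)
  have "ennpowr (a * ennreal (m powr recip b)) p = (\<integral>\<^sup>+x. ennpowr a p * indicator S x \<partial>M)"
    using real S by (simp add: ennpowr_mult ennpowr_ennreal powr_powr nn_integral_cmult_indicator)
  also have "\<dots> \<le> (\<integral>\<^sup>+x. ennpowr (h x) p \<partial>M)"
    using real ge by (intro nn_integral_mono) (auto simp: indicator_def intro: ennpowr_mono)
  also have "\<dots> \<le> ennpowr (Lp_qnorm M b h) p"
    using real by (simp flip: Lp_qnorm_le_iff)
  finally show ?thesis
    using real ennpowr_mono[of "1 / p"] ennpowr_inverse(1)[of p] by (metis zero_less_divide_1_iff)
qed


section \<open>Rearrangements\<close>

lemma rearrangement_le:
  "emeasure lebesgue {x. s < ennreal (norm (f x))} \<le> ennreal t \<Longrightarrow> rearrangement f t \<le> s"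
  unfolding rearrangement_def by (rule Inf_lower) simp

lemma rearrangement_antimono: "s \<le> t \<Longrightarrow> rearrangement f t \<le> rearrangement f s"
  unfolding rearrangement_def
  by (rule Inf_superset_mono) (auto intro: order_trans ennreal_leI)

lemma rearrangement_measurable [measurable]: "rearrangement f \<in> borel_measurable borel"
proof (rule borel_measurableI_less)
  fix y
  have "is_interval {t. rearrangement f t < y}"
    unfolding is_interval_1 using rearrangement_antimono[of _ _ f] by (auto intro: le_less_trans)
  then show "{x \<in> space borel. rearrangement f x < y} \<in> sets borel"
    by (simp add: real_interval_borel_measurable)
qed

lemma rearrangement_cong_AE:
  fixes f g :: "'a::euclidean_space \<Rightarrow> complex"
  assumes [measurable]: "f \<in> borel_measurable lebesgue" "g \<in> borel_measurable lebesgue"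
    and eq: "AE x in lebesgue. f x = g x"
  shows "rearrangement f = rearrangement g"
proof -
  have "emeasure lebesgue {x \<in> space lebesgue. s < ennreal (norm (f x))}
      = emeasure lebesgue {x \<in> space lebesgue. s < ennreal (norm (g x))}" for s
  proof (rule emeasure_eq_AE)
    show "AE x in lebesgue. x \<in> {x \<in> space lebesgue. s < ennreal (norm (f x))}
        \<longleftrightarrow> x \<in> {x \<in> space lebesgue. s < ennreal (norm (g x))}"
      using eq by eventually_elim simp
  qed measurable
  then show ?thesis by (simp add: rearrangement_def fun_eq_iff)
qed

lemma emeasure_superlevel_rearrangement_le:
  fixes f :: "'a::euclidean_space \<Rightarrow> complex"
  assumes [measurable]: "f \<in> borel_measurable borel"
  shows "emeasure lborel {x. rearrangement f t < ennreal (norm (f x))} \<le> ennreal t"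
proof -
  define S where "S = {s. emeasure lborel {x. s < ennreal (norm (f x))} \<le> ennreal t}"
  have Inf_S: "rearrangement f t = Inf S"
    by (simp add: rearrangement_def S_def)
  have "\<infinity> \<in> S" by (simp add: S_def)
  then obtain z where z: "decseq z" "range z \<subseteq> S" "Inf S = (INF i. z i)"
    using ennreal_Inf_countable_INF[of S] by blast
  have "{x. rearrangement f t < ennreal (norm (f x))} = (\<Union>i. {x. z i < ennreal (norm (f x))})"
    unfolding Inf_S z(3) by (auto simp: INF_less_iff)
  also have "emeasure lborel \<dots> = (SUP i. emeasure lborel {x. z i < ennreal (norm (f x))})"
    using z(1) by (intro SUP_emeasure_incseq[symmetric])
      (auto simp: incseq_def decseq_def intro: le_less_trans)
  also have "\<dots> \<le> ennreal t"
    using z(2) by (intro SUP_least) (auto simp: S_def)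
  finally show ?thesis .
qed

definition average_rearrangement :: "('a::euclidean_space \<Rightarrow> complex) \<Rightarrow> real \<Rightarrow> ennreal" where
  "average_rearrangement f t = (\<integral>\<^sup>+s. rearrangement f s * indicator {0<..t} s \<partial>lborel) / ennreal t"

lemma average_rearrangement_times:
  "0 < t \<Longrightarrow> average_rearrangement f t * ennreal t = (\<integral>\<^sup>+s. rearrangement f s * indicator {0<..t} s \<partial>lborel)"
  by (simp add: average_rearrangement_def ennreal_divide_times)

lemma average_rearrangement_leI:
  assumes "0 < t" "(\<integral>\<^sup>+s. rearrangement f s * indicator {0<..t} s \<partial>lborel) \<le> N * ennreal t"
  shows "average_rearrangement f t \<le> N"
  using assms divide_right_mono_ennreal[OF assms(2), of "ennreal t"]
  by (simp add: average_rearrangement_def ennreal_mult_divide_eq)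

lemma rearrangement_le_average:
  assumes t: "0 < t"
  shows "rearrangement f t \<le> average_rearrangement f t"
proof -
  have "rearrangement f t * ennreal t = (\<integral>\<^sup>+s. rearrangement f t * indicator {0<..t} s \<partial>lborel)"
    using t by (simp add: nn_integral_cmult)
  also have "\<dots> \<le> average_rearrangement f t * ennreal t"
    unfolding average_rearrangement_times[OF t]
    by (intro nn_integral_mono) (auto simp: indicator_def intro: rearrangement_antimono)
  finally show ?thesis
    using t by (simp add: ennreal_mult_le_mult_iff mult.commute[of _ "ennreal t"])
qed

lemma nn_integral_layer_cake:
  assumes "sigma_finite_measure M" and h[measurable]: "h \<in> borel_measurable M"
  shows "(\<integral>\<^sup>+x. h x \<partial>M) = (\<integral>\<^sup>+l. emeasure M {x \<in> space M. ennreal l \<le> h x} * indicator {0<..} l \<partial>lborel)"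
proof -
  interpret M: sigma_finite_measure M by fact
  interpret pair_sigma_finite M lborel ..
  have level: "(\<integral>\<^sup>+l. indicator {l. 0 < l \<and> ennreal l \<le> a} l \<partial>lborel) = a" for a
  proof (cases a)
    case (real r)
    then have "{l. 0 < l \<and> ennreal l \<le> a} = {0<..r}" by auto
    then show ?thesis using real by simp
  next
    case top
    have ge: "ennreal r \<le> emeasure lborel {0::real<..}" if "0 \<le> r" for r
    proof -
      have "emeasure lborel {0<..r} \<le> emeasure lborel {0::real<..}" by (intro emeasure_mono) auto
      then show ?thesis using that by simp
    qed
    have "emeasure lborel {0::real<..} = top"
    proof (cases "emeasure lborel {0::real<..}")
      case (real m)
      then show ?thesis using ge[of "m + 1"] by simp
    qed
    moreover have "{l. 0 < l \<and> ennreal l \<le> a} = {0<..}" using top by auto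
    ultimately show ?thesis using top by simp
  qed
  have "(\<integral>\<^sup>+x. h x \<partial>M) = (\<integral>\<^sup>+x. \<integral>\<^sup>+l. indicator {l. 0 < l \<and> ennreal l \<le> h x} l \<partial>lborel \<partial>M)"
    by (simp only: level)
  also have "\<dots> = (\<integral>\<^sup>+l. \<integral>\<^sup>+x. indicator {l. 0 < l \<and> ennreal l \<le> h x} l \<partial>M \<partial>lborel)"
    by (rule Fubini'[symmetric]) measurable
  also have "\<dots> = (\<integral>\<^sup>+l. emeasure M {x \<in> space M. ennreal l \<le> h x} * indicator {0<..} l \<partial>lborel)"
  proof (rule nn_integral_cong)
    fix l :: real
    have "(\<integral>\<^sup>+x. indicator {l. 0 < l \<and> ennreal l \<le> h x} l \<partial>M)
        = (\<integral>\<^sup>+x. indicator {0<..} l * indicator {x \<in> space M. ennreal l \<le> h x} x \<partial>M)"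
      by (intro nn_integral_cong) (auto simp: indicator_def)
    then show "(\<integral>\<^sup>+x. indicator {l. 0 < l \<and> ennreal l \<le> h x} l \<partial>M)
        = emeasure M {x \<in> space M. ennreal l \<le> h x} * indicator {0<..} l"
      by (simp add: nn_integral_cmult_indicator mult.commute)
  qed
  finally show ?thesis .
qed

lemma le_rearrangementI:
  assumes "ennreal s < emeasure lebesgue {x. l \<le> ennreal (norm (f x))}" "f \<in> borel_measurable lebesgue"
  shows "l \<le> rearrangement f s"
  unfolding rearrangement_def
proof (rule Inf_greatest, rule ccontr)
  note [measurable] = assms(2)
  fix z assume z: "z \<in> {z. emeasure lebesgue {x. z < ennreal (norm (f x))} \<le> ennreal s}" "\<not> l \<le> z"
  have "{x \<in> space lebesgue. z < ennreal (norm (f x))} \<in> sets lebesgue" by measurable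
  then have "emeasure lebesgue {x. l \<le> ennreal (norm (f x))} \<le> emeasure lebesgue {x. z < ennreal (norm (f x))}"
    using z(2) by (intro emeasure_mono) auto
  then show False using assms(1) z(1) by simp
qed

lemma emeasure_superlevel_on_set_le:
  fixes f :: "'a::euclidean_space \<Rightarrow> complex"
  assumes f[measurable]: "f \<in> borel_measurable borel" and t: "0 < t"
    and E[measurable]: "E \<in> sets borel" and E_le: "emeasure lborel E \<le> ennreal t"
  shows "emeasure lborel {x \<in> E. l \<le> ennreal (norm (f x))}
    \<le> emeasure lborel {s \<in> {0<..t}. l \<le> rearrangement f s}"
proof -
  define D where "D = emeasure lborel {x \<in> E. l \<le> ennreal (norm (f x))}"
  have "D \<le> emeasure lborel E" unfolding D_def by (intro emeasure_mono) auto
  then have "D \<le> ennreal t" using E_le by (rule order_trans)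
  then obtain m where m: "D = ennreal m" "0 \<le> m" "m \<le> t"
    using t by (cases D) (auto simp: top_unique)
  have "l \<le> rearrangement f s" if s: "0 < s" "s < m" for s
  proof (rule le_rearrangementI)
    have "D \<le> emeasure lborel {x. l \<le> ennreal (norm (f x))}"
      unfolding D_def by (intro emeasure_mono) auto
    moreover have "ennreal s < D" using s m by (simp add: ennreal_less_iff)
    ultimately show "ennreal s < emeasure lebesgue {x. l \<le> ennreal (norm (f x))}" by simp
  qed (intro measurable_completion, simp)
  then have "emeasure lborel {0<..<m} \<le> emeasure lborel {s \<in> {0<..t}. l \<le> rearrangement f s}"
    using m by (intro emeasure_mono) auto
  then show ?thesis using m by (simp add: D_def)
qed

lemma nn_integral_on_set_le_average:
  fixes f :: "'a::euclidean_space \<Rightarrow> complex"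
  assumes f[measurable]: "f \<in> borel_measurable borel" and t: "0 < t"
    and E[measurable]: "E \<in> sets borel" and E_le: "emeasure lborel E \<le> ennreal t"
  shows "(\<integral>\<^sup>+x. ennreal (norm (f x)) * indicator E x \<partial>lborel) \<le> average_rearrangement f t * ennreal t"
proof -
  note layer_cake = nn_integral_layer_cake[OF lborel.sigma_finite_measure_axioms]
  have "(\<integral>\<^sup>+x. ennreal (norm (f x)) * indicator E x \<partial>lborel)
      = (\<integral>\<^sup>+l. emeasure lborel {x \<in> space lborel. ennreal l \<le> ennreal (norm (f x)) * indicator E x}
          * indicator {0<..} l \<partial>lborel)"
    by (rule layer_cake) measurable
  also have "\<dots> \<le> (\<integral>\<^sup>+l. emeasure lborel {s \<in> space lborel. ennreal l \<le> rearrangement f s * indicator {0<..t} s}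
          * indicator {0<..} l \<partial>lborel)"
  proof (rule nn_integral_mono)
    fix l :: real
    show "emeasure lborel {x \<in> space lborel. ennreal l \<le> ennreal (norm (f x)) * indicator E x} * indicator {0<..} l
      \<le> emeasure lborel {s \<in> space lborel. ennreal l \<le> rearrangement f s * indicator {0<..t} s} * indicator {0<..} l"
    proof (cases "0 < l")
      case True
      then have "{x \<in> space lborel. ennreal l \<le> ennreal (norm (f x)) * indicator E x}
            = {x \<in> E. ennreal l \<le> ennreal (norm (f x))}"
          "{s \<in> space lborel. ennreal l \<le> rearrangement f s * indicator {0<..t} s}
            = {s \<in> {0<..t}. ennreal l \<le> rearrangement f s}"
        by (auto simp: indicator_def)
      then show ?thesis
        using emeasure_superlevel_on_set_le[OF f t E E_le, of "ennreal l"] by (simp add: mult_right_mono)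
    qed simp
  qed
  also have "\<dots> = average_rearrangement f t * ennreal t"
    unfolding average_rearrangement_times[OF t] by (rule layer_cake[symmetric]) measurable
  finally show ?thesis .
qed


section \<open>Nonnegative convolutions\<close>

definition nn_convolution :: "('a::euclidean_space \<Rightarrow> ennreal) \<Rightarrow> ('a \<Rightarrow> ennreal) \<Rightarrow> 'a \<Rightarrow> ennreal" where
  "nn_convolution k h x = (\<integral>\<^sup>+y. k (x - y) * h y \<partial>lborel)"

lemma nn_convolution_measurable [measurable]:
  assumes [measurable]: "k \<in> borel_measurable borel" "h \<in> borel_measurable borel"
  shows "nn_convolution k h \<in> borel_measurable borel"
  unfolding nn_convolution_def[abs_def] by measurable

lemma nn_convolution_mono: "(\<And>y. h y \<le> h' y) \<Longrightarrow> nn_convolution k h x \<le> nn_convolution k h' x"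
  unfolding nn_convolution_def by (intro nn_integral_mono mult_left_mono) auto

lemma nn_convolution_add_const:
  assumes [measurable]: "k \<in> borel_measurable borel" "h \<in> borel_measurable borel"
  shows "nn_convolution k (\<lambda>y. h y + a) x = nn_convolution k h x + (\<integral>\<^sup>+y. k y \<partial>lborel) * a"
proof -
  have "nn_convolution k (\<lambda>y. h y + a) x = nn_convolution k h x + (\<integral>\<^sup>+y. k (x - y) \<partial>lborel) * a"
    by (simp add: nn_convolution_def distrib_left nn_integral_add nn_integral_multc)
  also have "(\<integral>\<^sup>+y. k (x - y) \<partial>lborel) = (\<integral>\<^sup>+y. k y \<partial>lborel)"
    using nn_integral_lborel_affine[of k "-1" x] by simp
  finally show ?thesis .
qed

lemma nn_integral_nn_convolution:
  fixes k h :: "'a::euclidean_space \<Rightarrow> ennreal"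
  assumes [measurable]: "k \<in> borel_measurable borel" "h \<in> borel_measurable borel"
  shows "(\<integral>\<^sup>+x. nn_convolution k h x \<partial>lborel) = (\<integral>\<^sup>+x. k x \<partial>lborel) * (\<integral>\<^sup>+x. h x \<partial>lborel)"
proof -
  have "(\<integral>\<^sup>+x. k (x - y) \<partial>lborel) = (\<integral>\<^sup>+x. k x \<partial>lborel)" for y
    using nn_integral_lborel_affine[of k 1 "- y"] by simp
  moreover have "(\<integral>\<^sup>+x. nn_convolution k h x \<partial>lborel) = (\<integral>\<^sup>+y. \<integral>\<^sup>+x. k (x - y) * h y \<partial>lborel \<partial>lborel)"
    unfolding nn_convolution_def by (rule lborel_pair.Fubini') measurable
  ultimately show ?thesis by (simp add: nn_integral_multc nn_integral_cmult)
qed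

lemma nn_convolution_le:
  assumes [measurable]: "h \<in> borel_measurable borel" and k: "\<And>z. k z \<le> a"
  shows "nn_convolution k h x \<le> a * (\<integral>\<^sup>+y. h y \<partial>lborel)"
proof -
  have "nn_convolution k h x \<le> (\<integral>\<^sup>+y. a * h y \<partial>lborel)"
    unfolding nn_convolution_def by (intro nn_integral_mono mult_right_mono k) simp
  then show ?thesis by (simp add: nn_integral_cmult)
qed

lemma emeasure_superlevel_le:
  assumes [measurable]: "f \<in> borel_measurable M" and le: "(\<integral>\<^sup>+x. f x \<partial>M) \<le> s * t"
  shows "emeasure M {x \<in> space M. s < f x} \<le> t"
proof -
  consider (zero) "s = 0" | (top) "s = top" | (finite) "s \<noteq> 0" "s \<noteq> top" by auto
  then show ?thesis
  proof cases
    case zero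
    then have "AE x in M. f x = 0" using le by (simp add: nn_integral_0_iff_AE)
    then have "AE x in M. \<not> s < f x" by eventually_elim (simp add: zero)
    then have "emeasure M {x \<in> space M. s < f x} = 0" by (subst (asm) AE_iff_measurable[OF _ refl]) auto
    then show ?thesis by simp
  next
    case top
    then show ?thesis by simp
  next
    case finite
    have "s * emeasure M {x \<in> space M. s < f x} = (\<integral>\<^sup>+x. s * indicator {x \<in> space M. s < f x} x \<partial>M)"
      by (simp add: nn_integral_cmult_indicator)
    also have "\<dots> \<le> (\<integral>\<^sup>+x. f x \<partial>M)"
      by (intro nn_integral_mono) (auto simp: indicator_def)
    also note le
    finally show ?thesis using finite by (simp add: ennreal_mult_le_mult_iff)
  qed
qed

text \<open>The part of \<open>g\<close> above the height \<open>g\<^sup>*(t)\<close> lives on a set of measure at most \<open>t\<close>, so its integral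
  is at most \<open>t g\<^sup>*\<^sup>*(t)\<close>; the part below is bounded by \<open>g\<^sup>*(t) \<le> g\<^sup>*\<^sup>*(t)\<close>.\<close>

lemma nn_convolution_truncation:
  fixes g :: "'a::euclidean_space \<Rightarrow> complex"
  assumes [measurable]: "g \<in> borel_measurable borel" "k \<in> borel_measurable borel"
    and t: "0 < t" and k: "(\<integral>\<^sup>+x. k x \<partial>lborel) \<le> c"
  obtains h where "h \<in> borel_measurable borel"
    "(\<integral>\<^sup>+x. h x \<partial>lborel) \<le> average_rearrangement g t * ennreal t"
    "\<And>x. nn_convolution k (\<lambda>y. ennreal (norm (g y))) x \<le> nn_convolution k h x + c * average_rearrangement g t"
proof
  define E where "E = {x. rearrangement g t < ennreal (norm (g x))}"
  define h where "h x = ennreal (norm (g x)) * indicator E x" for x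
  have [measurable]: "E \<in> sets borel" unfolding E_def by measurable
  show [measurable]: "h \<in> borel_measurable borel" unfolding h_def by measurable
  show "(\<integral>\<^sup>+x. h x \<partial>lborel) \<le> average_rearrangement g t * ennreal t"
    unfolding h_def E_def
    by (intro nn_integral_on_set_le_average t emeasure_superlevel_rearrangement_le) measurable
  fix x
  have "nn_convolution k (\<lambda>y. ennreal (norm (g y))) x \<le> nn_convolution k (\<lambda>y. h y + rearrangement g t) x"
    by (intro nn_convolution_mono) (auto simp: h_def E_def indicator_def)
  also have "\<dots> = nn_convolution k h x + (\<integral>\<^sup>+y. k y \<partial>lborel) * rearrangement g t"
    by (intro nn_convolution_add_const) measurable
  also have "\<dots> \<le> nn_convolution k h x + c * average_rearrangement g t"
    by (intro add_left_mono mult_mono k rearrangement_le_average t) auto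
  finally show "nn_convolution k (\<lambda>y. ennreal (norm (g y))) x \<le> nn_convolution k h x + c * average_rearrangement g t" .
qed

lemma nn_convolution_le_average:
  fixes g :: "'a::euclidean_space \<Rightarrow> complex"
  assumes [measurable]: "g \<in> borel_measurable borel" "k \<in> borel_measurable borel"
    and t: "0 < t" and k: "(\<integral>\<^sup>+x. k x \<partial>lborel) \<le> c" "\<And>z. k z * ennreal t \<le> c"
  shows "nn_convolution k (\<lambda>y. ennreal (norm (g y))) x \<le> 2 * c * average_rearrangement g t"
proof -
  obtain h where h[measurable]: "h \<in> borel_measurable borel"
    and h_le: "(\<integral>\<^sup>+x. h x \<partial>lborel) \<le> average_rearrangement g t * ennreal t"
    and trunc: "nn_convolution k (\<lambda>y. ennreal (norm (g y))) x \<le> nn_convolution k h x + c * average_rearrangement g t"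
    using nn_convolution_truncation[OF assms(1,2) t k(1)] by metis
  have "k z \<le> c / ennreal t" for z
    using t divide_right_mono_ennreal[OF k(2)[of z], of "ennreal t"] by (simp add: ennreal_mult_divide_eq)
  then have "nn_convolution k h x \<le> c / ennreal t * (\<integral>\<^sup>+y. h y \<partial>lborel)"
    by (intro nn_convolution_le) auto
  also have "\<dots> \<le> c / ennreal t * (average_rearrangement g t * ennreal t)"
    by (intro mult_left_mono h_le) simp
  also have "\<dots> = c * average_rearrangement g t"
    unfolding ennreal_divide_times using t by (simp add: ennreal_mult_divide_eq)
  finally show ?thesis using trunc by (simp add: mult_2 distrib_right add_right_mono order_trans)
qed

lemma emeasure_superlevel_nn_convolution_le:
  fixes g :: "'a::euclidean_space \<Rightarrow> complex"
  assumes [measurable]: "g \<in> borel_measurable borel" "k \<in> borel_measurable borel"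
    and t: "0 < t" and k: "(\<integral>\<^sup>+x. k x \<partial>lborel) \<le> c"
  shows "emeasure lborel {x. 2 * c * average_rearrangement g t < nn_convolution k (\<lambda>y. ennreal (norm (g y))) x} \<le> ennreal t"
proof -
  obtain h where h[measurable]: "h \<in> borel_measurable borel"
    and h_le: "(\<integral>\<^sup>+x. h x \<partial>lborel) \<le> average_rearrangement g t * ennreal t"
    and trunc: "\<And>x. nn_convolution k (\<lambda>y. ennreal (norm (g y))) x \<le> nn_convolution k h x + c * average_rearrangement g t"
    using nn_convolution_truncation[OF assms(1,2) t k] by metis
  have "c * average_rearrangement g t < nn_convolution k h x"
    if "2 * c * average_rearrangement g t < nn_convolution k (\<lambda>y. ennreal (norm (g y))) x" for x
  proof (rule ccontr)
    assume "\<not> c * average_rearrangement g t < nn_convolution k h x"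
    then have "nn_convolution k h x + c * average_rearrangement g t \<le> 2 * c * average_rearrangement g t"
      by (simp add: mult_2 distrib_right add_right_mono)
    then show False using trunc[of x] that by simp
  qed
  then have "emeasure lborel {x. 2 * c * average_rearrangement g t < nn_convolution k (\<lambda>y. ennreal (norm (g y))) x}
      \<le> emeasure lborel {x \<in> space lborel. c * average_rearrangement g t < nn_convolution k h x}"
    by (intro emeasure_mono) auto
  also have "\<dots> \<le> ennreal t"
  proof (rule emeasure_superlevel_le)
    have "(\<integral>\<^sup>+x. nn_convolution k h x \<partial>lborel) \<le> c * (average_rearrangement g t * ennreal t)"
      by (subst nn_integral_nn_convolution) (auto intro!: mult_mono k h_le)
    then show "(\<integral>\<^sup>+x. nn_convolution k h x \<partial>lborel) \<le> c * average_rearrangement g t * ennreal t"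
      by (simp add: mult.assoc)
  qed measurable
  finally show ?thesis .
qed


section \<open>Lorentz--Zygmund quasi-norms\<close>

lemma lz_qnorm_eq:
  "lz_qnorm p b A f = Lp_qnorm (lebesgue_on {0<..}) b
     (\<lambda>t. ennreal (powr_log (recip p - recip b) A t) * rearrangement f t)"
  by (simp add: lz_qnorm_def powr_log_def)

lemma nn_integral_lebesgue_on_half_line:
  "(\<integral>\<^sup>+t. h t \<partial>lebesgue_on {0::real<..}) = (\<integral>\<^sup>+t. h t * indicator {0<..} t \<partial>lborel)"
  using nn_integral_restrict_space[of "{0<..}" lebesgue h] by (simp add: nn_integral_completion)

lemma borel_measurable_half_lineI:
  "h \<in> borel_measurable borel \<Longrightarrow> h \<in> borel_measurable (lebesgue_on {0::real<..})"
  by (intro measurable_restrict_space1 measurable_completion) simp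

lemma rearrangement_le_lz_qnorm:
  assumes "0 < b"
  obtains C where "0 < C"
    "\<And>(f :: 'a::euclidean_space \<Rightarrow> complex) t. 0 < t \<Longrightarrow>
       rearrangement f t \<le> ennreal (C * powr_log (- recip p) (- A) t) * lz_qnorm p b A f"
proof -
  define e where "e = recip p - recip b"
  obtain D where D: "0 < D" "\<And>s t. s / 2 < t \<Longrightarrow> t \<le> s \<Longrightarrow> powr_log e A s \<le> D * powr_log e A t"
    by (rule powr_log_doubling[of e A]) blast
  show ?thesis
  proof (rule that[of "D * 2 powr recip b"])
    show "0 < D * 2 powr recip b" using D by simp
    fix f :: "'a \<Rightarrow> complex" and t :: real assume t: "0 < t"
    define W where "W = D * 2 powr recip b * powr_log (- recip p) (- A) t"
    have W: "0 < W" using D t by (simp add: W_def powr_log_pos)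
    have "1 / W = powr_log e A t / D * (t / 2) powr recip b"
      using t by (simp add: W_def powr_log_minus) (simp add: powr_log_def e_def powr_diff powr_divide)
    then have "ennreal (1 / W) = ennreal (powr_log e A t / D) * ennreal ((t / 2) powr recip b)"
      using D by (simp add: powr_log_nonneg flip: ennreal_mult)
    then have "ennreal (1 / W) * rearrangement f t
        = ennreal (powr_log e A t / D) * rearrangement f t * ennreal ((t / 2) powr recip b)"
      by (simp only: mult_ac)
    also have "\<dots> \<le> lz_qnorm p b A f"
      unfolding lz_qnorm_eq
    proof (rule Lp_qnorm_ge_on_set[OF \<open>0 < b\<close>])
      show "{t / 2<..t} \<in> sets (lebesgue_on {0<..})"
        using t by (simp add: sets_restrict_space_iff subset_iff)
      show "emeasure (lebesgue_on {0<..}) {t / 2<..t} = ennreal (t / 2)"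
        using t by (subst emeasure_restrict_space) auto
      show "ennreal (powr_log e A t / D) * rearrangement f t
          \<le> ennreal (powr_log (recip p - recip b) A s) * rearrangement f s" if "s \<in> {t / 2<..t}" for s
        using that D by (intro mult_mono ennreal_leI rearrangement_antimono)
          (auto simp: e_def[symmetric] pos_divide_le_eq mult.commute)
    qed (use t in simp)
    finally have "ennreal W * (ennreal (1 / W) * rearrangement f t) \<le> ennreal W * lz_qnorm p b A f"
      by (rule mult_left_mono) simp
    then show "rearrangement f t \<le> ennreal W * lz_qnorm p b A f"
      using W by (simp flip: mult.assoc ennreal_mult)
  qed
qed

lemma broken_log_zero: "broken_log 0 t = 1"
  by (simp add: broken_log_def add_nonneg_eq_0_iff)

lemma lz_qnorm_one_one: "lz_qnorm 1 1 0 f = (\<integral>\<^sup>+s. rearrangement f s * indicator {0<..} s \<partial>lborel)"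
proof -
  have "recip 1 = 1" using recip_ennreal[of 1] by simp
  moreover have "powr_log 0 0 s = 1" if "0 < s" for s
    using that by (simp add: powr_log_def broken_log_zero)
  ultimately show ?thesis
    by (simp add: lz_qnorm_eq Lp_qnorm_def nn_integral_lebesgue_on_half_line)
      (auto intro!: nn_integral_cong simp: indicator_def)
qed

definition lz_admissible :: "real \<Rightarrow> ennreal \<Rightarrow> real \<times> real \<Rightarrow> bool" where
  "lz_admissible q c B \<longleftrightarrow> (q = 1 \<and> c = 1 \<and> B = 0) \<or> 1 < q"

lemma average_rearrangement_le_lz_qnorm_one:
  assumes t: "0 < t"
  shows "average_rearrangement f t \<le> ennreal (powr_log (-1) 0 t) * lz_qnorm 1 1 0 f"
proof (rule average_rearrangement_leI[OF t])
  have "ennreal (powr_log (-1) 0 t) * ennreal t = 1"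
    using t by (simp add: powr_log_def broken_log_zero powr_minus_divide flip: ennreal_mult)
  then have "ennreal (powr_log (-1) 0 t) * lz_qnorm 1 1 0 f * ennreal t = lz_qnorm 1 1 0 f"
    by (metis mult.assoc mult.commute mult_1)
  moreover have "(\<integral>\<^sup>+s. rearrangement f s * indicator {0<..t} s \<partial>lborel) \<le> lz_qnorm 1 1 0 f"
    unfolding lz_qnorm_one_one by (intro nn_integral_mono) (auto simp: indicator_def)
  ultimately show "(\<integral>\<^sup>+s. rearrangement f s * indicator {0<..t} s \<partial>lborel)
      \<le> ennreal (powr_log (-1) 0 t) * lz_qnorm 1 1 0 f * ennreal t" by simp
qed

lemma average_rearrangement_le_powr_log:
  assumes "-1 < e"
  obtains C where "0 < C"
    "\<And>(f :: 'a::euclidean_space \<Rightarrow> complex) N t. 0 < t \<Longrightarrow>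
      (\<And>s. 0 < s \<Longrightarrow> rearrangement f s \<le> ennreal (powr_log e A s) * N) \<Longrightarrow>
      average_rearrangement f t \<le> ennreal (C * powr_log e A t) * N"
proof -
  obtain C where C: "0 < C" "\<And>t. 0 < t \<Longrightarrow>
      (\<integral>\<^sup>+s. ennreal (powr_log e A s) * indicator {0<..t} s \<partial>lborel) \<le> ennreal (C * (t * powr_log e A t))"
    using nn_integral_powr_log_Ioc_le[OF assms] by metis
  show ?thesis
  proof (rule that[OF C(1)], rule average_rearrangement_leI)
    fix f :: "'a \<Rightarrow> complex" and N and t :: real
    assume t: "0 < t" and f: "\<And>s. 0 < s \<Longrightarrow> rearrangement f s \<le> ennreal (powr_log e A s) * N"
    have "(\<integral>\<^sup>+s. rearrangement f s * indicator {0<..t} s \<partial>lborel)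
        \<le> (\<integral>\<^sup>+s. ennreal (powr_log e A s) * indicator {0<..t} s * N \<partial>lborel)"
      using f by (intro nn_integral_mono) (auto simp: indicator_def)
    also have "\<dots> = (\<integral>\<^sup>+s. ennreal (powr_log e A s) * indicator {0<..t} s \<partial>lborel) * N"
      by (rule nn_integral_multc) measurable
    also have "\<dots> \<le> ennreal (C * (t * powr_log e A t)) * N"
      by (intro mult_right_mono C(2) t) simp
    also have "\<dots> = ennreal (C * powr_log e A t) * N * ennreal t"
      using C(1) t by (simp add: ennreal_mult powr_log_nonneg mult_ac)
    finally show "(\<integral>\<^sup>+s. rearrangement f s * indicator {0<..t} s \<partial>lborel)
        \<le> ennreal (C * powr_log e A t) * N * ennreal t" .
  qed
qed

lemma average_rearrangement_le_lz_qnorm: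
  fixes q :: real
  assumes "0 < c" and adm: "lz_admissible q c B"
  obtains C where "0 < C"
    "\<And>(f :: 'a::euclidean_space \<Rightarrow> complex) t. 0 < t \<Longrightarrow>
       average_rearrangement f t \<le> ennreal (C * powr_log (- (1 / q)) (- B) t) * lz_qnorm (ennreal q) c B f"
proof -
  consider (one) "q = 1" "c = 1" "B = 0" | (greater) "1 < q"
    using adm unfolding lz_admissible_def by blast
  then show ?thesis
  proof cases
    case one
    then show ?thesis using average_rearrangement_le_lz_qnorm_one by (intro that[of 1]) simp_all
  next
    case greater
    obtain C where C: "0 < C" "\<And>(f :: 'a \<Rightarrow> complex) t. 0 < t \<Longrightarrow>
        rearrangement f t \<le> ennreal (C * powr_log (- (1 / q)) (- B) t) * lz_qnorm (ennreal q) c B f"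
      using rearrangement_le_lz_qnorm[OF \<open>0 < c\<close>, where p = "ennreal q" and A = B and 'a = 'a] greater
      by (auto simp: recip_ennreal)
    have "-1 < - (1 / q)" using greater by simp
    then obtain D where D: "0 < D" "\<And>(f :: 'a \<Rightarrow> complex) N t. 0 < t \<Longrightarrow>
        (\<And>s. 0 < s \<Longrightarrow> rearrangement f s \<le> ennreal (powr_log (- (1 / q)) (- B) s) * N) \<Longrightarrow>
        average_rearrangement f t \<le> ennreal (D * powr_log (- (1 / q)) (- B) t) * N"
      by (rule average_rearrangement_le_powr_log) blast
    show ?thesis
    proof (rule that[of "C * D"])
      show "0 < C * D" using C D by simp
      fix f :: "'a \<Rightarrow> complex" and t :: real assume t: "0 < t"
      have "average_rearrangement f t
          \<le> ennreal (D * powr_log (- (1 / q)) (- B) t) * (ennreal C * lz_qnorm (ennreal q) c B f)"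
        using C by (intro D(2) t) (simp add: ennreal_mult powr_log_nonneg mult_ac)
      then show "average_rearrangement f t
          \<le> ennreal (C * D * powr_log (- (1 / q)) (- B) t) * lz_qnorm (ennreal q) c B f"
        using C(1) D(1) by (simp add: ennreal_mult powr_log_nonneg mult_ac)
    qed
  qed
qed

lemma Lp_qnorm_powr_log_le:
  assumes p: "0 < p" and [measurable]: "S \<in> sets borel" and "S \<subseteq> {0<..}" and "0 < C" "0 \<le> N"
    and le: "(\<integral>\<^sup>+t. ennreal (powr_log (p * e) (p *\<^sub>R A) t) * indicator S t \<partial>lborel) \<le> ennreal (C * N powr p)"
  shows "Lp_qnorm (lebesgue_on {0<..}) (ennreal p) (\<lambda>t. ennreal (powr_log e A t) * indicator S t)
       \<le> ennreal (C powr (1 / p) * N)"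
proof -
  have "(\<integral>\<^sup>+t. ennpowr (ennreal (powr_log e A t) * indicator S t) p \<partial>lebesgue_on {0<..})
      = (\<integral>\<^sup>+t. ennreal (powr_log (p * e) (p *\<^sub>R A) t) * indicator S t \<partial>lborel)"
    unfolding nn_integral_lebesgue_on_half_line
    using p \<open>S \<subseteq> {0<..}\<close> by (intro nn_integral_cong)
      (auto simp: indicator_def ennpowr_ennreal powr_log_nonneg powr_log_powr)
  also note le
  also have "ennreal (C * N powr p) = ennpowr (ennreal (C powr (1 / p) * N)) p"
    using p \<open>0 < C\<close> \<open>0 \<le> N\<close> by (simp add: ennpowr_ennreal powr_mult powr_powr)
  finally show ?thesis using p by (simp add: Lp_qnorm_le_iff)
qed

lemma Lp_qnorm_half_line_top_le:
  fixes h :: "real \<Rightarrow> ennreal"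
  assumes "h \<in> borel_measurable borel" "\<And>t. 0 < t \<Longrightarrow> h t \<le> N"
  shows "Lp_qnorm (lebesgue_on {0<..}) top h \<le> N"
  using assms by (subst Lp_qnorm_top_le_iff)
    (auto intro!: borel_measurable_half_lineI AE_I2 simp: space_restrict_space)

lemma Lp_qnorm_powr_log_Ioc_le_real:
  assumes p: "0 < p" and A: "fst A < - (1 / p)" "- (1 / p) < snd A"
  obtains C where "0 < C"
    "\<And>r. 0 < r \<Longrightarrow> Lp_qnorm (lebesgue_on {0<..}) (ennreal p) (\<lambda>t. ennreal (powr_log (- (1 / p)) A t) * indicator {0<..r} t)
       \<le> ennreal (C * broken_log (pair_shift A (1 / p)) r)"
proof -
  have "fst (p *\<^sub>R A) < -1" "-1 < snd (p *\<^sub>R A)"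
    using A p by (simp_all add: field_simps)
  then obtain C where C: "0 < C" "\<And>r. 0 < r \<Longrightarrow>
      (\<integral>\<^sup>+t. ennreal (powr_log (-1) (p *\<^sub>R A) t) * indicator {0<..r} t \<partial>lborel)
        \<le> ennreal (C * broken_log (pair_shift (p *\<^sub>R A) 1) r)"
    by (rule nn_integral_powr_log_minus_one_le) blast
  show ?thesis
  proof (rule that[of "C powr (1 / p)"])
    show "0 < C powr (1 / p)" using C by simp
    fix r :: real assume r: "0 < r"
    have "p *\<^sub>R pair_shift A (1 / p) = pair_shift (p *\<^sub>R A) 1"
      using p by (simp add: pair_shift_def distrib_left)
    then have "broken_log (pair_shift A (1 / p)) r powr p = broken_log (pair_shift (p *\<^sub>R A) 1) r"
      by (simp add: broken_log_powr)
    moreover have "p * - (1 / p) = -1" using p by simp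
    ultimately have le: "(\<integral>\<^sup>+t. ennreal (powr_log (p * - (1 / p)) (p *\<^sub>R A) t) * indicator {0<..r} t \<partial>lborel)
        \<le> ennreal (C * broken_log (pair_shift A (1 / p)) r powr p)"
      using C(2)[OF r] by (simp only:)
    show "Lp_qnorm (lebesgue_on {0<..}) (ennreal p) (\<lambda>t. ennreal (powr_log (- (1 / p)) A t) * indicator {0<..r} t)
       \<le> ennreal (C powr (1 / p) * broken_log (pair_shift A (1 / p)) r)"
      by (rule Lp_qnorm_powr_log_le[OF p _ _ C(1) less_imp_le[OF broken_log_pos] le]) auto
  qed
qed

lemma Lp_qnorm_powr_log_Ioc_le:
  assumes "0 < b" and A: "fst A < - recip b" "- recip b < snd A"
  obtains C where "0 < C"
    "\<And>r. 0 < r \<Longrightarrow> Lp_qnorm (lebesgue_on {0<..}) b (\<lambda>t. ennreal (powr_log (- recip b) A t) * indicator {0<..r} t)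
       \<le> ennreal (C * broken_log (pair_shift A (recip b)) r)"
  using \<open>0 < b\<close>
proof (cases rule: exponent_cases)
  case top
  show ?thesis
  proof (rule that[of 1])
    fix r :: real assume r: "0 < r"
    have "ennreal (powr_log 0 A t) * indicator {0<..r} t \<le> ennreal (broken_log A r)" if "0 < t" for t
      using that broken_log_mono[of A t r] A top by (auto simp: indicator_def powr_log_zero intro: ennreal_leI)
    then have "Lp_qnorm (lebesgue_on {0<..}) top (\<lambda>t. ennreal (powr_log 0 A t) * indicator {0<..r} t)
        \<le> ennreal (broken_log A r)"
      by (intro Lp_qnorm_half_line_top_le) auto
    moreover have "pair_shift A (recip b) = A" using top by (simp add: pair_shift_def)
    ultimately show "Lp_qnorm (lebesgue_on {0<..}) b (\<lambda>t. ennreal (powr_log (- recip b) A t) * indicator {0<..r} t)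
       \<le> ennreal (1 * broken_log (pair_shift A (recip b)) r)"
      using top by simp
  qed simp
next
  case (real p)
  show ?thesis
    by (rule Lp_qnorm_powr_log_Ioc_le_real[OF real(2) A[unfolded real(3)]])
      (rule that[unfolded real(3), unfolded real(1)])
qed

lemma Lp_qnorm_powr_log_Ioi_le_real:
  assumes p: "0 < p" and e: "0 < e"
  obtains C where "0 < C"
    "\<And>r. 0 < r \<Longrightarrow> Lp_qnorm (lebesgue_on {0<..}) (ennreal p) (\<lambda>t. ennreal (powr_log (- (1 / p) - e) A t) * indicator {r<..} t)
       \<le> ennreal (C * powr_log (- e) A r)"
proof -
  have exponent: "p * (- (1 / p) - e) = - (p * e) - 1" using p by (simp add: field_simps)
  have "p * (- (1 / p) - e) < -1" unfolding exponent using p e by simp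
  then obtain C where C: "0 < C" "\<And>r. 0 < r \<Longrightarrow>
      (\<integral>\<^sup>+t. ennreal (powr_log (p * (- (1 / p) - e)) (p *\<^sub>R A) t) * indicator {r<..} t \<partial>lborel)
        \<le> ennreal (C * (r * powr_log (p * (- (1 / p) - e)) (p *\<^sub>R A) r))"
    by (rule nn_integral_powr_log_Ioi_le) blast
  show ?thesis
  proof (rule that[of "C powr (1 / p)"])
    show "0 < C powr (1 / p)" using C by simp
    fix r :: real assume r: "0 < r"
    have "r * powr_log (p * (- (1 / p) - e)) (p *\<^sub>R A) r = powr_log (- e) A r powr p"
      unfolding exponent using r by (simp add: powr_log_powr) (simp add: powr_log_def powr_diff)
    then have le: "(\<integral>\<^sup>+t. ennreal (powr_log (p * (- (1 / p) - e)) (p *\<^sub>R A) t) * indicator {r<..} t \<partial>lborel)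
        \<le> ennreal (C * powr_log (- e) A r powr p)"
      using C(2)[OF r] by (simp only:)
    show "Lp_qnorm (lebesgue_on {0<..}) (ennreal p) (\<lambda>t. ennreal (powr_log (- (1 / p) - e) A t) * indicator {r<..} t)
       \<le> ennreal (C powr (1 / p) * powr_log (- e) A r)"
      using r by (intro Lp_qnorm_powr_log_le[OF p _ _ C(1) powr_log_nonneg le]) auto
  qed
qed

lemma Lp_qnorm_powr_log_Ioi_le:
  assumes "0 < b" and e: "0 < e"
  obtains C where "0 < C"
    "\<And>r. 0 < r \<Longrightarrow> Lp_qnorm (lebesgue_on {0<..}) b (\<lambda>t. ennreal (powr_log (- recip b - e) A t) * indicator {r<..} t)
       \<le> ennreal (C * powr_log (- e) A r)"
  using \<open>0 < b\<close>
proof (cases rule: exponent_cases)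
  case top
  have "- e < 0" using e by simp
  then obtain C where C: "0 < C"
    "\<And>s t. 0 < s \<Longrightarrow> s \<le> t \<Longrightarrow> powr_log (- e) A t \<le> C * powr_log (- e) A s * (t / s) powr 0"
    using powr_log_potter by metis
  show ?thesis
  proof (rule that[OF C(1)])
    fix r :: real assume r: "0 < r"
    have "ennreal (powr_log (- e) A t) * indicator {r<..} t \<le> ennreal (C * powr_log (- e) A r)" for t
      using C(2)[of r t] r by (auto simp: indicator_def intro: ennreal_leI)
    then have "Lp_qnorm (lebesgue_on {0<..}) top (\<lambda>t. ennreal (powr_log (- e) A t) * indicator {r<..} t)
        \<le> ennreal (C * powr_log (- e) A r)"
      by (intro Lp_qnorm_half_line_top_le) auto
    then show "Lp_qnorm (lebesgue_on {0<..}) b (\<lambda>t. ennreal (powr_log (- recip b - e) A t) * indicator {r<..} t)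
       \<le> ennreal (C * powr_log (- e) A r)"
      using top by simp
  qed
next
  case (real p)
  show ?thesis
    by (rule Lp_qnorm_powr_log_Ioi_le_real[OF real(2) e]) (rule that[unfolded real(3), unfolded real(1)])
qed

lemma Lp_qnorm_half_line_split_le:
  fixes h u v :: "real \<Rightarrow> ennreal"
  assumes borel: "h \<in> borel_measurable borel" "u \<in> borel_measurable borel" "v \<in> borel_measurable borel"
    and "0 < b" and le_u: "\<And>t. 0 < t \<Longrightarrow> t \<le> r \<Longrightarrow> h t \<le> u t" and le_v: "\<And>t. 0 < t \<Longrightarrow> r < t \<Longrightarrow> h t \<le> v t"
    and N: "Lp_qnorm (lebesgue_on {0<..}) b (\<lambda>t. u t * indicator {0<..r} t) \<le> N"
      "Lp_qnorm (lebesgue_on {0<..}) b (\<lambda>t. v t * indicator {r<..} t) \<le> N"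
  shows "Lp_qnorm (lebesgue_on {0<..}) b h \<le> ennreal (2 powr recip b) * N"
proof -
  define u' where "u' t = u t * indicator {0<..r} t" for t
  define v' where "v' t = v t * indicator {r<..} t" for t
  note [measurable] = borel
  have "u' \<in> borel_measurable borel" "v' \<in> borel_measurable borel"
    unfolding u'_def v'_def by simp_all
  note [measurable] = borel[THEN borel_measurable_half_lineI] this[THEN borel_measurable_half_lineI]
  have "h t \<le> max (u' t) (v' t)" if "0 < t" for t
    using that le_u[of t] le_v[of t] by (cases "t \<le> r") (auto simp: u'_def v'_def)
  then have "Lp_qnorm (lebesgue_on {0<..}) b h \<le> Lp_qnorm (lebesgue_on {0<..}) b (\<lambda>t. max (u' t) (v' t))"
    using \<open>0 < b\<close> by (intro Lp_qnorm_mono) (auto simp: space_restrict_space)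
  also have "\<dots> \<le> ennreal (2 powr recip b) * N"
    using \<open>0 < b\<close> N[folded u'_def v'_def] by (intro Lp_qnorm_max_le) auto
  finally show ?thesis .
qed

lemma powr_log_le_pair_shift:
  assumes "0 \<le> s"
  shows "powr_log e A t \<le> powr_log e (pair_shift A s) t"
proof -
  have "1 \<le> (1 + \<bar>ln t\<bar>) powr s" using assms by (intro ge_one_powr_ge_zero) auto
  from mult_left_mono[OF this powr_log_nonneg[of e A t]] show ?thesis
    by (simp add: powr_log_def broken_log_pair_shift mult.assoc)
qed

lemma Lp_qnorm_powr_log_max_le_add:
  assumes "0 < b" "0 \<le> c" "0 \<le> d"
    and Ioc: "Lp_qnorm (lebesgue_on {0<..}) b (\<lambda>t. ennreal (powr_log e A t) * indicator {0<..r} t) \<le> ennreal c"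
    and Ioi: "Lp_qnorm (lebesgue_on {0<..}) b (\<lambda>t. ennreal (powr_log (e + f) (A + B) t) * indicator {r<..} t) \<le> ennreal d"
  shows "Lp_qnorm (lebesgue_on {0<..}) b (\<lambda>t. ennreal (powr_log e A t * powr_log f B (max r t)))
    \<le> ennreal (2 powr recip b) * ennreal (powr_log f B r * c + d)"
proof (rule Lp_qnorm_half_line_split_le[where r = r
      and u = "\<lambda>t. ennreal (powr_log f B r) * ennreal (powr_log e A t)"
      and v = "\<lambda>t. ennreal (powr_log (e + f) (A + B) t)"])
  have "Lp_qnorm (lebesgue_on {0<..}) b
        (\<lambda>t. ennreal (powr_log f B r) * (ennreal (powr_log e A t) * indicator {0<..r} t))
      \<le> ennreal (powr_log f B r) * ennreal c"
    using \<open>0 < b\<close>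
    by (intro order_trans[OF Lp_qnorm_cmult_le] mult_left_mono Ioc borel_measurable_half_lineI) auto
  also have "\<dots> \<le> ennreal (powr_log f B r * c + d)"
    using \<open>0 \<le> c\<close> \<open>0 \<le> d\<close> by (subst ennreal_mult[symmetric]) (auto simp: powr_log_nonneg intro!: ennreal_leI)
  finally show "Lp_qnorm (lebesgue_on {0<..}) b
      (\<lambda>t. ennreal (powr_log f B r) * ennreal (powr_log e A t) * indicator {0<..r} t)
      \<le> ennreal (powr_log f B r * c + d)"
    by (simp add: mult.assoc)
  show "Lp_qnorm (lebesgue_on {0<..}) b
      (\<lambda>t. ennreal (powr_log (e + f) (A + B) t) * indicator {r<..} t) \<le> ennreal (powr_log f B r * c + d)"
    using \<open>0 \<le> c\<close> by (intro order_trans[OF Ioi] ennreal_leI) (simp add: powr_log_nonneg)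
qed (use \<open>0 < b\<close> in \<open>auto simp: max_def powr_log_mult powr_log_nonneg mult.commute[of "powr_log f B r"]
    simp flip: ennreal_mult\<close>)

lemma Lp_qnorm_powr_log_max_le:
  assumes "0 < e" "0 < b" and A: "fst A < - recip b" "- recip b < snd A"
  obtains C where "0 < C"
    "\<And>r. 0 < r \<Longrightarrow>
      Lp_qnorm (lebesgue_on {0<..}) b (\<lambda>t. ennreal (powr_log (- recip b) A t * powr_log (- e) B (max r t)))
        \<le> ennreal (C * powr_log (- e) (pair_shift (A + B) (recip b)) r)"
proof -
  define E where "E = pair_shift (A + B) (recip b)"
  obtain C where C: "0 < C" "\<And>r. 0 < r \<Longrightarrow>
      Lp_qnorm (lebesgue_on {0<..}) b (\<lambda>t. ennreal (powr_log (- recip b) A t) * indicator {0<..r} t)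
        \<le> ennreal (C * broken_log (pair_shift A (recip b)) r)"
    by (rule Lp_qnorm_powr_log_Ioc_le[OF \<open>0 < b\<close> A]) blast
  obtain D where D: "0 < D" "\<And>r. 0 < r \<Longrightarrow>
      Lp_qnorm (lebesgue_on {0<..}) b (\<lambda>t. ennreal (powr_log (- recip b + - e) (A + B) t) * indicator {r<..} t)
        \<le> ennreal (D * powr_log (- e) (A + B) r)"
    using Lp_qnorm_powr_log_Ioi_le[OF \<open>0 < b\<close> \<open>0 < e\<close>, of "A + B"] by auto
  show ?thesis
  proof (rule that[of "2 powr recip b * (C + D)"])
    show "0 < 2 powr recip b * (C + D)" using C D by simp
    fix r :: real assume r: "0 < r"
    have "powr_log (- e) B r * broken_log (pair_shift A (recip b)) r = powr_log (- e) E r"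
      by (simp add: E_def powr_log_def broken_log_pair_shift broken_log_add)
    then have "powr_log (- e) B r * (C * broken_log (pair_shift A (recip b)) r) = C * powr_log (- e) E r"
      by (metis mult.left_commute)
    moreover have "D * powr_log (- e) (A + B) r \<le> D * powr_log (- e) E r"
      unfolding E_def using D(1) by (intro mult_left_mono powr_log_le_pair_shift recip_nonneg) simp
    ultimately have le: "powr_log (- e) B r * (C * broken_log (pair_shift A (recip b)) r)
        + D * powr_log (- e) (A + B) r \<le> (C + D) * powr_log (- e) E r"
      unfolding distrib_right by linarith
    have "Lp_qnorm (lebesgue_on {0<..}) b (\<lambda>t. ennreal (powr_log (- recip b) A t * powr_log (- e) B (max r t)))
        \<le> ennreal (2 powr recip b) * ennreal (powr_log (- e) B r * (C * broken_log (pair_shift A (recip b)) r)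
            + D * powr_log (- e) (A + B) r)"
      using C(1) D(1) by (intro Lp_qnorm_powr_log_max_le_add \<open>0 < b\<close> C(2)[OF r] D(2)[OF r])
        (simp_all add: powr_log_nonneg less_imp_le[OF broken_log_pos])
    also have "\<dots> \<le> ennreal (2 powr recip b) * ennreal ((C + D) * powr_log (- e) E r)"
      by (intro mult_left_mono ennreal_leI le) simp
    finally show "Lp_qnorm (lebesgue_on {0<..}) b (\<lambda>t. ennreal (powr_log (- recip b) A t * powr_log (- e) B (max r t)))
        \<le> ennreal (2 powr recip b * (C + D) * powr_log (- e) (pair_shift (A + B) (recip b)) r)"
      by (simp add: E_def mult.assoc flip: ennreal_mult')
  qed
qed

lemma lz_qnorm_top_le:
  assumes "0 < e" "0 < b" and A: "fst A < - recip b" "- recip b < snd A"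
  obtains C where "0 < C"
    "\<And>(f :: 'a::euclidean_space \<Rightarrow> complex) N r. 0 < r \<Longrightarrow>
      (\<And>t. 0 < t \<Longrightarrow> rearrangement f t \<le> N * ennreal (powr_log (- e) B (max r t))) \<Longrightarrow>
      lz_qnorm top b A f \<le> N * ennreal (C * powr_log (- e) (pair_shift (A + B) (recip b)) r)"
proof -
  obtain C where C: "0 < C" "\<And>r. 0 < r \<Longrightarrow>
      Lp_qnorm (lebesgue_on {0<..}) b (\<lambda>t. ennreal (powr_log (- recip b) A t * powr_log (- e) B (max r t)))
        \<le> ennreal (C * powr_log (- e) (pair_shift (A + B) (recip b)) r)"
    by (rule Lp_qnorm_powr_log_max_le[OF assms]) blast
  show ?thesis
  proof (rule that[OF C(1)])
    fix f :: "'a \<Rightarrow> complex" and N r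
    assume r: "0 < r" and f: "\<And>t. 0 < t \<Longrightarrow> rearrangement f t \<le> N * ennreal (powr_log (- e) B (max r t))"
    have "lz_qnorm top b A f \<le> Lp_qnorm (lebesgue_on {0<..}) b
        (\<lambda>t. N * ennreal (powr_log (- recip b) A t * powr_log (- e) B (max r t)))"
      unfolding lz_qnorm_eq
    proof (rule Lp_qnorm_mono)
      fix t :: real assume "t \<in> space (lebesgue_on {0<..})"
      then have "ennreal (powr_log (- recip b) A t) * rearrangement f t
          \<le> ennreal (powr_log (- recip b) A t) * (N * ennreal (powr_log (- e) B (max r t)))"
        by (intro mult_left_mono f) (auto simp: space_restrict_space)
      then show "ennreal (powr_log (recip top - recip b) A t) * rearrangement f t
          \<le> N * ennreal (powr_log (- recip b) A t * powr_log (- e) B (max r t))"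
        by (simp add: ennreal_mult powr_log_nonneg mult_ac)
    qed (use \<open>0 < b\<close> in \<open>auto intro!: borel_measurable_half_lineI\<close>)
    also have "\<dots> \<le> N * ennreal (C * powr_log (- e) (pair_shift (A + B) (recip b)) r)"
      using \<open>0 < b\<close>
      by (intro order_trans[OF Lp_qnorm_cmult_le] mult_left_mono C(2)[OF r] borel_measurable_half_lineI) auto
    finally show "lz_qnorm top b A f \<le> N * ennreal (C * powr_log (- e) (pair_shift (A + B) (recip b)) r)" .
  qed
qed


section \<open>Rapidly decreasing functions\<close>

lemma integrable_one_plus_norm_power:
  "integrable lborel (\<lambda>x::'a::euclidean_space. 1 / (1 + norm x) ^ (2 * DIM('a)))"
proof (rule Bochner_Integration.integrable_bound)
  have "integrable lborel (\<lambda>x::real. inverse (1 + x\<^sup>2))"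
    using integrable_inverse_1_plus_square by (simp add: set_integrable_def)
  then show "integrable lborel (\<lambda>x::'a. \<Prod>b\<in>Basis. inverse (1 + (x \<bullet> b)\<^sup>2))"
    by (rule integrable_lborel_prod)
  have "(\<Prod>b\<in>Basis. 1 + (x \<bullet> b)\<^sup>2) \<le> (1 + norm x) ^ (2 * DIM('a))" for x :: 'a
  proof -
    have "(\<Prod>b\<in>Basis. 1 + (x \<bullet> b)\<^sup>2) \<le> (\<Prod>b\<in>(Basis::'a set). (1 + norm x)\<^sup>2)"
    proof (rule prod_mono)
      fix b :: 'a assume b: "b \<in> Basis"
      have "(x \<bullet> b)\<^sup>2 \<le> (norm x)\<^sup>2"
        using Basis_le_norm[OF b, of x] by (simp add: abs_le_square_iff[symmetric])
      then show "0 \<le> 1 + (x \<bullet> b)\<^sup>2 \<and> 1 + (x \<bullet> b)\<^sup>2 \<le> (1 + norm x)\<^sup>2"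
        by (simp add: power2_sum add_increasing2)
    qed
    then show ?thesis by (simp add: power_mult)
  qed
  then have "inverse ((1 + norm x) ^ (2 * DIM('a))) \<le> inverse (\<Prod>b\<in>Basis. 1 + (x \<bullet> b)\<^sup>2)" for x :: 'a
    by (intro le_imp_inverse_le prod_pos) (auto intro: add_pos_nonneg)
  then show "AE x in lborel. norm (1 / (1 + norm (x::'a)) ^ (2 * DIM('a)))
      \<le> norm (\<Prod>b\<in>Basis. inverse (1 + (x \<bullet> b)\<^sup>2))"
    by (intro AE_I2) (simp add: inverse_eq_divide prod_dividef prod_nonneg)
qed measurable

definition rapidly_decreasing :: "('a::euclidean_space \<Rightarrow> complex) \<Rightarrow> bool" where
  "rapidly_decreasing f \<longleftrightarrow> f \<in> borel_measurable borel \<and>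
     (\<forall>m. \<exists>C. \<forall>x. (1 + norm x) ^ m * norm (f x) \<le> C)"

lemma rapidly_decreasing_measurable: "rapidly_decreasing f \<Longrightarrow> f \<in> borel_measurable borel"
  by (simp add: rapidly_decreasing_def)

lemma rapidly_decreasing_bound:
  assumes "rapidly_decreasing f"
  obtains C where "0 \<le> C" "\<And>x. (1 + norm x) ^ m * norm (f x) \<le> C"
proof -
  obtain C where C: "\<And>x. (1 + norm x) ^ m * norm (f x) \<le> C"
    using assms unfolding rapidly_decreasing_def by blast
  have "0 \<le> (1 + norm (0::'a)) ^ m * norm (f 0)" by simp
  then have "0 \<le> C" using C by (rule order_trans)
  then show ?thesis using C by (rule that)
qed

lemma rapidly_decreasing_bounded:
  assumes "rapidly_decreasing f"
  obtains C where "0 \<le> C" "\<And>x. norm (f x) \<le> C"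
  using rapidly_decreasing_bound[OF assms, of 0] by auto

lemma rapidly_decreasing_integrable_moment:
  assumes f: "rapidly_decreasing (f :: 'a::euclidean_space \<Rightarrow> complex)"
  shows "integrable lborel (\<lambda>x. (1 + norm x) ^ m * norm (f x))"
proof -
  note [measurable] = rapidly_decreasing_measurable[OF f]
  obtain C where C: "0 \<le> C" "\<And>x. (1 + norm x) ^ (2 * DIM('a) + m) * norm (f x) \<le> C"
    using rapidly_decreasing_bound[OF f] by blast
  show ?thesis
  proof (rule Bochner_Integration.integrable_bound)
    show "integrable lborel (\<lambda>x::'a. C * (1 / (1 + norm x) ^ (2 * DIM('a))))"
      by (intro integrable_mult_right integrable_one_plus_norm_power)
    have "(1 + norm x) ^ m * norm (f x) \<le> C / (1 + norm x) ^ (2 * DIM('a))" for x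
      using C(2)[of x] by (simp add: power_add pos_le_divide_eq add_pos_nonneg mult_ac)
    then show "AE x in lborel. norm ((1 + norm x) ^ m * norm (f x)) \<le> norm (C * (1 / (1 + norm x) ^ (2 * DIM('a))))"
      using C(1) by (intro AE_I2) (simp add: abs_mult)
  qed measurable
qed

lemma rapidly_decreasing_integrable: "rapidly_decreasing f \<Longrightarrow> integrable lborel f"
  using rapidly_decreasing_integrable_moment[of f 0] rapidly_decreasing_measurable[of f]
  by (simp add: integrable_norm_iff)

lemma rapidly_decreasing_add:
  assumes f: "rapidly_decreasing f" and g: "rapidly_decreasing g"
  shows "rapidly_decreasing (\<lambda>x. f x + g x)"
  unfolding rapidly_decreasing_def
proof (intro conjI allI)
  show "(\<lambda>x. f x + g x) \<in> borel_measurable borel"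
    by (intro borel_measurable_add rapidly_decreasing_measurable assms)
  fix m
  obtain C where C: "\<And>x. (1 + norm x) ^ m * norm (f x) \<le> C"
    using rapidly_decreasing_bound[OF f] by blast
  obtain D where D: "\<And>x. (1 + norm x) ^ m * norm (g x) \<le> D"
    using rapidly_decreasing_bound[OF g] by blast
  have "(1 + norm x) ^ m * norm (f x + g x) \<le> C + D" for x
  proof -
    have "(1 + norm x) ^ m * norm (f x + g x) \<le> (1 + norm x) ^ m * (norm (f x) + norm (g x))"
      by (intro mult_left_mono norm_triangle_ineq) auto
    also have "\<dots> \<le> C + D" using C[of x] D[of x] by (simp add: distrib_left)
    finally show ?thesis .
  qed
  then show "\<exists>C. \<forall>x. (1 + norm x) ^ m * norm (f x + g x) \<le> C" by blast
qed

lemma rapidly_decreasing_sum: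
  assumes "finite J" "\<And>j. j \<in> J \<Longrightarrow> rapidly_decreasing (f j)"
  shows "rapidly_decreasing (\<lambda>x. \<Sum>j\<in>J. f j x)"
  using assms
proof (induction J)
  case empty
  show ?case by (auto simp: rapidly_decreasing_def)
next
  case (insert a F)
  then show ?case by (simp add: rapidly_decreasing_add)
qed

lemma rapidly_decreasing_dilate:
  assumes f: "rapidly_decreasing f" and s: "0 < s"
  shows "rapidly_decreasing (\<lambda>x. a * f (s *\<^sub>R x))"
  unfolding rapidly_decreasing_def
proof (intro conjI allI)
  have [measurable]: "f \<in> borel_measurable borel" by (rule rapidly_decreasing_measurable[OF f])
  show "(\<lambda>x. a * f (s *\<^sub>R x)) \<in> borel_measurable borel" by measurable
  fix m
  obtain C where C: "\<And>x. (1 + norm x) ^ m * norm (f x) \<le> C"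
    using rapidly_decreasing_bound[OF f] by blast
  have "(1 + norm x) ^ m * norm (a * f (s *\<^sub>R x)) \<le> (1 + 1 / s) ^ m * norm a * C" for x
  proof -
    have "1 + norm x \<le> (1 + 1 / s) * (1 + norm (s *\<^sub>R x))"
      using s by (simp add: field_simps)
    then have "(1 + norm x) ^ m \<le> (1 + 1 / s) ^ m * (1 + norm (s *\<^sub>R x)) ^ m"
      by (metis power_mono power_mult_distrib add_nonneg_nonneg norm_ge_zero zero_le_one)
    then have "(1 + norm x) ^ m * norm (a * f (s *\<^sub>R x))
        \<le> (1 + 1 / s) ^ m * norm a * ((1 + norm (s *\<^sub>R x)) ^ m * norm (f (s *\<^sub>R x)))"
      using mult_right_mono[of _ _ "norm (a * f (s *\<^sub>R x))"] by (fastforce simp: norm_mult mult_ac)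
    also have "\<dots> \<le> (1 + 1 / s) ^ m * norm a * C"
      using s by (intro mult_left_mono C) auto
    finally show ?thesis .
  qed
  then show "\<exists>C. \<forall>x. (1 + norm x) ^ m * norm (a * f (s *\<^sub>R x)) \<le> C" by blast
qed


section \<open>Schwartz functions\<close>

lemma mixed_partial_append: "mixed_partial (us @ vs) f = mixed_partial us (mixed_partial vs f)"
  by (induction us) auto

lemma schwartz_mixed_partial:
  assumes "schwartz f" "vs \<in> lists Basis"
  shows "schwartz (mixed_partial vs f)"
proof -
  have "us @ vs \<in> lists Basis" if "us \<in> lists Basis" for us using that assms(2) by simp
  then show ?thesis
    using assms(1) unfolding schwartz_def smooth_def by (metis mixed_partial_append)
qed

lemma schwartz_has_derivative:
  "schwartz f \<Longrightarrow> (f has_derivative frechet_derivative f (at x)) (at x)"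
  unfolding schwartz_def smooth_def
  by (metis frechet_derivative_works lists.Nil mixed_partial.simps(1))

lemma schwartz_continuous: "schwartz f \<Longrightarrow> continuous_on UNIV f"
  by (meson schwartz_has_derivative has_derivative_continuous continuous_at_imp_continuous_on)

lemma schwartz_rapidly_decreasing:
  assumes f: "schwartz f"
  shows "rapidly_decreasing f"
  unfolding rapidly_decreasing_def
proof (intro conjI allI)
  show "f \<in> borel_measurable borel"
    using schwartz_continuous[OF f] by (rule borel_measurable_continuous_onI)
  fix m
  have "bounded (range (\<lambda>x. (1 + norm x) ^ m *\<^sub>R f x))"
    using f unfolding schwartz_def by (metis lists.Nil mixed_partial.simps(1))
  then show "\<exists>C. \<forall>x. (1 + norm x) ^ m * norm (f x) \<le> C"
    by (auto simp: bounded_iff)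
qed

lemma schwartz_measurable: "schwartz f \<Longrightarrow> f \<in> borel_measurable borel"
  by (intro rapidly_decreasing_measurable schwartz_rapidly_decreasing)

lemma schwartz_integrable: "schwartz f \<Longrightarrow> integrable lborel f"
  by (intro rapidly_decreasing_integrable schwartz_rapidly_decreasing)

lemma schwartz_bounded:
  assumes "schwartz f"
  obtains C where "0 \<le> C" "\<And>x. norm (f x) \<le> C"
  using rapidly_decreasing_bounded[OF schwartz_rapidly_decreasing[OF assms]] by blast

lemma schwartz_partial:
  "schwartz f \<Longrightarrow> v \<in> Basis \<Longrightarrow> schwartz (\<lambda>x. frechet_derivative f (at x) v)"
  using schwartz_mixed_partial[of f "[v]"] by simp

lemma schwartz_frechet_derivative_eq_sum:
  fixes f :: "'a::euclidean_space \<Rightarrow> complex"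
  assumes "schwartz f"
  shows "frechet_derivative f (at x) h = (\<Sum>v\<in>Basis. (h \<bullet> v) *\<^sub>R frechet_derivative f (at x) v)"
proof -
  have lin: "linear (frechet_derivative f (at x))"
    using schwartz_has_derivative[OF assms] by (rule has_derivative_linear)
  have "frechet_derivative f (at x) h = frechet_derivative f (at x) (\<Sum>v\<in>Basis. (h \<bullet> v) *\<^sub>R v)"
    by (simp add: euclidean_representation)
  then show ?thesis by (simp add: linear_sum[OF lin] linear_scale[OF lin])
qed

lemma schwartz_frechet_derivative_measurable:
  fixes f :: "'a::euclidean_space \<Rightarrow> complex"
  assumes "schwartz f"
  shows "(\<lambda>x. frechet_derivative f (at x) h) \<in> borel_measurable borel"
  unfolding schwartz_frechet_derivative_eq_sum[OF assms, of _ h]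
  by (intro borel_measurable_sum borel_measurable_scaleR borel_measurable_const schwartz_measurable
      schwartz_partial assms)

lemma schwartz_frechet_derivative_bounded:
  fixes f :: "'a::euclidean_space \<Rightarrow> complex"
  assumes f: "schwartz f"
  obtains C where "0 \<le> C" "\<And>x h. norm (frechet_derivative f (at x) h) \<le> C * norm h"
proof -
  have "\<exists>C\<ge>0. \<forall>x. norm (frechet_derivative f (at x) v) \<le> C" if "v \<in> Basis" for v
    using schwartz_bounded[OF schwartz_partial[OF f that]] by metis
  then obtain C where C: "\<And>v. v \<in> Basis \<Longrightarrow> 0 \<le> C v"
    "\<And>v x. v \<in> Basis \<Longrightarrow> norm (frechet_derivative f (at x) v) \<le> C v"
    by metis
  show ?thesis
  proof (rule that)
    show "0 \<le> (\<Sum>v\<in>Basis. C v)" by (intro sum_nonneg C)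
    fix x h
    have "norm (frechet_derivative f (at x) h) \<le> (\<Sum>v\<in>Basis. C v * norm h)"
      unfolding schwartz_frechet_derivative_eq_sum[OF f, of x h]
    proof (rule sum_norm_le)
      fix v :: 'a assume v: "v \<in> Basis"
      show "norm ((h \<bullet> v) *\<^sub>R frechet_derivative f (at x) v) \<le> C v * norm h"
        using mult_mono[OF Basis_le_norm[OF v] C(2)[OF v]] by (simp add: mult.commute)
    qed
    then show "norm (frechet_derivative f (at x) h) \<le> (\<Sum>v\<in>Basis. C v) * norm h"
      by (simp add: sum_distrib_right)
  qed
qed


section \<open>The Fourier transform\<close>

definition phase :: "real \<Rightarrow> complex" where
  "phase r = exp (2 * pi * \<i> * complex_of_real r)"

lemma norm_phase [simp]: "norm (phase r) = 1"
  using norm_exp_i_times[of "2 * pi * r"] by (simp add: phase_def mult_ac)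

lemma phase_zero [simp]: "phase 0 = 1"
  by (simp add: phase_def)

lemma phase_add: "phase (r + s) = phase r * phase s"
  by (simp add: phase_def distrib_left exp_add)

lemma phase_measurable [measurable]: "phase \<in> borel_measurable borel"
  unfolding phase_def[abs_def] by measurable

lemma inv_fourier_eq: "inv_fourier f x = (\<integral>\<xi>. phase (x \<bullet> \<xi>) * f \<xi> \<partial>lborel)"
  by (simp add: inv_fourier_def phase_def)

lemma fourier_eq_inv_fourier: "fourier f \<xi> = inv_fourier f (- \<xi>)"
  by (simp add: fourier_def inv_fourier_def inner_commute)

lemma integrable_phase_mult:
  assumes "integrable M f" "r \<in> borel_measurable M"
  shows "integrable M (\<lambda>x. phase (r x) * f x)"
  using assms by (intro Bochner_Integration.integrable_bound[OF assms(1)]) (auto simp: norm_mult)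

lemma norm_inv_fourier_le: "norm (inv_fourier f x) \<le> (\<integral>\<xi>. norm (f \<xi>) \<partial>lborel)"
  unfolding inv_fourier_eq by (rule order_trans[OF integral_norm_bound]) (simp add: norm_mult)

lemma inv_fourier_measurable:
  assumes [measurable]: "f \<in> borel_measurable borel"
  shows "inv_fourier f \<in> borel_measurable borel"
  unfolding inv_fourier_eq[abs_def] by (rule lborel.borel_measurable_lebesgue_integral) measurable

lemma inv_fourier_phase_mult: "inv_fourier (\<lambda>\<xi>. phase (y \<bullet> \<xi>) * f \<xi>) x = inv_fourier f (x + y)"
  by (simp add: inv_fourier_eq inner_add_left phase_add mult.assoc)

lemma inv_fourier_dilate:
  fixes f :: "'a::euclidean_space \<Rightarrow> complex"
  assumes [measurable]: "f \<in> borel_measurable borel" and s: "0 < s"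
  shows "inv_fourier (\<lambda>\<xi>. complex_of_real (s ^ DIM('a)) * f (s *\<^sub>R \<xi>)) x = inv_fourier f ((1 / s) *\<^sub>R x)"
proof -
  have "inv_fourier f ((1 / s) *\<^sub>R x)
      = \<bar>s\<bar> ^ DIM('a) *\<^sub>R (\<integral>\<xi>. phase ((1 / s) *\<^sub>R x \<bullet> (0 + s *\<^sub>R \<xi>)) * f (0 + s *\<^sub>R \<xi>) \<partial>lborel)"
    unfolding inv_fourier_eq using s by (intro lborel_integral_affine) auto
  also have "\<dots> = inv_fourier (\<lambda>\<xi>. complex_of_real (s ^ DIM('a)) * f (s *\<^sub>R \<xi>)) x"
    unfolding inv_fourier_eq integral_scaleR_right[symmetric] using s
    by (intro Bochner_Integration.integral_cong) (simp_all add: scaleR_conv_of_real mult_ac)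
  finally show ?thesis by simp
qed

lemma inv_fourier_sum:
  assumes "\<And>j. j \<in> J \<Longrightarrow> integrable lborel (f j)"
  shows "inv_fourier (\<lambda>\<xi>. \<Sum>j\<in>J. f j \<xi>) x = (\<Sum>j\<in>J. inv_fourier (f j) x)"
  using integrable_phase_mult[OF assms] by (simp add: inv_fourier_eq sum_distrib_left integral_sum)

lemma integral_inv_fourier_mult:
  fixes f g :: "'a::euclidean_space \<Rightarrow> complex"
  assumes f: "integrable lborel f" and g: "integrable lborel g"
  shows "(\<integral>x. inv_fourier f x * g x \<partial>lborel) = (\<integral>\<xi>. f \<xi> * inv_fourier g \<xi> \<partial>lborel)"
proof -
  have [measurable]: "f \<in> borel_measurable borel" "g \<in> borel_measurable borel" using f g by auto
  have "(\<integral>x. inv_fourier f x * g x \<partial>lborel) = (\<integral>x. \<integral>\<xi>. phase (x \<bullet> \<xi>) * f \<xi> * g x \<partial>lborel \<partial>lborel)"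
    by (simp add: inv_fourier_eq)
  also have "\<dots> = (\<integral>\<xi>. \<integral>x. phase (x \<bullet> \<xi>) * f \<xi> * g x \<partial>lborel \<partial>lborel)"
  proof (rule lborel_pair.Fubini_integral[symmetric], rule integrable_lborel_pairI)
    have "(\<integral>\<^sup>+x. \<integral>\<^sup>+\<xi>. ennreal (norm (phase (x \<bullet> \<xi>) * f \<xi> * g x)) \<partial>lborel \<partial>lborel)
        = (\<integral>\<^sup>+\<xi>. ennreal (norm (f \<xi>)) \<partial>lborel) * (\<integral>\<^sup>+x. ennreal (norm (g x)) \<partial>lborel)"
      by (simp add: norm_mult ennreal_mult nn_integral_cmult nn_integral_multc)
    also have "\<dots> < \<infinity>"
      using f g by (simp add: integrable_iff_bounded ennreal_mult_less_top)
    finally show "(\<integral>\<^sup>+x. \<integral>\<^sup>+\<xi>. ennreal (norm (phase (x \<bullet> \<xi>) * f \<xi> * g x)) \<partial>lborel \<partial>lborel) < \<infinity>" .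
  qed measurable
  also have "\<dots> = (\<integral>\<xi>. f \<xi> * inv_fourier g \<xi> \<partial>lborel)"
  proof (rule Bochner_Integration.integral_cong[OF refl])
    fix \<xi>
    have "(\<integral>x. phase (x \<bullet> \<xi>) * f \<xi> * g x \<partial>lborel) = (\<integral>x. f \<xi> * (phase (\<xi> \<bullet> x) * g x) \<partial>lborel)"
      by (simp add: mult_ac inner_commute)
    then show "(\<integral>x. phase (x \<bullet> \<xi>) * f \<xi> * g x \<partial>lborel) = f \<xi> * inv_fourier g \<xi>"
      by (simp add: inv_fourier_eq)
  qed
  finally show ?thesis .
qed


subsection \<open>Derivatives\<close>

text \<open>By the fundamental theorem of calculus along \<open>v\<close> and Fubini, the integral of the derivative is
  \<open>\<integral> (f (x + v) - f x) dx\<close>, which vanishes by translation invariance.\<close>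

lemma integral_directional_derivative_eq_0:
  fixes f D :: "'a::euclidean_space \<Rightarrow> 'b::euclidean_space"
  assumes f: "integrable lborel f" and D: "integrable lborel D" "continuous_on UNIV D"
    and deriv: "\<And>x. (f has_derivative f' x) (at x)" "\<And>x. f' x v = D x"
  shows "(\<integral>x. D x \<partial>lborel) = 0"
proof -
  have [measurable]: "f \<in> borel_measurable borel" "D \<in> borel_measurable borel" using f D by auto
  have translate: "(\<integral>\<^sup>+x. ennreal (norm (D (x + s *\<^sub>R v))) \<partial>lborel) = (\<integral>\<^sup>+x. ennreal (norm (D x)) \<partial>lborel)" for s
    using nn_integral_lborel_affine[of "\<lambda>x. ennreal (norm (D x))" 1 "s *\<^sub>R v"] by (simp add: add.commute)
  have "(\<integral>x. D (x + s *\<^sub>R v) \<partial>lborel) = (\<integral>x. D x \<partial>lborel)" for s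
    using lborel_integral_translate[of D "s *\<^sub>R v"] by (simp add: add.commute)
  then have "(\<integral>x. D x \<partial>lborel) = (\<integral>s. \<integral>x. indicator {0..1} s *\<^sub>R D (x + s *\<^sub>R v) \<partial>lborel \<partial>lborel)"
    by (simp add: integral_scaleR_left)
  also have "\<dots> = (\<integral>x. \<integral>s. indicator {0..1::real} s *\<^sub>R D (x + s *\<^sub>R v) \<partial>lborel \<partial>lborel)"
  proof (rule lborel_pair.Fubini_integral[symmetric], rule integrable_lborel_pairI)
    have "(\<integral>\<^sup>+s. \<integral>\<^sup>+x. ennreal (norm (indicator {0..1::real} s *\<^sub>R D (x + s *\<^sub>R v))) \<partial>lborel \<partial>lborel)
        = (\<integral>\<^sup>+s. indicator {0..1::real} s * (\<integral>\<^sup>+x. ennreal (norm (D x)) \<partial>lborel) \<partial>lborel)"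
      by (simp add: ennreal_mult nn_integral_cmult translate ennreal_indicator)
    also have "\<dots> = (\<integral>\<^sup>+x. ennreal (norm (D x)) \<partial>lborel)"
      by (simp add: nn_integral_multc)
    finally show "(\<integral>\<^sup>+s. \<integral>\<^sup>+x. ennreal (norm (indicator {0..1::real} s *\<^sub>R D (x + s *\<^sub>R v))) \<partial>lborel \<partial>lborel) < \<infinity>"
      using D(1) by (simp add: integrable_iff_bounded)
  qed measurable
  also have "\<dots> = (\<integral>x. f (x + v) - f x \<partial>lborel)"
  proof (rule Bochner_Integration.integral_cong[OF refl])
    fix x
    have "((\<lambda>s. f (x + s *\<^sub>R v)) has_vector_derivative D (x + s *\<^sub>R v)) (at s within {0..1})" for s
    proof -
      have "((\<lambda>s. f (x + s *\<^sub>R v)) has_derivative (\<lambda>h. f' (x + s *\<^sub>R v) (h *\<^sub>R v))) (at s within {0..1})"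
        by (rule has_derivative_compose[OF _ deriv(1)]) (auto intro!: derivative_eq_intros)
      then show ?thesis
        by (simp add: has_vector_derivative_def linear_scale[OF has_derivative_linear[OF deriv(1)]] deriv(2))
    qed
    moreover have "continuous_on {0..1} (\<lambda>s. D (x + s *\<^sub>R v))"
      by (intro continuous_on_compose2[OF D(2)] continuous_intros) auto
    ultimately show "(\<integral>s. indicator {0..1::real} s *\<^sub>R D (x + s *\<^sub>R v) \<partial>lborel) = f (x + v) - f x"
      by (subst integral_FTC_Icc[where F = "\<lambda>s. f (x + s *\<^sub>R v)"]) auto
  qed
  also have "\<dots> = 0"
    using f integrable_lborel_affine[OF f, of 1 v] lborel_integral_translate[of f v]
    by (simp add: add.commute)
  finally show ?thesis .
qed

lemma phase_inner_has_derivative: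
  "((\<lambda>\<xi>. phase (x \<bullet> \<xi>)) has_derivative (\<lambda>h. (x \<bullet> h) *\<^sub>R (2 * pi * \<i> * phase (x \<bullet> \<xi>)))) (at \<xi>)"
proof -
  have "((\<lambda>\<xi>. 2 * pi * \<i> * complex_of_real (x \<bullet> \<xi>)) has_derivative
      (\<lambda>h. 2 * pi * \<i> * complex_of_real (x \<bullet> h))) (at \<xi>)"
    by (intro has_derivative_mult_right has_derivative_of_real has_derivative_inner_right has_derivative_ident)
  from has_derivative_compose[OF this DERIV_exp[unfolded has_field_derivative_def]] show ?thesis
    by (simp add: phase_def scaleR_conv_of_real mult_ac)
qed

lemma inv_fourier_partial:
  fixes f :: "'a::euclidean_space \<Rightarrow> complex"
  assumes f: "schwartz f" and v: "v \<in> Basis"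
  shows "inv_fourier (\<lambda>\<xi>. frechet_derivative f (at \<xi>) v) x = - (2 * pi * \<i> * (x \<bullet> v)) * inv_fourier f x"
proof -
  define g where "g \<xi> = frechet_derivative f (at \<xi>) v" for \<xi>
  define D where "D \<xi> = phase (x \<bullet> \<xi>) * g \<xi> + 2 * pi * \<i> * (x \<bullet> v) * (phase (x \<bullet> \<xi>) * f \<xi>)" for \<xi>
  have g: "schwartz g" unfolding g_def by (rule schwartz_partial[OF f v])
  have integrable: "integrable lborel (\<lambda>\<xi>. phase (x \<bullet> \<xi>) * h \<xi>)" if "schwartz h" for h
    by (intro integrable_phase_mult schwartz_integrable that) simp
  have "(\<integral>\<xi>. D \<xi> \<partial>lborel) = 0"
  proof (rule integral_directional_derivative_eq_0[where f = "\<lambda>\<xi>. phase (x \<bullet> \<xi>) * f \<xi>" and v = v])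
    show "integrable lborel (\<lambda>\<xi>. phase (x \<bullet> \<xi>) * f \<xi>)" by (rule integrable[OF f])
    show "integrable lborel D"
      unfolding D_def by (intro Bochner_Integration.integrable_add integrable_mult_right integrable f g)
    show "continuous_on UNIV D"
      unfolding D_def phase_def by (intro continuous_intros schwartz_continuous f g)
    show "((\<lambda>\<xi>. phase (x \<bullet> \<xi>) * f \<xi>) has_derivative
        (\<lambda>h. phase (x \<bullet> \<xi>) * frechet_derivative f (at \<xi>) h
           + (x \<bullet> h) *\<^sub>R (2 * pi * \<i> * phase (x \<bullet> \<xi>)) * f \<xi>)) (at \<xi>)" for \<xi>
      by (intro has_derivative_mult phase_inner_has_derivative schwartz_has_derivative f)
    show "phase (x \<bullet> \<xi>) * frechet_derivative f (at \<xi>) v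
        + (x \<bullet> v) *\<^sub>R (2 * pi * \<i> * phase (x \<bullet> \<xi>)) * f \<xi> = D \<xi>" for \<xi>
      by (simp add: D_def g_def scaleR_conv_of_real mult_ac)
  qed
  moreover have "(\<integral>\<xi>. D \<xi> \<partial>lborel) = inv_fourier g x + 2 * pi * \<i> * (x \<bullet> v) * inv_fourier f x"
    unfolding D_def inv_fourier_eq using integrable[OF f] integrable[OF g]
    by (simp add: Bochner_Integration.integral_add)
  ultimately show ?thesis
    by (simp add: g_def[abs_def] add_eq_0_iff2)
qed

lemma inv_fourier_iterated_partial:
  assumes f: "schwartz f" and v: "v \<in> Basis"
  shows "inv_fourier (mixed_partial (replicate m v) f) x = (- (2 * pi * \<i> * (x \<bullet> v))) ^ m * inv_fourier f x"
proof (induction m)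
  case (Suc m)
  have "replicate m v \<in> lists Basis" using v by auto
  then have "schwartz (mixed_partial (replicate m v) f)" by (rule schwartz_mixed_partial[OF f])
  from inv_fourier_partial[OF this v] show ?case using Suc.IH by simp
qed simp

lemma one_plus_norm_power_le:
  fixes x :: "'a::euclidean_space"
  shows "(1 + norm x) ^ m \<le> (1 + DIM('a)) ^ m * (1 + (\<Sum>v\<in>Basis. \<bar>x \<bullet> v\<bar> ^ m))"
proof -
  obtain v where v: "v \<in> Basis" "\<And>w. w \<in> Basis \<Longrightarrow> \<bar>x \<bullet> w\<bar> \<le> \<bar>x \<bullet> v\<bar>"
    using finite_Basis nonempty_Basis obtains_MAX[of Basis "\<lambda>w. \<bar>x \<bullet> w\<bar>"]
    by (metis Max_ge finite_imageI imageI)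
  have "norm x \<le> (\<Sum>w\<in>Basis. \<bar>x \<bullet> w\<bar>)" by (rule norm_le_l1)
  also have "\<dots> \<le> real DIM('a) * \<bar>x \<bullet> v\<bar>" by (rule sum_bounded_above) (use v in auto)
  also have "\<dots> \<le> real DIM('a) * max 1 \<bar>x \<bullet> v\<bar>" by (intro mult_left_mono) auto
  finally have "1 + norm x \<le> (1 + real DIM('a)) * max 1 \<bar>x \<bullet> v\<bar>"
    by (simp add: distrib_right add_mono)
  then have "(1 + norm x) ^ m \<le> (1 + real DIM('a)) ^ m * max 1 \<bar>x \<bullet> v\<bar> ^ m"
    by (metis add_nonneg_nonneg norm_ge_zero power_mono power_mult_distrib zero_le_one)
  also have "max 1 \<bar>x \<bullet> v\<bar> ^ m \<le> 1 + \<bar>x \<bullet> v\<bar> ^ m" by (auto simp: max_def)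
  also have "\<dots> \<le> 1 + (\<Sum>v\<in>Basis. \<bar>x \<bullet> v\<bar> ^ m)"
    using v by (intro add_left_mono member_le_sum) auto
  finally show ?thesis by (simp add: mult_left_mono)
qed

lemma inv_fourier_rapidly_decreasing:
  fixes f :: "'a::euclidean_space \<Rightarrow> complex"
  assumes f: "schwartz f"
  shows "rapidly_decreasing (inv_fourier f)"
  unfolding rapidly_decreasing_def
proof (intro conjI allI)
  show "inv_fourier f \<in> borel_measurable borel"
    by (intro inv_fourier_measurable schwartz_measurable f)
  fix m
  define c where "c v = (\<integral>\<xi>. norm (mixed_partial (replicate m v) f \<xi>) \<partial>lborel)" for v
  define c\<^sub>0 where "c\<^sub>0 = (\<integral>\<xi>. norm (f \<xi>) \<partial>lborel)"
  have coordinate: "\<bar>x \<bullet> v\<bar> ^ m * norm (inv_fourier f x) \<le> c v" if v: "v \<in> Basis" for v x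
  proof -
    have "1 * \<bar>x \<bullet> v\<bar> \<le> (2 * pi) * \<bar>x \<bullet> v\<bar>"
      using pi_gt3 by (intro mult_right_mono) auto
    then have "\<bar>x \<bullet> v\<bar> ^ m * norm (inv_fourier f x) \<le> \<bar>2 * pi * (x \<bullet> v)\<bar> ^ m * norm (inv_fourier f x)"
      by (intro mult_right_mono power_mono) (auto simp: abs_mult)
    also have "\<dots> = norm (inv_fourier (mixed_partial (replicate m v) f) x)"
      by (simp add: inv_fourier_iterated_partial[OF f v] norm_mult norm_power abs_mult)
    also have "\<dots> \<le> c v" unfolding c_def by (rule norm_inv_fourier_le)
    finally show ?thesis .
  qed
  have "(1 + norm x) ^ m * norm (inv_fourier f x) \<le> (1 + DIM('a)) ^ m * (c\<^sub>0 + (\<Sum>v\<in>Basis. c v))" for x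
  proof -
    have "(1 + norm x) ^ m * norm (inv_fourier f x)
        \<le> (1 + DIM('a)) ^ m * (1 + (\<Sum>v\<in>Basis. \<bar>x \<bullet> v\<bar> ^ m)) * norm (inv_fourier f x)"
      by (intro mult_right_mono one_plus_norm_power_le) simp
    also have "\<dots> = (1 + DIM('a)) ^ m * (norm (inv_fourier f x) + (\<Sum>v\<in>Basis. \<bar>x \<bullet> v\<bar> ^ m * norm (inv_fourier f x)))"
      by (simp add: distrib_right sum_distrib_right)
    also have "\<dots> \<le> (1 + DIM('a)) ^ m * (c\<^sub>0 + (\<Sum>v\<in>Basis. c v))"
      by (intro mult_left_mono add_mono sum_mono coordinate) (auto simp: c\<^sub>0_def norm_inv_fourier_le)
    finally show ?thesis .
  qed
  then show "\<exists>C. \<forall>x. (1 + norm x) ^ m * norm (inv_fourier f x) \<le> C" by blast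
qed


subsection \<open>Fourier inversion by Gaussian summation\<close>

definition gaussian :: "'a::euclidean_space \<Rightarrow> complex" where
  "gaussian x = complex_of_real (exp (- pi * (norm x)\<^sup>2))"

lemma gaussian_measurable [measurable]: "gaussian \<in> borel_measurable borel"
  unfolding gaussian_def[abs_def] by measurable

lemma norm_gaussian_le: "norm (gaussian x) \<le> 1"
  by (simp add: gaussian_def)

lemma
  fixes z :: real
  shows integrable_gaussian_real: "integrable lborel (gaussian :: real \<Rightarrow> complex)"
    and inv_fourier_gaussian_real: "inv_fourier gaussian z = gaussian z"
proof -
  define c where "c = sqrt (2 * pi)"
  have c: "0 < c" "c\<^sup>2 = 2 * pi" by (simp_all add: c_def)
  define h where "h z x = iexp (c * z * x) * complex_of_real (std_normal_density x)" for z x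
  have h_integrable: "integrable lborel (h z)" for z
    unfolding h_def
    by (rule Bochner_Integration.integrable_bound[OF integrable_normal_density[of 1 0]])
      (auto simp: norm_mult simp del: of_real_mult)
  have h_dilate: "h z (0 + c * x) = complex_of_real (1 / c) * (phase (z * x) * gaussian x)" for z x
  proof -
    have "(c * x)\<^sup>2 / 2 = pi * x\<^sup>2" "c * z * (c * x) = 2 * pi * (z * x)"
      using c(2) by (simp_all add: power2_eq_square algebra_simps)
    then show ?thesis
      by (simp add: h_def phase_def gaussian_def std_normal_density_def c_def mult_ac)
  qed
  have "integrable lborel (\<lambda>x. complex_of_real c * h 0 (0 + c * x))"
    using c by (intro integrable_mult_right lborel_integrable_real_affine h_integrable) auto
  then show "integrable lborel (gaussian :: real \<Rightarrow> complex)"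
    unfolding h_dilate using c by simp
  have "complex_of_real (exp (- ((c * z)\<^sup>2) / 2)) = char std_normal_distribution (c * z)"
    by (simp add: char_std_normal_distribution)
  also have "\<dots> = (\<integral>x. h z x \<partial>lborel)"
    unfolding char_def h_def by (subst integral_density) (auto simp: scaleR_conv_of_real mult_ac)
  also have "\<dots> = c *\<^sub>R (\<integral>x. h z (0 + c * x) \<partial>lborel)"
    using lborel_integral_real_affine[of c "h z" 0] c by simp
  also have "\<dots> = inv_fourier gaussian z"
    unfolding h_dilate using c by (simp add: inv_fourier_eq scaleR_conv_of_real)
  finally show "inv_fourier gaussian z = gaussian z"
    using c by (simp add: gaussian_def power_mult_distrib)
qed

lemma gaussian_eq_prod: "gaussian x = (\<Prod>b\<in>Basis. gaussian (x \<bullet> b))"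
proof -
  have "(norm x)\<^sup>2 = (\<Sum>b\<in>Basis. (x \<bullet> b)\<^sup>2)"
    unfolding power2_norm_eq_inner by (subst euclidean_inner) (simp add: power2_eq_square)
  then have "exp (- pi * (norm x)\<^sup>2) = (\<Prod>b\<in>Basis. exp (- pi * (x \<bullet> b)\<^sup>2))"
    by (simp add: sum_distrib_left exp_sum flip: sum_negf)
  then show ?thesis by (simp add: gaussian_def)
qed

lemma phase_inner_eq_prod: "phase (x \<bullet> y) = (\<Prod>b\<in>Basis. phase ((x \<bullet> b) * (y \<bullet> b)))"
  unfolding phase_def by (subst euclidean_inner) (simp add: sum_distrib_left exp_sum)

lemma integrable_gaussian: "integrable lborel (gaussian :: 'a::euclidean_space \<Rightarrow> complex)"
proof -
  have eq_prod: "(gaussian :: 'a \<Rightarrow> complex) = (\<lambda>x. \<Prod>b\<in>Basis. gaussian (x \<bullet> b))"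
    by (rule ext) (rule gaussian_eq_prod)
  show ?thesis
    by (subst eq_prod) (intro integrable_lborel_prod integrable_gaussian_real)
qed

lemma inv_fourier_gaussian: "inv_fourier gaussian x = gaussian x"
proof -
  have "inv_fourier gaussian x = (\<integral>\<xi>. (\<Prod>b\<in>Basis. phase ((x \<bullet> b) \<bullet> (\<xi> \<bullet> b)) * gaussian (\<xi> \<bullet> b)) \<partial>lborel)"
    unfolding inv_fourier_eq by (simp add: phase_inner_eq_prod gaussian_eq_prod[of "_ :: 'a"] prod.distrib)
  also have "\<dots> = (\<Prod>b\<in>Basis. \<integral>s. phase ((x \<bullet> b) \<bullet> s) * gaussian s \<partial>lborel)"
    by (intro integral_lborel_prod integrable_phase_mult integrable_gaussian_real) simp
  also have "\<dots> = (\<Prod>b\<in>Basis. gaussian (x \<bullet> b))"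
    by (simp only: inv_fourier_gaussian_real flip: inv_fourier_eq)
  also have "\<dots> = gaussian x" by (rule gaussian_eq_prod[symmetric])
  finally show ?thesis .
qed

lemma integral_gaussian: "(\<integral>x. gaussian (x::'a::euclidean_space) \<partial>lborel) = 1"
  using inv_fourier_gaussian[of "0::'a"] by (simp add: inv_fourier_eq) (simp add: gaussian_def)

lemma integral_gaussian_cutoff_tendsto:
  fixes g :: "'a::euclidean_space \<Rightarrow> complex"
  assumes g: "integrable lborel g" and \<epsilon>: "\<epsilon> \<longlonglongrightarrow> 0"
  shows "(\<lambda>j. \<integral>x. g x * gaussian (\<epsilon> j *\<^sub>R x) \<partial>lborel) \<longlonglongrightarrow> (\<integral>x. g x \<partial>lborel)"
proof (rule integral_dominated_convergence)
  have [measurable]: "g \<in> borel_measurable borel" using g by auto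
  show "g \<in> borel_measurable lborel" "(\<lambda>x. g x * gaussian (\<epsilon> j *\<^sub>R x)) \<in> borel_measurable lborel" for j
    by measurable
  show "integrable lborel (\<lambda>x. norm (g x))" using g by simp
  show "AE x in lborel. norm (g x * gaussian (\<epsilon> j *\<^sub>R x)) \<le> norm (g x)" for j
    by (intro AE_I2) (simp add: norm_mult mult_left_le norm_gaussian_le)
  show "AE x in lborel. (\<lambda>j. g x * gaussian (\<epsilon> j *\<^sub>R x)) \<longlonglongrightarrow> g x"
  proof (intro AE_I2)
    fix x :: 'a
    have "(\<lambda>j. g x * gaussian (\<epsilon> j *\<^sub>R x)) \<longlonglongrightarrow> g x * complex_of_real (exp (- pi * (norm (0 *\<^sub>R x))\<^sup>2))"
      unfolding gaussian_def by (intro tendsto_intros \<epsilon>)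
    then show "(\<lambda>j. g x * gaussian (\<epsilon> j *\<^sub>R x)) \<longlonglongrightarrow> g x" by simp
  qed
qed

lemma integral_gaussian_average_tendsto:
  fixes f :: "'a::euclidean_space \<Rightarrow> complex"
  assumes [measurable]: "f \<in> borel_measurable borel" and bound: "\<And>x. norm (f x) \<le> C"
    and cont: "isCont f x" and \<epsilon>: "\<epsilon> \<longlonglongrightarrow> 0"
  shows "(\<lambda>j. \<integral>z. f (x + \<epsilon> j *\<^sub>R z) * gaussian z \<partial>lborel) \<longlonglongrightarrow> f x"
proof -
  have "(\<lambda>j. \<integral>z. f (x + \<epsilon> j *\<^sub>R z) * gaussian z \<partial>lborel) \<longlonglongrightarrow> (\<integral>z. f x * gaussian (z::'a) \<partial>lborel)"
  proof (rule integral_dominated_convergence)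
    show "integrable lborel (\<lambda>z::'a. C * norm (gaussian z))"
      by (intro integrable_mult_right integrable_norm integrable_gaussian)
    show "AE z in lborel. norm (f (x + \<epsilon> j *\<^sub>R z) * gaussian z) \<le> C * norm (gaussian z)" for j
      using bound by (intro AE_I2) (simp add: norm_mult mult_right_mono)
    show "AE z in lborel. (\<lambda>j. f (x + \<epsilon> j *\<^sub>R z) * gaussian z) \<longlonglongrightarrow> f x * gaussian z"
    proof (intro AE_I2 tendsto_mult tendsto_const isCont_tendsto_compose[OF cont])
      show "(\<lambda>j. x + \<epsilon> j *\<^sub>R z) \<longlonglongrightarrow> x" for z
        using \<epsilon> by (auto intro!: tendsto_eq_intros)
    qed
  qed measurable
  then show ?thesis by (simp add: integral_gaussian)
qed

lemma integral_inv_fourier_gaussian_cutoff: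
  fixes f :: "'a::euclidean_space \<Rightarrow> complex"
  assumes f: "integrable lborel f" and \<epsilon>: "0 < \<epsilon>"
  shows "(\<integral>x. phase (- (\<xi> \<bullet> x)) * inv_fourier f x * gaussian (\<epsilon> *\<^sub>R x) \<partial>lborel)
       = (\<integral>z. f (\<xi> + \<epsilon> *\<^sub>R z) * gaussian z \<partial>lborel)"
proof -
  define g where "g x = gaussian (\<epsilon> *\<^sub>R x)" for x :: 'a
  have [measurable]: "f \<in> borel_measurable borel" "g \<in> borel_measurable borel"
    using f unfolding g_def by auto
  have g: "integrable lborel g"
    using integrable_lborel_affine[OF integrable_gaussian, of \<epsilon> 0] \<epsilon> by (simp add: g_def[abs_def])
  have "complex_of_real (\<epsilon> ^ DIM('a)) * inv_fourier g \<eta> = gaussian ((1 / \<epsilon>) *\<^sub>R \<eta>)" for \<eta>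
  proof -
    have "complex_of_real (\<epsilon> ^ DIM('a)) * inv_fourier g \<eta>
        = inv_fourier (\<lambda>x. complex_of_real (\<epsilon> ^ DIM('a)) * gaussian (\<epsilon> *\<^sub>R x)) \<eta>"
      by (simp add: inv_fourier_eq g_def mult.left_commute[of "phase _"])
    then show ?thesis
      by (simp only: inv_fourier_dilate[OF gaussian_measurable \<epsilon>] inv_fourier_gaussian)
  qed
  then have inv_g: "\<epsilon> ^ DIM('a) *\<^sub>R inv_fourier g (\<epsilon> *\<^sub>R z) = gaussian z" for z
    using \<epsilon> by (simp add: scaleR_conv_of_real)
  have "(\<integral>x. phase (- (\<xi> \<bullet> x)) * inv_fourier f x * g x \<partial>lborel)
      = (\<integral>x. inv_fourier f x * (phase (- (\<xi> \<bullet> x)) * g x) \<partial>lborel)"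
    by (simp add: mult_ac)
  also have "\<dots> = (\<integral>\<eta>. f \<eta> * inv_fourier (\<lambda>x. phase (- (\<xi> \<bullet> x)) * g x) \<eta> \<partial>lborel)"
    by (intro integral_inv_fourier_mult f integrable_phase_mult g) measurable
  also have "\<dots> = (\<integral>\<eta>. f \<eta> * inv_fourier g (\<eta> - \<xi>) \<partial>lborel)"
    using inv_fourier_phase_mult[of "- \<xi>" g] by simp
  also have "\<dots> = \<epsilon> ^ DIM('a) *\<^sub>R (\<integral>z. f (\<xi> + \<epsilon> *\<^sub>R z) * inv_fourier g (\<xi> + \<epsilon> *\<^sub>R z - \<xi>) \<partial>lborel)"
    using \<epsilon> inv_fourier_measurable[of g] by (subst lborel_integral_affine[of _ \<epsilon> \<xi>]) auto
  also have "\<dots> = (\<integral>z. f (\<xi> + \<epsilon> *\<^sub>R z) * gaussian z \<partial>lborel)"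
    unfolding integral_scaleR_right[symmetric] by (simp add: inv_g flip: mult_scaleR_right)
  finally show ?thesis by (simp add: g_def)
qed

lemma fourier_inv_fourier:
  fixes f :: "'a::euclidean_space \<Rightarrow> complex"
  assumes f: "integrable lborel f" "integrable lborel (inv_fourier f)"
    and bound: "\<And>x. norm (f x) \<le> C" and cont: "isCont f \<xi>"
  shows "fourier (inv_fourier f) \<xi> = f \<xi>"
proof -
  define \<epsilon> where "\<epsilon> j = 1 / real (Suc j)" for j
  have \<epsilon>: "\<epsilon> \<longlonglongrightarrow> 0" unfolding \<epsilon>_def by (rule LIMSEQ_Suc[OF lim_1_over_n])
  have "integrable lborel (\<lambda>x. phase (- (\<xi> \<bullet> x)) * inv_fourier f x)"
    by (intro integrable_phase_mult f) measurable
  then have "(\<lambda>j. \<integral>x. phase (- (\<xi> \<bullet> x)) * inv_fourier f x * gaussian (\<epsilon> j *\<^sub>R x) \<partial>lborel)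
      \<longlonglongrightarrow> fourier (inv_fourier f) \<xi>"
    unfolding fourier_eq_inv_fourier inv_fourier_eq[of "inv_fourier f"] inner_minus_left
    by (rule integral_gaussian_cutoff_tendsto[OF _ \<epsilon>])
  moreover have "(\<lambda>j. \<integral>x. phase (- (\<xi> \<bullet> x)) * inv_fourier f x * gaussian (\<epsilon> j *\<^sub>R x) \<partial>lborel) \<longlonglongrightarrow> f \<xi>"
    using integral_gaussian_average_tendsto[OF _ bound cont \<epsilon>] f(1)
    by (simp add: integral_inv_fourier_gaussian_cutoff \<epsilon>_def)
  ultimately show ?thesis by (rule LIMSEQ_unique)
qed

lemma schwartz_fourier_inv_fourier:
  assumes f: "schwartz f"
  shows "fourier (inv_fourier f) \<xi> = f \<xi>"
proof -
  obtain C where "\<And>x. norm (f x) \<le> C" using schwartz_bounded[OF f] by blast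
  moreover have "isCont f \<xi>"
    using schwartz_continuous[OF f] by (simp add: continuous_on_eq_continuous_at)
  ultimately show ?thesis
    by (intro fourier_inv_fourier schwartz_integrable rapidly_decreasing_integrable
        inv_fourier_rapidly_decreasing f)
qed


section \<open>Correlations\<close>

definition correlation :: "('a::euclidean_space \<Rightarrow> complex) \<Rightarrow> ('a \<Rightarrow> complex) \<Rightarrow> 'a \<Rightarrow> complex" where
  "correlation K \<psi> y = (\<integral>z. K z * \<psi> (y + z) \<partial>lborel)"

lemma correlation_integrable:
  fixes K f :: "'a::euclidean_space \<Rightarrow> complex"
  assumes K: "integrable lborel K" and f: "rapidly_decreasing f"
  shows "integrable lborel (\<lambda>z. K z * f (y + z))"
proof -
  have [measurable]: "K \<in> borel_measurable borel" "f \<in> borel_measurable borel"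
    using K rapidly_decreasing_measurable[OF f] by auto
  obtain C where C: "0 \<le> C" "\<And>x. norm (f x) \<le> C" using rapidly_decreasing_bounded[OF f] by blast
  show ?thesis
  proof (rule Bochner_Integration.integrable_bound)
    show "integrable lborel (\<lambda>z. C * norm (K z))" using K by simp
    show "AE z in lborel. norm (K z * f (y + z)) \<le> norm (C * norm (K z))"
      using C by (intro AE_I2) (simp add: norm_mult mult.commute[of C] mult_left_mono)
  qed measurable
qed

lemma peetre_inequality:
  fixes y z :: "'a::real_normed_vector"
  shows "(1 + norm y) ^ m \<le> (1 + norm (y + z)) ^ m * (1 + norm z) ^ m"
proof -
  have "norm y \<le> norm (y + z) + norm z" by (metis norm_triangle_ineq4 add_diff_cancel_right')
  then have "1 + norm y \<le> (1 + norm (y + z)) * (1 + norm z)"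
    using mult_nonneg_nonneg[OF norm_ge_zero[of "y + z"] norm_ge_zero[of z]] by argo
  then show ?thesis
    by (metis power_mono power_mult_distrib add_nonneg_nonneg norm_ge_zero zero_le_one)
qed

lemma rapidly_decreasing_correlation:
  assumes K: "rapidly_decreasing K" and f: "rapidly_decreasing f"
  shows "rapidly_decreasing (correlation K f)"
  unfolding rapidly_decreasing_def
proof (intro conjI allI)
  note [measurable] = rapidly_decreasing_measurable[OF K] rapidly_decreasing_measurable[OF f]
  show "correlation K f \<in> borel_measurable borel"
    unfolding correlation_def[abs_def] by (rule lborel.borel_measurable_lebesgue_integral) measurable
  fix m
  obtain C where C: "\<And>x. (1 + norm x) ^ m * norm (f x) \<le> C"
    using rapidly_decreasing_bound[OF f] by blast
  have weight: "(1 + norm y) ^ m * (norm (K z) * norm (f (y + z))) \<le> C * ((1 + norm z) ^ m * norm (K z))" for y z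
  proof -
    have "(1 + norm y) ^ m * (norm (K z) * norm (f (y + z)))
        \<le> ((1 + norm (y + z)) ^ m * (1 + norm z) ^ m) * (norm (K z) * norm (f (y + z)))"
      by (intro mult_right_mono peetre_inequality) simp
    also have "\<dots> = ((1 + norm z) ^ m * norm (K z)) * ((1 + norm (y + z)) ^ m * norm (f (y + z)))"
      by (simp add: mult_ac)
    also have "\<dots> \<le> ((1 + norm z) ^ m * norm (K z)) * C" by (intro mult_left_mono C) auto
    finally show ?thesis by (simp add: mult_ac)
  qed
  have "(1 + norm y) ^ m * norm (correlation K f y) \<le> (\<integral>z. C * ((1 + norm z) ^ m * norm (K z)) \<partial>lborel)" for y
  proof -
    have "norm (\<integral>z. (1 + norm y) ^ m *\<^sub>R (K z * f (y + z)) \<partial>lborel)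
        \<le> (\<integral>z. C * ((1 + norm z) ^ m * norm (K z)) \<partial>lborel)"
    proof (rule Bochner_Integration.integral_norm_bound_integral)
      show "integrable lborel (\<lambda>z. (1 + norm y) ^ m *\<^sub>R (K z * f (y + z)))"
        using correlation_integrable[OF rapidly_decreasing_integrable[OF K] f] by simp
      show "integrable lborel (\<lambda>z. C * ((1 + norm z) ^ m * norm (K z)))"
        using rapidly_decreasing_integrable_moment[OF K] by simp
    qed (use weight in \<open>simp add: norm_mult\<close>)
    then show ?thesis by (simp add: correlation_def)
  qed
  then show "\<exists>C. \<forall>y. (1 + norm y) ^ m * norm (correlation K f y) \<le> C" by blast
qed

lemma correlation_has_derivative:
  fixes K \<psi> :: "'a::euclidean_space \<Rightarrow> complex"
  assumes K: "integrable lborel K" and \<psi>: "schwartz \<psi>"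
  shows "(correlation K \<psi> has_derivative (\<lambda>h. correlation K (\<lambda>x. frechet_derivative \<psi> (at x) h) y)) (at y)"
proof -
  have [measurable]: "K \<in> borel_measurable borel" using K by auto
  note [measurable] = schwartz_frechet_derivative_measurable[OF \<psi>]
  obtain C where C: "0 \<le> C" "\<And>x h. norm (frechet_derivative \<psi> (at x) h) \<le> C * norm h"
    using schwartz_frechet_derivative_bounded[OF \<psi>] by blast
  show ?thesis
    unfolding correlation_def[abs_def]
  proof (rule has_derivative_lebesgue_integral)
    show "integrable lborel (\<lambda>z. K z * \<psi> (y + z))" for y
      by (rule correlation_integrable[OF K schwartz_rapidly_decreasing[OF \<psi>]])
    have "((\<lambda>y. \<psi> (y + z)) has_derivative frechet_derivative \<psi> (at (y + z))) (at y)" for y z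
      using has_derivative_compose[OF has_derivative_add_const[OF has_derivative_ident] schwartz_has_derivative[OF \<psi>]] .
    then show "((\<lambda>y. K z * \<psi> (y + z)) has_derivative (\<lambda>h. K z * frechet_derivative \<psi> (at (y + z)) h)) (at y)" for z y
      by (rule has_derivative_mult_right)
    show "norm (K z * frechet_derivative \<psi> (at (y + z)) h) \<le> C * norm (K z) * norm h" for z y h
      using mult_left_mono[OF C(2), of "norm (K z)"] by (simp add: norm_mult mult_ac)
    show "integrable lborel (\<lambda>z. C * norm (K z))" using K by simp
  qed measurable
qed

lemma mixed_partial_correlation:
  assumes K: "integrable lborel K" and \<psi>: "schwartz \<psi>" and "vs \<in> lists Basis"
  shows "mixed_partial vs (correlation K \<psi>) = correlation K (mixed_partial vs \<psi>)"
  using assms(3)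
proof (induction vs)
  case (Cons v vs)
  have IH: "mixed_partial vs (correlation K \<psi>) = correlation K (mixed_partial vs \<psi>)"
    using Cons by simp
  have "schwartz (mixed_partial vs \<psi>)" using Cons by (intro schwartz_mixed_partial \<psi>) auto
  from frechet_derivative_at[OF correlation_has_derivative[OF K this], symmetric] show ?case
    by (simp add: IH)
qed simp

lemma schwartz_correlation:
  fixes K \<psi> :: "'a::euclidean_space \<Rightarrow> complex"
  assumes K: "rapidly_decreasing K" and \<psi>: "schwartz \<psi>"
  shows "schwartz (correlation K \<psi>)"
  unfolding schwartz_def smooth_def
proof (intro conjI ballI allI)
  note K_integrable = rapidly_decreasing_integrable[OF K]
  fix vs :: "'a list" assume vs: "vs \<in> lists Basis"
  note partial_eq = mixed_partial_correlation[OF K_integrable \<psi> vs]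
  have partial: "schwartz (mixed_partial vs \<psi>)" by (rule schwartz_mixed_partial[OF \<psi> vs])
  show "mixed_partial vs (correlation K \<psi>) differentiable at x" for x
    unfolding partial_eq differentiable_def using correlation_has_derivative[OF K_integrable partial] by blast
  fix m
  obtain C where "\<And>y. (1 + norm y) ^ m * norm (correlation K (mixed_partial vs \<psi>) y) \<le> C"
    using rapidly_decreasing_bound[OF rapidly_decreasing_correlation[OF K schwartz_rapidly_decreasing[OF partial]]]
    by blast
  then show "bounded (range (\<lambda>x. (1 + norm x) ^ m *\<^sub>R mixed_partial vs (correlation K \<psi>) x))"
    unfolding partial_eq bounded_iff by auto
qed

lemma inv_fourier_translate:
  assumes [measurable]: "f \<in> borel_measurable borel"
  shows "inv_fourier (\<lambda>\<xi>. f (\<xi> + z)) x = phase (- (x \<bullet> z)) * inv_fourier f x"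
proof -
  have "inv_fourier (\<lambda>\<xi>. f (\<xi> + z)) x = (\<integral>\<xi>. phase (- (x \<bullet> z)) * (phase (x \<bullet> (z + \<xi>)) * f (z + \<xi>)) \<partial>lborel)"
    by (simp add: inv_fourier_eq inner_add_right add.commute flip: mult.assoc phase_add)
  also have "\<dots> = (\<integral>\<xi>. phase (- (x \<bullet> z)) * (phase (x \<bullet> \<xi>) * f \<xi>) \<partial>lborel)"
    by (rule lborel_integral_translate[of "\<lambda>\<xi>. phase (- (x \<bullet> z)) * (phase (x \<bullet> \<xi>) * f \<xi>)"]) measurable
  finally show ?thesis by (simp add: inv_fourier_eq)
qed

lemma inv_fourier_correlation:
  fixes K \<psi> :: "'a::euclidean_space \<Rightarrow> complex"
  assumes K: "integrable lborel K" and \<psi>: "integrable lborel \<psi>"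
  shows "inv_fourier (correlation K \<psi>) \<xi> = fourier K \<xi> * inv_fourier \<psi> \<xi>"
proof -
  have [measurable]: "K \<in> borel_measurable borel" "\<psi> \<in> borel_measurable borel" using K \<psi> by auto
  have "inv_fourier (correlation K \<psi>) \<xi> = (\<integral>y. \<integral>z. K z * (phase (\<xi> \<bullet> y) * \<psi> (y + z)) \<partial>lborel \<partial>lborel)"
    by (simp add: inv_fourier_eq correlation_def mult.left_commute[of "phase _"] flip: integral_mult_right_zero)
  also have "\<dots> = (\<integral>z. \<integral>y. K z * (phase (\<xi> \<bullet> y) * \<psi> (y + z)) \<partial>lborel \<partial>lborel)"
  proof (rule lborel_pair.Fubini_integral, rule integrable_lborel_pairI)
    have "(\<integral>\<^sup>+y. ennreal (norm (\<psi> (y + z))) \<partial>lborel) = (\<integral>\<^sup>+y. ennreal (norm (\<psi> y)) \<partial>lborel)" for z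
      using nn_integral_lborel_affine[of "\<lambda>y. ennreal (norm (\<psi> y))" 1 z] by (simp add: add.commute)
    then have "(\<integral>\<^sup>+z. \<integral>\<^sup>+y. ennreal (norm (K z * (phase (\<xi> \<bullet> y) * \<psi> (y + z)))) \<partial>lborel \<partial>lborel)
        = (\<integral>\<^sup>+z. ennreal (norm (K z)) \<partial>lborel) * (\<integral>\<^sup>+y. ennreal (norm (\<psi> y)) \<partial>lborel)"
      by (simp add: norm_mult ennreal_mult nn_integral_cmult nn_integral_multc)
    also have "\<dots> < \<infinity>"
      using K \<psi> by (simp add: integrable_iff_bounded ennreal_mult_less_top)
    finally show "(\<integral>\<^sup>+z. \<integral>\<^sup>+y. ennreal (norm (K z * (phase (\<xi> \<bullet> y) * \<psi> (y + z)))) \<partial>lborel \<partial>lborel) < \<infinity>" .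
  qed measurable
  also have "\<dots> = (\<integral>z. phase (- \<xi> \<bullet> z) * K z * inv_fourier \<psi> \<xi> \<partial>lborel)"
    by (simp add: inv_fourier_translate mult_ac flip: inv_fourier_eq)
  finally show ?thesis by (simp add: fourier_eq_inv_fourier inv_fourier_eq[of K])
qed


section \<open>Reproducing kernels of dyadic blocks\<close>

lemma dyadic_generator_support:
  assumes "dyadic_generator \<phi>" "\<phi> \<xi> \<noteq> 0"
  shows "1 / 2 \<le> norm \<xi>" "norm \<xi> \<le> 2"
  using assms closure_subset[of "{\<xi>. \<phi> \<xi> \<noteq> 0}"] unfolding dyadic_generator_def by blast+

lemma dyadic_generator_sum_eq_1:
  assumes \<phi>: "dyadic_generator \<phi>" and \<xi>: "\<phi> \<xi> \<noteq> 0"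
  shows "(\<Sum>k\<in>{-2..2::int}. \<phi> ((2 powi (- k)) *\<^sub>R \<xi>)) = 1"
proof -
  note \<xi>_norm = dyadic_generator_support[OF \<phi> \<xi>]
  then have "\<xi> \<noteq> 0" by auto
  then have "((\<lambda>k::int. \<phi> ((2 powi (- k)) *\<^sub>R \<xi>)) has_sum 1) UNIV"
    using \<phi> unfolding dyadic_generator_def by blast
  moreover have "k \<in> {-2..2}" if "\<phi> ((2 powi (- k)) *\<^sub>R \<xi>) \<noteq> 0" for k
  proof -
    have bounds: "1 / 2 \<le> 2 powi (- k) * norm \<xi>" "2 powi (- k) * norm \<xi> \<le> 2"
      using dyadic_generator_support[OF \<phi> that] by (auto simp: norm_power_int)
    have "2 powi (- k) * norm \<xi> \<le> 2 powi (- k) * 2" "2 powi (- k) * (1 / 2) \<le> 2 powi (- k) * norm \<xi>"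
      by (intro mult_left_mono \<xi>_norm; simp)+
    with bounds have le: "1 / 4 \<le> (2::real) powi (- k)" "(2::real) powi (- k) \<le> 4"
      by linarith+
    have "\<not> k \<le> -3"
    proof
      assume "k \<le> -3"
      then have "2 powi 3 \<le> (2::real) powi (- k)" by (intro power_int_increasing) auto
      with le show False by simp
    qed
    moreover have "\<not> 3 \<le> k"
    proof
      assume "3 \<le> k"
      then have "(2::real) powi (- k) \<le> 2 powi (-3)" by (intro power_int_increasing) auto
      with le show False by (simp add: power_int_minus)
    qed
    ultimately show ?thesis by simp
  qed
  ultimately have "((\<lambda>k::int. \<phi> ((2 powi (- k)) *\<^sub>R \<xi>)) has_sum 1) {-2..2}"
    by (subst has_sum_cong_neutral[where T = UNIV and g = "\<lambda>k::int. \<phi> ((2 powi (- k)) *\<^sub>R \<xi>)"]) auto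
  then show ?thesis by (simp add: has_sum_finite_iff)
qed

definition dyadic_dilate :: "int \<Rightarrow> ('a::euclidean_space \<Rightarrow> complex) \<Rightarrow> 'a \<Rightarrow> complex" where
  "dyadic_dilate k f x = complex_of_real ((2 powi k) ^ DIM('a)) * f ((2 powi k) *\<^sub>R x)"

lemma rapidly_decreasing_dyadic_dilate: "rapidly_decreasing f \<Longrightarrow> rapidly_decreasing (dyadic_dilate k f)"
  unfolding dyadic_dilate_def[abs_def] by (rule rapidly_decreasing_dilate) simp_all

lemma fourier_dyadic_dilate:
  "f \<in> borel_measurable borel \<Longrightarrow> fourier (dyadic_dilate k f) \<xi> = fourier f ((2 powi (- k)) *\<^sub>R \<xi>)"
  using inv_fourier_dilate[of f "2 powi k" "- \<xi>"]
  by (simp add: dyadic_dilate_def[abs_def] fourier_eq_inv_fourier power_int_minus_divide)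

lemma nn_integral_dyadic_dilate:
  fixes f :: "'a::euclidean_space \<Rightarrow> complex"
  assumes [measurable]: "f \<in> borel_measurable borel"
  shows "(\<integral>\<^sup>+x. ennreal (norm (dyadic_dilate k f x)) \<partial>lborel) = (\<integral>\<^sup>+x. ennreal (norm (f x)) \<partial>lborel)"
proof -
  have "(\<integral>\<^sup>+x. ennreal (norm (dyadic_dilate k f x)) \<partial>lborel)
      = ennreal ((2 powi k) ^ DIM('a)) * (\<integral>\<^sup>+x. ennreal (norm (f ((2 powi k) *\<^sub>R x))) \<partial>lborel)"
    by (simp add: dyadic_dilate_def norm_mult norm_power norm_power_int ennreal_mult nn_integral_cmult)
  also have "\<dots> = (\<integral>\<^sup>+x. ennreal (norm (f x)) \<partial>lborel)"
    using nn_integral_lborel_affine[of "\<lambda>x. ennreal (norm (f x))" "2 powi k" 0] by simp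
  finally show ?thesis .
qed

lemma reproducing_kernel_exists:
  fixes \<phi> :: "'a::euclidean_space \<Rightarrow> real"
  assumes \<phi>: "dyadic_generator \<phi>"
  obtains K where "rapidly_decreasing K" "\<And>\<xi>. \<phi> \<xi> \<noteq> 0 \<Longrightarrow> fourier K \<xi> = 1"
proof
  define f where "f \<xi> = complex_of_real (\<phi> \<xi>)" for \<xi>
  define P where "P j = dyadic_dilate j (inv_fourier f)" for j
  have f: "schwartz f" using \<phi> by (simp add: dyadic_generator_def f_def[abs_def])
  note inv_f = inv_fourier_rapidly_decreasing[OF f]
  have P: "rapidly_decreasing (P j)" for j
    unfolding P_def by (rule rapidly_decreasing_dyadic_dilate[OF inv_f])
  have fourier_P: "fourier (P j) \<xi> = f ((2 powi (- j)) *\<^sub>R \<xi>)" for j \<xi>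
    unfolding P_def
    by (simp only: fourier_dyadic_dilate[OF rapidly_decreasing_measurable[OF inv_f]] schwartz_fourier_inv_fourier[OF f])
  show "rapidly_decreasing (\<lambda>x. \<Sum>j\<in>{-2..2}. P j x)" by (intro rapidly_decreasing_sum P) simp
  fix \<xi> assume "\<phi> \<xi> \<noteq> 0"
  have "fourier (\<lambda>x. \<Sum>j\<in>{-2..2}. P j x) \<xi> = (\<Sum>j\<in>{-2..2}. fourier (P j) \<xi>)"
    unfolding fourier_eq_inv_fourier by (intro inv_fourier_sum rapidly_decreasing_integrable P)
  also have "\<dots> = complex_of_real (\<Sum>j\<in>{-2..2}. \<phi> ((2 powi (- j)) *\<^sub>R \<xi>))"
    by (simp only: fourier_P f_def of_real_sum)
  finally show "fourier (\<lambda>x. \<Sum>j\<in>{-2..2}. P j x) \<xi> = 1"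
    using dyadic_generator_sum_eq_1[OF \<phi> \<open>\<phi> \<xi> \<noteq> 0\<close>] by simp
qed

lemma lp_block_correlation:
  assumes K: "rapidly_decreasing K" and \<psi>: "schwartz \<psi>"
    and one: "\<And>\<xi>. \<phi> ((2 powi (- k)) *\<^sub>R \<xi>) \<noteq> 0 \<Longrightarrow> fourier K \<xi> = 1"
  shows "lp_block \<phi> k T (correlation K \<psi>) = lp_block \<phi> k T \<psi>"
proof -
  have "inv_fourier (correlation K \<psi>) \<xi> = fourier K \<xi> * inv_fourier \<psi> \<xi>" for \<xi>
    by (intro inv_fourier_correlation rapidly_decreasing_integrable schwartz_integrable K \<psi>)
  then have "complex_of_real (\<phi> ((2 powi (- k)) *\<^sub>R \<xi>)) * inv_fourier (correlation K \<psi>) \<xi>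
      = complex_of_real (\<phi> ((2 powi (- k)) *\<^sub>R \<xi>)) * inv_fourier \<psi> \<xi>" for \<xi>
    using one[of \<xi>] by (cases "\<phi> ((2 powi (- k)) *\<^sub>R \<xi>) = 0") auto
  then show ?thesis by (simp only: lp_block_def dist_inv_fourier_def dist_mult_def)
qed


section \<open>Convolutions\<close>

definition fun_convolution :: "('a::euclidean_space \<Rightarrow> complex) \<Rightarrow> ('a \<Rightarrow> complex) \<Rightarrow> 'a \<Rightarrow> complex" where
  "fun_convolution K g x = (\<integral>y. K (x - y) * g y \<partial>lborel)"

lemma fun_convolution_measurable [measurable]:
  assumes [measurable]: "K \<in> borel_measurable borel" "g \<in> borel_measurable borel"
  shows "fun_convolution K g \<in> borel_measurable borel"
  unfolding fun_convolution_def[abs_def] by (rule lborel.borel_measurable_lebesgue_integral) measurable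

lemma norm_fun_convolution_le:
  "ennreal (norm (fun_convolution K g x))
    \<le> nn_convolution (\<lambda>z. ennreal (norm (K z))) (\<lambda>y. ennreal (norm (g y))) x"
proof (cases "integrable lborel (\<lambda>y. K (x - y) * g y)")
  case True
  then show ?thesis
    using integral_norm_bound_ennreal[OF True]
    by (simp add: fun_convolution_def nn_convolution_def norm_mult ennreal_mult)
qed (simp add: fun_convolution_def not_integrable_integral_eq)

lemma rearrangement_fun_convolution_le:
  fixes K g :: "'a::euclidean_space \<Rightarrow> complex"
  assumes [measurable]: "K \<in> borel_measurable borel" "g \<in> borel_measurable borel"
    and "0 < r" "0 < t"
    and K: "(\<integral>\<^sup>+x. ennreal (norm (K x)) \<partial>lborel) \<le> c" "\<And>x. ennreal (norm (K x)) * ennreal r \<le> c"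
  shows "rearrangement (fun_convolution K g) t \<le> 2 * c * average_rearrangement g (max r t)"
proof (rule rearrangement_le)
  define N where "N = 2 * c * average_rearrangement g (max r t)"
  define G where "G = nn_convolution (\<lambda>z. ennreal (norm (K z))) (\<lambda>y. ennreal (norm (g y)))"
  have G_measurable [measurable]: "G \<in> borel_measurable borel" unfolding G_def by measurable
  have "emeasure lborel {x. N < ennreal (norm (fun_convolution K g x))} \<le> emeasure lborel {x. N < G x}"
    using norm_fun_convolution_le[of K g] unfolding G_def
    by (intro emeasure_mono) (auto intro: less_le_trans)
  also have "\<dots> \<le> ennreal t"
  proof (cases "t \<le> r")
    case True
    then have "G x \<le> N" for x
      unfolding G_def N_def using \<open>0 < r\<close> K by (simp add: nn_convolution_le_average max_absorb1)
    then have "{x. N < G x} = {}" by (auto simp: not_less)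
    then show ?thesis by simp
  next
    case False
    then show ?thesis
      unfolding G_def N_def using \<open>0 < t\<close> K(1)
      by (simp add: emeasure_superlevel_nn_convolution_le max_absorb2)
  qed
  finally show "emeasure lebesgue {x. 2 * c * average_rearrangement g (max r t) < ennreal (norm (fun_convolution K g x))} \<le> ennreal t"
    by (simp add: N_def)
qed

lemma average_rearrangement_less_top:
  fixes q :: real
  assumes "0 < c" "lz_admissible q c B" "lz_qnorm (ennreal q) c B f < top" "0 < t"
  shows "average_rearrangement f t < top"
proof -
  obtain C where "average_rearrangement f t \<le> ennreal (C * powr_log (- (1 / q)) (- B) t) * lz_qnorm (ennreal q) c B f"
    using average_rearrangement_le_lz_qnorm[OF assms(1,2)] assms(4) by metis
  also have "\<dots> < top" using assms(3) by (simp add: ennreal_mult_less_top)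
  finally show ?thesis .
qed

lemma rearrangement_fun_convolution_le_powr_log:
  fixes q :: real
  assumes "0 < c" "lz_admissible q c B"
  obtains C where "0 < C"
    "\<And>(K :: 'a::euclidean_space \<Rightarrow> complex) g r t \<kappa>.
      K \<in> borel_measurable borel \<Longrightarrow> g \<in> borel_measurable borel \<Longrightarrow> 0 < r \<Longrightarrow> 0 < t \<Longrightarrow>
      (\<integral>\<^sup>+x. ennreal (norm (K x)) \<partial>lborel) \<le> \<kappa> \<Longrightarrow> (\<And>x. ennreal (norm (K x)) * ennreal r \<le> \<kappa>) \<Longrightarrow>
      rearrangement (fun_convolution K g) t
        \<le> ennreal C * \<kappa> * lz_qnorm (ennreal q) c B g * ennreal (powr_log (- (1 / q)) (- B) (max r t))"
proof -
  obtain C where C: "0 < C" "\<And>(g :: 'a \<Rightarrow> complex) t. 0 < t \<Longrightarrow>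
      average_rearrangement g t \<le> ennreal (C * powr_log (- (1 / q)) (- B) t) * lz_qnorm (ennreal q) c B g"
    by (rule average_rearrangement_le_lz_qnorm[OF assms]) blast
  show ?thesis
  proof (rule that[of "2 * C"])
    show "0 < 2 * C" using C(1) by simp
    fix K g :: "'a \<Rightarrow> complex" and r t :: real and \<kappa>
    assume "K \<in> borel_measurable borel" "g \<in> borel_measurable borel" and r: "0 < r" "0 < t"
      and "(\<integral>\<^sup>+x. ennreal (norm (K x)) \<partial>lborel) \<le> \<kappa>" "\<And>x. ennreal (norm (K x)) * ennreal r \<le> \<kappa>"
    then have "rearrangement (fun_convolution K g) t \<le> 2 * \<kappa> * average_rearrangement g (max r t)"
      by (intro rearrangement_fun_convolution_le)
    also have "\<dots> \<le> 2 * \<kappa> * (ennreal (C * powr_log (- (1 / q)) (- B) (max r t)) * lz_qnorm (ennreal q) c B g)"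
      using r by (intro mult_left_mono C(2)) auto
    finally show "rearrangement (fun_convolution K g) t
        \<le> ennreal (2 * C) * \<kappa> * lz_qnorm (ennreal q) c B g * ennreal (powr_log (- (1 / q)) (- B) (max r t))"
      using C(1) by (simp add: ennreal_mult powr_log_nonneg mult_ac)
  qed
qed

lemma lz_qnorm_fun_convolution_le:
  fixes q :: real
  assumes "0 < c" and adm: "lz_admissible q c B"
    and "0 < b" and A: "fst A < - recip b" "- recip b < snd A"
  obtains C where "0 < C"
    "\<And>(K :: 'a::euclidean_space \<Rightarrow> complex) g r \<kappa>.
      K \<in> borel_measurable borel \<Longrightarrow> g \<in> borel_measurable borel \<Longrightarrow> 0 < r \<Longrightarrow>
      (\<integral>\<^sup>+x. ennreal (norm (K x)) \<partial>lborel) \<le> \<kappa> \<Longrightarrow> (\<And>x. ennreal (norm (K x)) * ennreal r \<le> \<kappa>) \<Longrightarrow>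
      lz_qnorm top b A (fun_convolution K g)
        \<le> ennreal (C * powr_log (- (1 / q)) (pair_shift (A - B) (recip b)) r) * \<kappa> * lz_qnorm (ennreal q) c B g"
proof -
  obtain C where C: "0 < C" "\<And>(K :: 'a \<Rightarrow> complex) g r t \<kappa>.
      K \<in> borel_measurable borel \<Longrightarrow> g \<in> borel_measurable borel \<Longrightarrow> 0 < r \<Longrightarrow> 0 < t \<Longrightarrow>
      (\<integral>\<^sup>+x. ennreal (norm (K x)) \<partial>lborel) \<le> \<kappa> \<Longrightarrow> (\<And>x. ennreal (norm (K x)) * ennreal r \<le> \<kappa>) \<Longrightarrow>
      rearrangement (fun_convolution K g) t
        \<le> ennreal C * \<kappa> * lz_qnorm (ennreal q) c B g * ennreal (powr_log (- (1 / q)) (- B) (max r t))"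
    by (rule rearrangement_fun_convolution_le_powr_log[OF \<open>0 < c\<close> adm]) blast
  have "0 < 1 / q" using adm by (auto simp: lz_admissible_def)
  obtain D where D: "0 < D" "\<And>(f :: 'a \<Rightarrow> complex) N r. 0 < r \<Longrightarrow>
      (\<And>t. 0 < t \<Longrightarrow> rearrangement f t \<le> N * ennreal (powr_log (- (1 / q)) (- B) (max r t))) \<Longrightarrow>
      lz_qnorm top b A f \<le> N * ennreal (D * powr_log (- (1 / q)) (pair_shift (A + - B) (recip b)) r)"
    by (rule lz_qnorm_top_le[OF \<open>0 < 1 / q\<close> \<open>0 < b\<close> A, of "- B"]) blast
  show ?thesis
  proof (rule that[of "C * D"])
    show "0 < C * D" using C(1) D(1) by simp
    fix K g :: "'a \<Rightarrow> complex" and r :: real and \<kappa>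
    assume "K \<in> borel_measurable borel" "g \<in> borel_measurable borel" "0 < r"
      "(\<integral>\<^sup>+x. ennreal (norm (K x)) \<partial>lborel) \<le> \<kappa>" "\<And>x. ennreal (norm (K x)) * ennreal r \<le> \<kappa>"
    then have "lz_qnorm top b A (fun_convolution K g) \<le> ennreal C * \<kappa> * lz_qnorm (ennreal q) c B g
        * ennreal (D * powr_log (- (1 / q)) (pair_shift (A + - B) (recip b)) r)"
      by (intro D(2) C(2))
    then show "lz_qnorm top b A (fun_convolution K g)
        \<le> ennreal (C * D * powr_log (- (1 / q)) (pair_shift (A - B) (recip b)) r) * \<kappa> * lz_qnorm (ennreal q) c B g"
      using C(1) D(1) by (simp add: ennreal_mult powr_log_nonneg mult_ac)
  qed
qed

lemma integral_fun_convolution_mult: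
  fixes K g \<psi> :: "'a::euclidean_space \<Rightarrow> complex"
  assumes [measurable]: "K \<in> borel_measurable borel" "g \<in> borel_measurable borel"
    and \<psi>: "integrable lborel \<psi>"
    and bound: "\<And>x. nn_convolution (\<lambda>z. ennreal (norm (K z))) (\<lambda>y. ennreal (norm (g y))) x \<le> ennreal M"
  shows "(\<integral>x. fun_convolution K g x * \<psi> x \<partial>lborel) = (\<integral>y. g y * correlation K \<psi> y \<partial>lborel)"
proof -
  have [measurable]: "\<psi> \<in> borel_measurable borel" using \<psi> by auto
  have "(\<integral>x. fun_convolution K g x * \<psi> x \<partial>lborel) = (\<integral>x. \<integral>y. K (x - y) * g y * \<psi> x \<partial>lborel \<partial>lborel)"
    by (simp add: fun_convolution_def)
  also have "\<dots> = (\<integral>y. \<integral>x. K (x - y) * g y * \<psi> x \<partial>lborel \<partial>lborel)"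
  proof (rule lborel_pair.Fubini_integral[symmetric], rule integrable_lborel_pairI)
    have "(\<integral>\<^sup>+x. \<integral>\<^sup>+y. ennreal (norm (K (x - y) * g y * \<psi> x)) \<partial>lborel \<partial>lborel)
        = (\<integral>\<^sup>+x. nn_convolution (\<lambda>z. ennreal (norm (K z))) (\<lambda>y. ennreal (norm (g y))) x * ennreal (norm (\<psi> x)) \<partial>lborel)"
      by (simp add: nn_convolution_def norm_mult ennreal_mult nn_integral_multc)
    also have "\<dots> \<le> (\<integral>\<^sup>+x. ennreal M * ennreal (norm (\<psi> x)) \<partial>lborel)"
      by (intro nn_integral_mono mult_right_mono bound) simp
    also have "\<dots> < \<infinity>" using \<psi> by (simp add: nn_integral_cmult integrable_iff_bounded ennreal_mult_less_top)
    finally show "(\<integral>\<^sup>+x. \<integral>\<^sup>+y. ennreal (norm (K (x - y) * g y * \<psi> x)) \<partial>lborel \<partial>lborel) < \<infinity>" .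
  qed measurable
  also have "\<dots> = (\<integral>y. g y * correlation K \<psi> y \<partial>lborel)"
  proof (rule Bochner_Integration.integral_cong[OF refl])
    fix y
    have "(\<integral>x. K (- y + x) * \<psi> (y + (- y + x)) \<partial>lborel) = correlation K \<psi> y"
      unfolding correlation_def by (rule lborel_integral_translate[of "\<lambda>x. K x * \<psi> (y + x)"]) measurable
    moreover have "(\<integral>x. K (x - y) * g y * \<psi> x \<partial>lborel) = (\<integral>x. g y * (K (x - y) * \<psi> x) \<partial>lborel)"
      by (simp add: mult_ac)
    ultimately show "(\<integral>x. K (x - y) * g y * \<psi> x \<partial>lborel) = g y * correlation K \<psi> y" by simp
  qed
  finally show ?thesis .
qed


section \<open>Representing functions of tempered distributions\<close>

lemma represents_borel_iff:
  assumes [measurable]: "g \<in> borel_measurable borel"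
  shows "represents g T \<longleftrightarrow> (\<forall>\<psi>. schwartz \<psi> \<longrightarrow>
    integrable lborel (\<lambda>x. g x * \<psi> x) \<and> T \<psi> = (\<integral>x. g x * \<psi> x \<partial>lborel))"
proof -
  have "g \<in> borel_measurable lebesgue" by (intro measurable_completion) simp
  moreover have "integrable lebesgue (\<lambda>x. g x * \<psi> x) = integrable lborel (\<lambda>x. g x * \<psi> x)"
    "(\<integral>x. g x * \<psi> x \<partial>lebesgue) = (\<integral>x. g x * \<psi> x \<partial>lborel)" if "schwartz \<psi>" for \<psi>
    using schwartz_measurable[OF that] by (simp_all add: integrable_completion integral_completion)
  ultimately show ?thesis unfolding represents_def by auto
qed

lemma represents_cong_AE:
  assumes "represents g T" and h: "h \<in> borel_measurable lebesgue" and eq: "AE x in lebesgue. g x = h x"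
  shows "represents h T"
  unfolding represents_def
proof (intro conjI allI impI h)
  fix \<psi> :: "'a \<Rightarrow> complex" assume \<psi>: "schwartz \<psi>"
  have g_meas: "(\<lambda>x. g x * \<psi> x) \<in> borel_measurable lebesgue"
    using assms(1) \<psi> unfolding represents_def by auto
  have "\<psi> \<in> borel_measurable lebesgue"
    using schwartz_measurable[OF \<psi>] by (intro measurable_completion) simp
  then have h_meas: "(\<lambda>x. h x * \<psi> x) \<in> borel_measurable lebesgue" using h by simp
  have "AE x in lebesgue. g x * \<psi> x = h x * \<psi> x" using eq by eventually_elim simp
  note cong = integrable_cong_AE[OF g_meas h_meas this] integral_cong_AE[OF g_meas h_meas this]
  show "integrable lebesgue (\<lambda>x. h x * \<psi> x)" "T \<psi> = (\<integral>x. h x * \<psi> x \<partial>lebesgue)"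
    using assms(1) \<psi> cong unfolding represents_def by auto
qed

lemma represents_borel_version:
  fixes g :: "'a::euclidean_space \<Rightarrow> complex"
  assumes g: "represents g T"
  obtains h where "h \<in> borel_measurable borel" "represents h T" "rearrangement h = rearrangement g"
proof -
  have g_meas: "g \<in> borel_measurable lebesgue" using g by (simp add: represents_def)
  then have "(\<lambda>x. Re (g x)) \<in> borel_measurable lebesgue" "(\<lambda>x. Im (g x)) \<in> borel_measurable lebesgue"
    by simp_all
  then obtain u v where uv: "u \<in> borel_measurable lborel" "AE x in lborel. Re (g x) = u x"
    "v \<in> borel_measurable lborel" "AE x in lborel. Im (g x) = v x"
    using completion_ex_borel_measurable_real by metis
  define h where "h x = Complex (u x) (v x)" for x
  have h: "h \<in> borel_measurable borel"
    using uv by (simp add: h_def[abs_def] borel_measurable_complex_iff)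
  then have h_meas: "h \<in> borel_measurable lebesgue" by (intro measurable_completion) simp
  have "AE x in lborel. g x = h x"
    using uv(2,4) by eventually_elim (simp add: h_def complex_eq_iff)
  then have eq: "AE x in lebesgue. g x = h x" by (rule AE_completion)
  show ?thesis
    using that[OF h represents_cong_AE[OF g h_meas eq]] rearrangement_cong_AE[OF g_meas h_meas eq] by simp
qed

lemma rapidly_decreasing_nn_convolution_bounded:
  fixes K g :: "'a::euclidean_space \<Rightarrow> complex"
  assumes K: "rapidly_decreasing K" and "g \<in> borel_measurable borel"
    and r: "0 < r" and avg: "average_rearrangement g r < top"
  obtains M where "\<And>x. nn_convolution (\<lambda>z. ennreal (norm (K z))) (\<lambda>y. ennreal (norm (g y))) x \<le> ennreal M"
proof -
  have [measurable]: "K \<in> borel_measurable borel" by (rule rapidly_decreasing_measurable[OF K])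
  obtain C where C: "0 \<le> C" "\<And>x. norm (K x) \<le> C" using rapidly_decreasing_bounded[OF K] by blast
  define c where "c = (\<integral>\<^sup>+x. ennreal (norm (K x)) \<partial>lborel) + ennreal (C * r)"
  have "c < top"
    using rapidly_decreasing_integrable[OF K] by (simp add: c_def integrable_iff_bounded)
  then have "2 * c * average_rearrangement g r < top"
    using avg by (simp add: ennreal_mult_less_top)
  then have "2 * c * average_rearrangement g r = ennreal (enn2real (2 * c * average_rearrangement g r))"
    by simp
  moreover have "nn_convolution (\<lambda>z. ennreal (norm (K z))) (\<lambda>y. ennreal (norm (g y))) x
      \<le> 2 * c * average_rearrangement g r" for x
  proof (rule nn_convolution_le_average[OF assms(2) _ r])
    show "ennreal (norm (K z)) * ennreal r \<le> c" for z
      unfolding c_def using C r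
      by (intro add_increasing) (simp_all add: ennreal_leI mult_right_mono flip: ennreal_mult)
  qed (simp_all add: c_def)
  ultimately show ?thesis using that by metis
qed

lemma represents_fun_convolution:
  fixes K g :: "'a::euclidean_space \<Rightarrow> complex"
  assumes K: "rapidly_decreasing K" and g[measurable]: "g \<in> borel_measurable borel"
    and rep: "represents g T" and "0 < r" "average_rearrangement g r < top"
    and invariant: "\<And>\<psi>. schwartz \<psi> \<Longrightarrow> T (correlation K \<psi>) = T \<psi>"
  shows "represents (fun_convolution K g) T"
proof -
  note [measurable] = rapidly_decreasing_measurable[OF K]
  obtain M where bound: "\<And>x. nn_convolution (\<lambda>z. ennreal (norm (K z))) (\<lambda>y. ennreal (norm (g y))) x \<le> ennreal M"
    using rapidly_decreasing_nn_convolution_bounded[OF K g \<open>0 < r\<close> \<open>average_rearrangement g r < top\<close>] by blast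
  have conv_bound: "norm (fun_convolution K g x) \<le> max 0 M" for x
  proof -
    have "ennreal (norm (fun_convolution K g x)) \<le> ennreal (max 0 M)"
      using order_trans[OF norm_fun_convolution_le bound] by (rule order_trans) (simp add: ennreal_leI)
    then show ?thesis by (subst (asm) ennreal_le_iff) auto
  qed
  have "integrable lborel (\<lambda>x. fun_convolution K g x * \<psi> x) \<and> T \<psi> = (\<integral>x. fun_convolution K g x * \<psi> x \<partial>lborel)"
    if \<psi>: "schwartz \<psi>" for \<psi>
  proof
    have \<psi>_integrable: "integrable lborel \<psi>" by (rule schwartz_integrable[OF \<psi>])
    note [measurable] = schwartz_measurable[OF \<psi>]
    show "integrable lborel (\<lambda>x. fun_convolution K g x * \<psi> x)"
    proof (rule Bochner_Integration.integrable_bound)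
      show "integrable lborel (\<lambda>x. max 0 M * norm (\<psi> x))" using \<psi>_integrable by simp
      show "AE x in lborel. norm (fun_convolution K g x * \<psi> x) \<le> norm (max 0 M * norm (\<psi> x))"
        using conv_bound by (intro AE_I2) (simp add: norm_mult mult_right_mono)
    qed measurable
    have "T \<psi> = (\<integral>y. g y * correlation K \<psi> y \<partial>lborel)"
      using rep schwartz_correlation[OF K \<psi>] invariant[OF \<psi>] by (simp add: represents_borel_iff[OF g])
    also have "\<dots> = (\<integral>x. fun_convolution K g x * \<psi> x \<partial>lborel)"
      by (rule integral_fun_convolution_mult[symmetric, OF _ g \<psi>_integrable bound]) measurable
    finally show "T \<psi> = (\<integral>x. fun_convolution K g x * \<psi> x \<partial>lborel)" .
  qed
  then show ?thesis by (subst represents_borel_iff) auto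
qed


section \<open>The Nikolskii inequality for a dyadic block\<close>

lemma ennreal_le_mult_INF:
  fixes X :: ennreal
  assumes "0 < a" and le: "\<And>i. i \<in> I \<Longrightarrow> X \<le> ennreal a * f i"
  shows "X \<le> ennreal a * (INF i\<in>I. f i)"
proof -
  have "X / ennreal a \<le> (INF i\<in>I. f i)"
    using assms by (intro INF_greatest divide_le_posI_ennreal) auto
  then have "ennreal a * (X / ennreal a) \<le> ennreal a * (INF i\<in>I. f i)" by (rule mult_left_mono) simp
  then show ?thesis using \<open>0 < a\<close> by (simp add: ennreal_times_divide mult.commute ennreal_mult_divide_eq)
qed

lemma powr_log_dyadic_le:
  assumes "1 \<le> n"
  shows "powr_log (- e) D (1 / (2 powi k) ^ n)
    \<le> real n powr (\<bar>fst D\<bar> + \<bar>snd D\<bar>) * (2 powr (real n * e * real_of_int k) * broken_log (prod.swap D) (2 powi k))"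
proof -
  define s where "s = (2::real) powi k"
  have s: "0 < s" "s = 2 powr real_of_int k" by (simp_all add: s_def powr_real_of_int')
  have "1 / s ^ n = 2 powr (- (real_of_int k * real n))"
    using s by (simp add: powr_minus_divide powr_powr flip: powr_realpow)
  then have "(1 / s ^ n) powr (- e) = 2 powr (real n * e * real_of_int k)"
    by (simp add: powr_powr mult_ac)
  moreover have "broken_log D (1 / s ^ n) \<le> real n powr (\<bar>fst D\<bar> + \<bar>snd D\<bar>) * broken_log (prod.swap D) s"
    using broken_log_power_le[OF assms s(1), of "prod.swap D"] s(1) by (simp add: broken_log_inverse add.commute)
  ultimately show ?thesis
    by (simp add: powr_log_def s_def[symmetric] mult.left_commute mult_left_mono)
qed

lemma represents_lp_block_fun_convolution:
  assumes K: "rapidly_decreasing K" "\<And>\<xi>. \<phi> \<xi> \<noteq> 0 \<Longrightarrow> fourier K \<xi> = 1"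
    and g: "g \<in> borel_measurable borel" "represents g (lp_block \<phi> k T)"
    and avg: "0 < r" "average_rearrangement g r < top"
  shows "represents (fun_convolution (dyadic_dilate k K) g) (lp_block \<phi> k T)"
proof (rule represents_fun_convolution[OF _ g avg])
  show K_k: "rapidly_decreasing (dyadic_dilate k K)"
    by (rule rapidly_decreasing_dyadic_dilate[OF K(1)])
  show "lp_block \<phi> k T (correlation (dyadic_dilate k K) \<psi>) = lp_block \<phi> k T \<psi>" if "schwartz \<psi>" for \<psi>
    using K(2) by (intro lp_block_correlation K_k that)
      (simp add: fourier_dyadic_dilate rapidly_decreasing_measurable[OF K(1)])
qed

lemma rapidly_decreasing_L1_sup_bound:
  assumes K: "rapidly_decreasing K"
  obtains \<kappa> where "0 < \<kappa>" "(\<integral>\<^sup>+x. ennreal (norm (K x)) \<partial>lborel) \<le> ennreal \<kappa>" "\<And>x. norm (K x) \<le> \<kappa>"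
proof -
  obtain M where M: "0 \<le> M" "\<And>x. norm (K x) \<le> M" using rapidly_decreasing_bounded[OF K] by blast
  define I where "I = (\<integral>x. norm (K x) \<partial>lborel)"
  have I: "0 \<le> I" by (simp add: I_def)
  show ?thesis
  proof (rule that[of "I + M + 1"])
    have "(\<integral>\<^sup>+x. ennreal (norm (K x)) \<partial>lborel) = ennreal I"
      using rapidly_decreasing_integrable[OF K] by (subst nn_integral_eq_integral) (auto simp: I_def)
    then show "(\<integral>\<^sup>+x. ennreal (norm (K x)) \<partial>lborel) \<le> ennreal (I + M + 1)"
      using M(1) by (simp add: ennreal_leI)
    show "0 < I + M + 1" using I M(1) by linarith
    show "norm (K x) \<le> I + M + 1" for x using I M(2)[of x] by linarith
  qed
qed

lemma lp_block_borel_representative: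
  fixes q :: real
  assumes K: "rapidly_decreasing K" "\<And>\<xi>. \<phi> \<xi> \<noteq> 0 \<Longrightarrow> fourier K \<xi> = 1"
    and "0 < c" "lz_admissible q c B"
    and g: "represents g (lp_block \<phi> k T)" "lz_qnorm (ennreal q) c B g < top"
  obtains h where "h \<in> borel_measurable borel" "lz_qnorm (ennreal q) c B h = lz_qnorm (ennreal q) c B g"
    "represents (fun_convolution (dyadic_dilate k K) h) (lp_block \<phi> k T)"
proof -
  obtain h where h: "h \<in> borel_measurable borel" "represents h (lp_block \<phi> k T)"
    and eq: "rearrangement h = rearrangement g"
    using represents_borel_version[OF g(1)] by blast
  have lz_h: "lz_qnorm (ennreal q) c B h = lz_qnorm (ennreal q) c B g"
    by (simp add: lz_qnorm_def eq)
  then have "average_rearrangement h 1 < top"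
    using g(2) by (intro average_rearrangement_less_top[OF assms(3,4)]) simp_all
  from represents_lp_block_fun_convolution[OF K(1) _ h zero_less_one this] K(2)
  have "represents (fun_convolution (dyadic_dilate k K) h) (lp_block \<phi> k T)" by blast
  then show ?thesis by (rule that[OF h(1) lz_h])
qed

lemma lz_qnorm_dyadic_convolution_le:
  fixes K :: "'a::euclidean_space \<Rightarrow> complex" and q :: real
  assumes K: "rapidly_decreasing K" and c: "0 < c" "lz_admissible q c B"
    and b: "0 < b" "fst A < - recip b" "- recip b < snd A"
  obtains C where "0 < C"
    "\<And>k h. h \<in> borel_measurable borel \<Longrightarrow> lz_qnorm top b A (fun_convolution (dyadic_dilate k K) h)
       \<le> ennreal (C * powr_log (- (1 / q)) (pair_shift (A - B) (recip b)) (1 / (2 powi k) ^ DIM('a)))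
          * lz_qnorm (ennreal q) c B h"
proof -
  define W where "W = powr_log (- (1 / q)) (pair_shift (A - B) (recip b))"
  have K_measurable: "K \<in> borel_measurable borel" by (rule rapidly_decreasing_measurable[OF K])
  obtain \<kappa> where \<kappa>: "0 < \<kappa>" "(\<integral>\<^sup>+x. ennreal (norm (K x)) \<partial>lborel) \<le> ennreal \<kappa>" "\<And>x. norm (K x) \<le> \<kappa>"
    using rapidly_decreasing_L1_sup_bound[OF K] by blast
  obtain C where C: "0 < C" "\<And>(K :: 'a \<Rightarrow> complex) g r \<kappa>.
      K \<in> borel_measurable borel \<Longrightarrow> g \<in> borel_measurable borel \<Longrightarrow> 0 < r \<Longrightarrow>
      (\<integral>\<^sup>+x. ennreal (norm (K x)) \<partial>lborel) \<le> \<kappa> \<Longrightarrow> (\<And>x. ennreal (norm (K x)) * ennreal r \<le> \<kappa>) \<Longrightarrow>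
      lz_qnorm top b A (fun_convolution K g) \<le> ennreal (C * W r) * \<kappa> * lz_qnorm (ennreal q) c B g"
    unfolding W_def by (rule lz_qnorm_fun_convolution_le[OF c b]) blast
  have "lz_qnorm top b A (fun_convolution (dyadic_dilate k K) h)
      \<le> ennreal (C * \<kappa> * W (1 / (2 powi k) ^ DIM('a))) * lz_qnorm (ennreal q) c B h"
    if h: "h \<in> borel_measurable borel" for k h
  proof -
    define r where "r = 1 / (2 powi k :: real) ^ DIM('a)"
    have r: "0 < r" by (simp add: r_def)
    then have W: "0 < W r" by (simp add: W_def powr_log_pos)
    have "lz_qnorm top b A (fun_convolution (dyadic_dilate k K) h)
        \<le> ennreal (C * W r) * ennreal \<kappa> * lz_qnorm (ennreal q) c B h"
    proof (rule C(2)[OF _ h r])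
      show "ennreal (norm (dyadic_dilate k K x)) * ennreal r \<le> ennreal \<kappa>" for x
        using ennreal_leI[OF \<kappa>(3)]
        by (simp add: dyadic_dilate_def r_def norm_mult norm_power norm_power_int flip: ennreal_mult)
    qed (simp_all add: \<kappa>(2) K_measurable nn_integral_dyadic_dilate
        rapidly_decreasing_measurable rapidly_decreasing_dyadic_dilate[OF K])
    also have "\<dots> = ennreal (C * \<kappa> * W r) * lz_qnorm (ennreal q) c B h"
      using C(1) \<kappa>(1) W by (simp add: mult_ac flip: ennreal_mult)
    finally show ?thesis by (simp only: r_def)
  qed
  then show ?thesis using that[of "C * \<kappa>"] C(1) \<kappa>(1) by (simp add: W_def)
qed

lemma dist_lz_qnorm_lp_block_le:
  fixes \<phi> :: "'a::euclidean_space \<Rightarrow> real" and q :: real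
  assumes \<phi>: "dyadic_generator \<phi>" and c: "0 < c" "lz_admissible q c B"
    and b: "0 < b" "fst A < - recip b" "- recip b < snd A"
  obtains C where "0 < C"
    "\<And>k T g. represents g (lp_block \<phi> k T) \<Longrightarrow> dist_lz_qnorm top b A (lp_block \<phi> k T)
       \<le> ennreal (C * powr_log (- (1 / q)) (pair_shift (A - B) (recip b)) (1 / (2 powi k) ^ DIM('a)))
          * lz_qnorm (ennreal q) c B g"
proof -
  define W where "W k = powr_log (- (1 / q)) (pair_shift (A - B) (recip b)) (1 / (2 powi k) ^ DIM('a))" for k :: int
  obtain K where K: "rapidly_decreasing K" "\<And>\<xi>. \<phi> \<xi> \<noteq> 0 \<Longrightarrow> fourier K \<xi> = 1"
    using reproducing_kernel_exists[OF \<phi>] by blast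
  obtain C where C: "0 < C" "\<And>k h. h \<in> borel_measurable borel \<Longrightarrow>
      lz_qnorm top b A (fun_convolution (dyadic_dilate k K) h) \<le> ennreal (C * W k) * lz_qnorm (ennreal q) c B h"
    unfolding W_def by (rule lz_qnorm_dyadic_convolution_le[OF K(1) c b]) blast
  have "dist_lz_qnorm top b A (lp_block \<phi> k T) \<le> ennreal (C * W k) * lz_qnorm (ennreal q) c B g"
    if rep: "represents g (lp_block \<phi> k T)" for k T g
  proof (cases "lz_qnorm (ennreal q) c B g = top")
    case True
    moreover have "0 < W k" by (simp add: W_def powr_log_pos)
    ultimately show ?thesis using C(1) by (simp add: ennreal_mult_top)
  next
    case False
    then obtain h where h: "h \<in> borel_measurable borel" "lz_qnorm (ennreal q) c B h = lz_qnorm (ennreal q) c B g"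
      "represents (fun_convolution (dyadic_dilate k K) h) (lp_block \<phi> k T)"
      using lp_block_borel_representative[OF K c rep] by (auto simp: less_top)
    from h(3) have "dist_lz_qnorm top b A (lp_block \<phi> k T) \<le> lz_qnorm top b A (fun_convolution (dyadic_dilate k K) h)"
      unfolding dist_lz_qnorm_def by (intro INF_lower) simp
    with C(2)[OF h(1), of k] show ?thesis by (simp add: h(2))
  qed
  then show ?thesis using that[OF C(1)] by (simp only: W_def)
qed

lemma lp_block_nikolskii:
  fixes \<phi> :: "'a::euclidean_space \<Rightarrow> real" and q :: real
  assumes "dyadic_generator \<phi>" "0 < c" "lz_admissible q c B"
    and "0 < b" "fst A < - recip b" "- recip b < snd A"
  obtains C where "0 < C"
    "\<And>k T. dist_lz_qnorm top b A (lp_block \<phi> k T)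
       \<le> ennreal (C * (2 powr (real DIM('a) / q * real_of_int k)
            * broken_log (pair_shift (prod.swap A - prod.swap B) (recip b)) (2 powi k)))
          * dist_lz_qnorm (ennreal q) c B (lp_block \<phi> k T)"
proof -
  define D where "D = pair_shift (A - B) (recip b)"
  define E where "E = real DIM('a) powr (\<bar>fst D\<bar> + \<bar>snd D\<bar>)"
  have swap_D: "pair_shift (prod.swap A - prod.swap B) (recip b) = prod.swap D"
    by (simp add: D_def pair_shift_def)
  obtain C where C: "0 < C" "\<And>k T g. represents g (lp_block \<phi> k T) \<Longrightarrow> dist_lz_qnorm top b A (lp_block \<phi> k T)
       \<le> ennreal (C * powr_log (- (1 / q)) D (1 / (2 powi k) ^ DIM('a))) * lz_qnorm (ennreal q) c B g"
    unfolding D_def by (rule dist_lz_qnorm_lp_block_le[OF assms]) blast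
  show ?thesis
  proof (rule that[of "C * E"])
    show "0 < C * E" using C(1) by (simp add: E_def)
    fix k :: int and T :: "'a functional"
    define W where "W = 2 powr (real DIM('a) / q * real_of_int k) * broken_log (prod.swap D) (2 powi k)"
    have W: "0 < W" by (simp add: W_def broken_log_pos)
    have "powr_log (- (1 / q)) D (1 / (2 powi k) ^ DIM('a)) \<le> E * W"
      using powr_log_dyadic_le[of "DIM('a)" "1 / q" D k] by (simp add: E_def W_def)
    then have "ennreal (C * powr_log (- (1 / q)) D (1 / (2 powi k) ^ DIM('a))) \<le> ennreal (C * E * W)"
      using C(1) by (intro ennreal_leI) (simp add: mult.assoc mult_left_mono)
    then have "dist_lz_qnorm top b A (lp_block \<phi> k T) \<le> ennreal (C * E * W) * lz_qnorm (ennreal q) c B g"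
      if "represents g (lp_block \<phi> k T)" for g
      by (intro order_trans[OF C(2)[OF that]] mult_right_mono) simp_all
    then show "dist_lz_qnorm top b A (lp_block \<phi> k T)
        \<le> ennreal (C * E * (2 powr (real DIM('a) / q * real_of_int k)
            * broken_log (pair_shift (prod.swap A - prod.swap B) (recip b)) (2 powi k)))
          * dist_lz_qnorm (ennreal q) c B (lp_block \<phi> k T)"
      unfolding swap_D W_def[symmetric] dist_lz_qnorm_def[of "ennreal q"] using C(1) W
      by (intro ennreal_le_mult_INF) (auto simp: E_def)
  qed
qed


section \<open>Homogeneous Besov-type spaces\<close>

lemma infsum_ennreal_le_cmult:
  fixes f g :: "'i \<Rightarrow> ennreal"
  assumes "\<And>i. f i \<le> a * g i"
  shows "infsum f I \<le> a * infsum g I"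
proof -
  have "sum f F \<le> a * infsum g I" if "finite F" "F \<subseteq> I" for F
  proof -
    have "sum f F \<le> a * sum g F" using assms by (simp add: sum_distrib_left sum_mono)
    also have "sum g F \<le> infsum g I"
      using that by (subst nonneg_infsum_complete) (auto intro: SUP_upper)
    finally show ?thesis by (simp add: mult_left_mono)
  qed
  then show ?thesis
    by (intro infsum_le_finite_sums nonneg_summable_on_complete) auto
qed

lemma ennpowr_infsum_le_cmult:
  assumes p: "0 < p" and le: "\<And>i. f i \<le> a * g i"
  shows "ennpowr (\<Sum>\<^sub>\<infinity>i\<in>I. ennpowr (f i) p) (1 / p) \<le> a * ennpowr (\<Sum>\<^sub>\<infinity>i\<in>I. ennpowr (g i) p) (1 / p)"
proof -
  have "ennpowr (f i) p \<le> ennpowr a p * ennpowr (g i) p" for i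
    using ennpowr_mono[OF p le] by (simp add: ennpowr_mult[OF p])
  then have "(\<Sum>\<^sub>\<infinity>i\<in>I. ennpowr (f i) p) \<le> ennpowr a p * (\<Sum>\<^sub>\<infinity>i\<in>I. ennpowr (g i) p)"
    by (rule infsum_ennreal_le_cmult)
  then have "ennpowr (\<Sum>\<^sub>\<infinity>i\<in>I. ennpowr (f i) p) (1 / p)
      \<le> ennpowr (ennpowr a p * (\<Sum>\<^sub>\<infinity>i\<in>I. ennpowr (g i) p)) (1 / p)"
    using p by (intro ennpowr_mono) auto
  then show ?thesis using p by (simp add: ennpowr_mult ennpowr_inverse)
qed

lemma besov_qnorm_le:
  fixes \<phi> :: "'a::euclidean_space \<Rightarrow> real"
  assumes "0 < u" "0 \<le> C"
    and blocks: "\<And>k. dist_lz_qnorm p b A (lp_block \<phi> k T)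
      \<le> ennreal (C * (2 powr (\<tau> * real_of_int k) * broken_log \<Delta> (2 powi k))) * dist_lz_qnorm q c B (lp_block \<phi> k T)"
  shows "besov_qnorm \<phi> \<sigma> \<Gamma> p b A u T \<le> ennreal C * besov_qnorm \<phi> (\<sigma> + \<tau>) (\<Gamma> + \<Delta>) q c B u T"
proof -
  define X where "X k = ennreal (2 powr ((\<sigma> + \<tau>) * real_of_int k) * broken_log (\<Gamma> + \<Delta>) (2 powi k))
      * dist_lz_qnorm q c B (lp_block \<phi> k T)" for k
  define Y where "Y k = ennreal (2 powr (\<sigma> * real_of_int k) * broken_log \<Gamma> (2 powi k))
      * dist_lz_qnorm p b A (lp_block \<phi> k T)" for k
  have YX: "Y k \<le> ennreal C * X k" for k
  proof -
    define w where "w = 2 powr (\<sigma> * real_of_int k) * broken_log \<Gamma> (2 powi k)"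
    define d where "d = 2 powr (\<tau> * real_of_int k) * broken_log \<Delta> (2 powi k)"
    have "0 \<le> w" "0 \<le> d" by (simp_all add: w_def d_def less_imp_le[OF broken_log_pos])
    have "Y k \<le> ennreal w * (ennreal (C * d) * dist_lz_qnorm q c B (lp_block \<phi> k T))"
      unfolding Y_def w_def d_def by (intro mult_left_mono blocks) simp
    also have "\<dots> = ennreal C * (ennreal (w * d) * dist_lz_qnorm q c B (lp_block \<phi> k T))"
      using \<open>0 \<le> C\<close> \<open>0 \<le> w\<close> \<open>0 \<le> d\<close> by (simp add: ennreal_mult mult_ac)
    also have "w * d = 2 powr ((\<sigma> + \<tau>) * real_of_int k) * broken_log (\<Gamma> + \<Delta>) (2 powi k)"
      by (simp add: w_def d_def broken_log_add distrib_right powr_add)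
    finally show ?thesis by (simp only: X_def)
  qed
  from \<open>0 < u\<close> show ?thesis
  proof (cases rule: exponent_cases)
    case top
    have "(SUP k. Y k) \<le> ennreal C * (SUP k. X k)"
      by (intro SUP_least order_trans[OF YX] mult_left_mono SUP_upper) auto
    then show ?thesis using top by (simp add: besov_qnorm_def X_def Y_def)
  next
    case (real p')
    show ?thesis
      using ennpowr_infsum_le_cmult[OF real(2) YX, where I = UNIV] real(1,2)
      by (simp add: besov_qnorm_def X_def Y_def recip_ennreal)
  qed
qed

lemma continuously_embeddedI:
  assumes le: "\<And>T. tempered T \<Longrightarrow> N\<^sub>Y T \<le> ennreal C * N\<^sub>X T"
  shows "continuously_embedded N\<^sub>X N\<^sub>Y"
proof -
  have "N\<^sub>Y T < \<infinity>" if "tempered T" "N\<^sub>X T < \<infinity>" for T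
    using le_less_trans[OF le[OF that(1)]] that(2) by (simp add: ennreal_mult_less_top)
  then show ?thesis
    using le unfolding continuously_embedded_def tempered_space_def by auto
qed

theorem corollary21:
  fixes \<phi> :: "real ^ 'n \<Rightarrow> real"
    and q \<sigma> :: real and c u b :: ennreal and A B \<Gamma> :: "real \<times> real"
  assumes "dyadic_generator \<phi>"
    and "1 \<le> q" and "0 < c"
    and "(q = 1 \<and> c = 1 \<and> B = (0, 0)) \<or> 1 < q"
    and "0 < u" and "0 < b"
    and "fst A < - recip b" and "- recip b < snd A"
  shows "continuously_embedded
    (besov_qnorm \<phi> (\<sigma> + real CARD('n) / q)
       (\<Gamma> + pair_shift (prod.swap A - prod.swap B) (recip b)) (ennreal q) c B u)
    (besov_qnorm \<phi> \<sigma> \<Gamma> \<infinity> b A u)"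
proof -
  have "lz_admissible q c B" using assms(4) by (simp add: lz_admissible_def zero_prod_def)
  then obtain C where "0 < C" and C: "\<And>k T. dist_lz_qnorm top b A (lp_block \<phi> k T)
       \<le> ennreal (C * (2 powr (real CARD('n) / q * real_of_int k)
            * broken_log (pair_shift (prod.swap A - prod.swap B) (recip b)) (2 powi k)))
          * dist_lz_qnorm (ennreal q) c B (lp_block \<phi> k T)"
    using lp_block_nikolskii[OF assms(1,3) _ assms(6-8)] by (metis DIM_cart DIM_real mult_1_right)
  show ?thesis
    unfolding infinity_ennreal_def
    by (rule continuously_embeddedI[OF besov_qnorm_le[OF \<open>0 < u\<close> less_imp_le[OF \<open>0 < C\<close>] C]])
qed

end
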